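(* Let $G$ be a Morse local-to-global group and let $H$ be an infinite index stable subgroup of $G$. If $H$ is residually finite, then for any finite generating set $A$ of $G$, the growth rate of $H$ with respect to $A$ is strictly smaller than the growth rate of $G$ with respect to $A$, that is, $\lambda_{H,A}<\lambda_{G,A}$.
   Context: All finite generating sets are symmetric ($A=A^{-1}$). For a group $G$ with finite generating set $A$, $\mathrm{Cay}(G,A)$ is the Cayley graph (vertices $g\in G$, $g,h$ joined by an edge if $g^{-1}h\in A$, edges of length $1$), and $|g|$ is the distance from the identity $e$ to $g$. Growth: for a subgroup $H\le G$ (including $H=G$), $f_{H,A}(n)=|\{h\in H: |h|\le n\}|$ and $\lambda_{H,A}=\limsup_{n\to\infty}\sqrt[n]{f_{H,A}(n)}$. Morse quasi-geodesics: let $X$ be a metric space and $I\subseteq\mathbb{R}$ a closed interval. A map $\gamma:I\to X$ is a $(k,c)$-quasi-geodesic ($k\ge1$, $c\ge0$) if $\frac1k|s-t|-c\le d(\gamma(s),\gamma(t))\le k|s-t|+c$ for all $s,t\in I$; a geodesic is a $(1,0)$-quasi-geodesic. A Morse gauge is a function $M:[1,\infty)\times[0,\infty)\to[0,\infty)$. A quasi-geodesic $\gamma:I\to X$ is $M$-Morse if for every $[s,t]\subseteq I$, every $(k,c)$-quasi-geodesic with endpoints $\gamma(s),\gamma(t)$ is contained in the $M(k,c)$-neighborhood of $\gamma|_{[s,t]}$. An $(M;k,c)$-Morse quasi-geodesic is an $M$-Morse $(k,c)$-quasi-geodesic. For $B\ge0$, $\gamma:I\to X$ is a $(B;M;k,c)$-local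 Morse quasi-geodesic if $\gamma|_{[s,t]}$ is an $(M;k,c)$-Morse quasi-geodesic for every $[s,t]\subseteq I$ with $|s-t|\le B$. Morse local-to-global: $X$ is a Morse local-to-global space if for every Morse gauge $M$ and $k\ge1$, $c\ge0$ there exist $B\ge0$, a Morse gauge $M'$, and $k'\ge1$, $c'\ge0$ such that every $(B;M;k,c)$-local Morse quasi-geodesic is an $(M';k',c')$-Morse quasi-geodesic. A Morse local-to-global group is a finitely generated group some (equivalently, every) Cayley graph of which, with respect to a finite generating set, is a Morse local-to-global space. Stable subgroups: $H\le G$ is $(M,k)$-stable in $\mathrm{Cay}(G,A)$ if for every $h\in H$ every geodesic in $\mathrm{Cay}(G,A)$ from $e$ to $h$ is $M$-Morse and contained in the $k$-neighborhood of $H$. $H$ is stable if for every finite generating set $A$ of $G$ there exist $M$ and $k\ge0$ such that $H$ is $(M,k)$-stable in $\mathrm{Cay}(G,A)$.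
   Formalization: If H is finite, it is additionally assumed that the growth rate of G with respect to A exceeds 1; without this the claim fails, e.g. for G the integers and H trivial, where both growth rates equal 1. For infinite H nothing is added. *)

theory Defs
  imports "HOL-Analysis.Analysis" "HOL-Algebra.Generated_Groups"
begin

section \<open>Quasi-geodesics and the Morse property\<close>

definition closed_interval :: "real set \<Rightarrow> bool" where
  "closed_interval I \<longleftrightarrow> closed I \<and> is_interval I \<and> I \<noteq> {}"

definition quasi_geodesic ::
  "'p set \<Rightarrow> ('p \<Rightarrow> 'p \<Rightarrow> real) \<Rightarrow> real set \<Rightarrow> (real \<Rightarrow> 'p) \<Rightarrow> real \<Rightarrow> real \<Rightarrow> bool" where
  "quasi_geodesic X d I \<gamma> k c \<longleftrightarrow>
     1 \<le> k \<and> 0 \<le> c \<and> closed_interval I \<and> \<gamma> \<in> I \<rightarrow> X \<and>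
     (\<forall>s\<in>I. \<forall>t\<in>I. 1 / k * \<bar>s - t\<bar> - c \<le> d (\<gamma> s) (\<gamma> t) \<and> d (\<gamma> s) (\<gamma> t) \<le> k * \<bar>s - t\<bar> + c)"

abbreviation geodesic :: "'p set \<Rightarrow> ('p \<Rightarrow> 'p \<Rightarrow> real) \<Rightarrow> real set \<Rightarrow> (real \<Rightarrow> 'p) \<Rightarrow> bool" where
  "geodesic X d I \<gamma> \<equiv> quasi_geodesic X d I \<gamma> 1 0"

text \<open>Neighbourhoods are closed, so that radius 0 (allowed for Morse gauges) is meaningful.\<close>

definition neighbourhood :: "'p set \<Rightarrow> ('p \<Rightarrow> 'p \<Rightarrow> real) \<Rightarrow> real \<Rightarrow> 'p set \<Rightarrow> 'p set" where
  "neighbourhood X d r S = {x \<in> X. \<exists>y\<in>S. d x y \<le> r}"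

definition morse_gauge :: "(real \<Rightarrow> real \<Rightarrow> real) \<Rightarrow> bool" where
  "morse_gauge M \<longleftrightarrow> (\<forall>k\<ge>1. \<forall>c\<ge>0. 0 \<le> M k c)"

definition morse ::
  "'p set \<Rightarrow> ('p \<Rightarrow> 'p \<Rightarrow> real) \<Rightarrow> (real \<Rightarrow> real \<Rightarrow> real) \<Rightarrow> real set \<Rightarrow> (real \<Rightarrow> 'p) \<Rightarrow> bool" where
  "morse X d M I \<gamma> \<longleftrightarrow>
     (\<forall>s t. s \<le> t \<longrightarrow> {s..t} \<subseteq> I \<longrightarrow>
       (\<forall>k c a b \<eta>. k \<ge> 1 \<longrightarrow> c \<ge> 0 \<longrightarrow> a \<le> b \<longrightarrow> quasi_geodesic X d {a..b} \<eta> k c \<longrightarrow>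
          \<eta> a = \<gamma> s \<longrightarrow> \<eta> b = \<gamma> t \<longrightarrow>
          \<eta> ` {a..b} \<subseteq> neighbourhood X d (M k c) (\<gamma> ` {s..t})))"

definition morse_quasi_geodesic ::
  "'p set \<Rightarrow> ('p \<Rightarrow> 'p \<Rightarrow> real) \<Rightarrow> (real \<Rightarrow> real \<Rightarrow> real) \<Rightarrow> real \<Rightarrow> real \<Rightarrow>
     real set \<Rightarrow> (real \<Rightarrow> 'p) \<Rightarrow> bool" where
  "morse_quasi_geodesic X d M k c I \<gamma> \<longleftrightarrow> quasi_geodesic X d I \<gamma> k c \<and> morse X d M I \<gamma>"

definition local_morse_quasi_geodesic ::
  "'p set \<Rightarrow> ('p \<Rightarrow> 'p \<Rightarrow> real) \<Rightarrow> real \<Rightarrow> (real \<Rightarrow> real \<Rightarrow> real) \<Rightarrow> real \<Rightarrow> real \<Rightarrow>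
     real set \<Rightarrow> (real \<Rightarrow> 'p) \<Rightarrow> bool" where
  "local_morse_quasi_geodesic X d B M k c I \<gamma> \<longleftrightarrow>
     closed_interval I \<and> \<gamma> \<in> I \<rightarrow> X \<and>
     (\<forall>s t. s \<le> t \<longrightarrow> {s..t} \<subseteq> I \<longrightarrow> \<bar>s - t\<bar> \<le> B \<longrightarrow> morse_quasi_geodesic X d M k c {s..t} \<gamma>)"

definition morse_local_to_global_space :: "'p set \<Rightarrow> ('p \<Rightarrow> 'p \<Rightarrow> real) \<Rightarrow> bool" where
  "morse_local_to_global_space X d \<longleftrightarrow>
     (\<forall>M k c. morse_gauge M \<longrightarrow> k \<ge> 1 \<longrightarrow> c \<ge> 0 \<longrightarrow>
       (\<exists>B M' k' c'. B \<ge> 0 \<and> morse_gauge M' \<and> k' \<ge> 1 \<and> c' \<ge> 0 \<and>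
          (\<forall>I \<gamma>. local_morse_quasi_geodesic X d B M k c I \<gamma> \<longrightarrow>
             morse_quasi_geodesic X d M' k' c' I \<gamma>)))"


section \<open>Metric graphs\<close>

text \<open>
  The geometric realization of a graph with vertex set \<open>V\<close> and adjacency relation \<open>E\<close>, in
  barycentric coordinates: a point is a formal convex combination of two adjacent vertices.
  Loops of \<open>E\<close> contribute nothing to the realization.
\<close>

definition vertex :: "'a \<Rightarrow> ('a \<Rightarrow> real)" where
  "vertex v = (\<lambda>x. of_bool (x = v))"

definition edge_point :: "'a \<Rightarrow> 'a \<Rightarrow> real \<Rightarrow> ('a \<Rightarrow> real)" where
  "edge_point u v t = (\<lambda>x. (1 - t) * vertex u x + t * vertex v x)"

definition graph_points :: "'a set \<Rightarrow> ('a \<Rightarrow> 'a \<Rightarrow> bool) \<Rightarrow> ('a \<Rightarrow> real) set" where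
  "graph_points V E =
     vertex ` V \<union> {edge_point u v t |u v t. u \<in> V \<and> v \<in> V \<and> E u v \<and> t \<in> {0..1}}"

text \<open>\<open>graph_path V E p l q\<close>: a concatenation of segments, each contained in a single edge,
  leads from \<open>p\<close> to \<open>q\<close> and has total length \<open>l\<close>, where edges have length 1.\<close>

inductive graph_path ::
  "'a set \<Rightarrow> ('a \<Rightarrow> 'a \<Rightarrow> bool) \<Rightarrow> ('a \<Rightarrow> real) \<Rightarrow> real \<Rightarrow> ('a \<Rightarrow> real) \<Rightarrow> bool"
  for V E where
  refl: "p \<in> graph_points V E \<Longrightarrow> graph_path V E p 0 p"
| step: "\<lbrakk>graph_path V E p l (edge_point u v s); u \<in> V; v \<in> V; E u v; s \<in> {0..1}; t \<in> {0..1}\<rbrakk>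
     \<Longrightarrow> graph_path V E p (l + \<bar>s - t\<bar>) (edge_point u v t)"

text \<open>The value 0 off the realization is a dummy that makes this a \<^locale>\<open>Metric_space\<close>.\<close>

definition graph_dist ::
  "'a set \<Rightarrow> ('a \<Rightarrow> 'a \<Rightarrow> bool) \<Rightarrow> ('a \<Rightarrow> real) \<Rightarrow> ('a \<Rightarrow> real) \<Rightarrow> real" where
  "graph_dist V E p q =
     (if p \<in> graph_points V E \<and> q \<in> graph_points V E then Inf {l. graph_path V E p l q} else 0)"

lemma vertex_eq_edge_point: "vertex u = edge_point u v 0" "vertex v = edge_point u v 1"
  by (auto simp: edge_point_def vertex_def fun_eq_iff)

lemma edge_point_commute: "edge_point u v t = edge_point v u (1 - t)"
  by (auto simp: edge_point_def fun_eq_iff)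

lemma graph_path_points:
  "graph_path V E p l q \<Longrightarrow> p \<in> graph_points V E \<and> q \<in> graph_points V E"
  by (induction rule: graph_path.induct) (auto simp: graph_points_def)

lemma graph_path_coordinate:
  "graph_path V E p l q \<Longrightarrow> \<bar>p x - q x\<bar> \<le> l"
proof (induction rule: graph_path.induct)
  case (step p l u v s t)
  have "\<bar>edge_point u v s x - edge_point u v t x\<bar> \<le> \<bar>s - t\<bar>"
    by (auto simp: edge_point_def vertex_def)
  with step.IH show ?case by linarith
qed auto

lemma graph_path_trans:
  "graph_path V E q m r \<Longrightarrow> graph_path V E p l q \<Longrightarrow> graph_path V E p (l + m) r"
proof (induction rule: graph_path.induct)
  case (step q m u v s t)
  from graph_path.step[OF step.IH[OF step.prems] step.hyps(2-6)] show ?case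
    by (simp add: add.assoc)
qed auto

lemma graph_path_sym:
  "graph_path V E p l q \<Longrightarrow> graph_path V E q l p"
proof (induction rule: graph_path.induct)
  case (step p l u v s t)
  have "edge_point u v t \<in> graph_points V E"
    using step.hyps by (auto simp: graph_points_def)
  from graph_path.step[OF graph_path.refl[OF this] step.hyps(2-4) step.hyps(6,5)]
  have "graph_path V E (edge_point u v t) \<bar>s - t\<bar> (edge_point u v s)"
    by (simp add: abs_minus_commute)
  from graph_path_trans[OF step.IH this] show ?case by (simp add: add.commute)
qed (auto intro: graph_path.refl)

lemma graph_path_edge:
  assumes "u \<in> V" "v \<in> V" "E u v" "t \<in> {0..1}"
  shows "graph_path V E (vertex u) t (edge_point u v t)"
proof -
  have "vertex u \<in> graph_points V E" using assms by (auto simp: graph_points_def)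
  from graph_path.step[of V E _ 0 u v 0 t, folded vertex_eq_edge_point, OF graph_path.refl[OF this]]
  show ?thesis using assms by auto
qed

text \<open>Only connectedness on the vertices is needed for the path metric to be a metric.\<close>

lemma Metric_space_graph_dist:
  assumes conn: "\<And>u v. u \<in> V \<Longrightarrow> v \<in> V \<Longrightarrow> \<exists>l. graph_path V E (vertex u) l (vertex v)"
  shows "Metric_space (graph_points V E) (graph_dist V E)"
proof -
  let ?P = "graph_points V E" and ?S = "\<lambda>p q. {l. graph_path V E p l q}"
  have to_vertex: "\<exists>u\<in>V. \<exists>l. graph_path V E (vertex u) l p" if "p \<in> ?P" for p
  proof -
    from that consider u where "u \<in> V" "p = vertex u"
      | u v t where "u \<in> V" "v \<in> V" "E u v" "t \<in> {0..1}" "p = edge_point u v t"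
      unfolding graph_points_def by blast
    then show ?thesis
    proof cases
      case 1
      then show ?thesis using graph_path.refl[OF that] by blast
    next
      case 2
      then show ?thesis using graph_path_edge by metis
    qed
  qed
  have ne: "?S p q \<noteq> {}" if pq: "p \<in> ?P" "q \<in> ?P" for p q
  proof -
    obtain u l where u: "u \<in> V" "graph_path V E (vertex u) l p"
      using to_vertex[OF pq(1)] by blast
    obtain v m where v: "v \<in> V" "graph_path V E (vertex v) m q"
      using to_vertex[OF pq(2)] by blast
    obtain n where "graph_path V E (vertex u) n (vertex v)" using conn[OF u(1) v(1)] by blast
    from graph_path_trans[OF v(2) graph_path_trans[OF this graph_path_sym[OF u(2)]]]
    show ?thesis by blast
  qed
  have nonneg: "0 \<le> l" if "graph_path V E p l q" for p l q
    using graph_path_coordinate[OF that, of undefined] by linarith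
  then have bdd: "bdd_below (?S p q)" for p q by (intro bdd_belowI[of _ 0]) auto
  have Inf_nonneg: "0 \<le> Inf (?S p q)" if "p \<in> ?P" "q \<in> ?P" for p q
    using nonneg by (intro cInf_greatest[OF ne[OF that]]) auto
  have sym: "?S p q = ?S q p" for p q using graph_path_sym by blast
  show ?thesis
  proof
    show "0 \<le> graph_dist V E p q" for p q
      using Inf_nonneg by (simp add: graph_dist_def)
    show "graph_dist V E p q = graph_dist V E q p" for p q
      using sym[of p q] by (auto simp: graph_dist_def)
    show "graph_dist V E p q = 0 \<longleftrightarrow> p = q" if pq: "p \<in> ?P" "q \<in> ?P" for p q
    proof
      assume 0: "graph_dist V E p q = 0"
      have "\<bar>p x - q x\<bar> \<le> Inf (?S p q)" for x
        using graph_path_coordinate by (intro cInf_greatest[OF ne[OF pq]]) auto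
      then show "p = q" using 0 pq by (auto simp: graph_dist_def fun_eq_iff)
    next
      assume "p = q"
      then have "Inf (?S p q) \<le> 0" using graph_path.refl pq bdd by (intro cInf_lower) auto
      with Inf_nonneg[OF pq] show "graph_dist V E p q = 0" using pq by (simp add: graph_dist_def)
    qed
    show "graph_dist V E p r \<le> graph_dist V E p q + graph_dist V E q r"
      if pqr: "p \<in> ?P" "q \<in> ?P" "r \<in> ?P" for p q r
    proof -
      have "Inf (?S p r) - m \<le> Inf (?S p q)" if m: "m \<in> ?S q r" for m
      proof (rule cInf_greatest[OF ne[OF pqr(1,2)]])
        fix l assume "l \<in> ?S p q"
        then have "l + m \<in> ?S p r" using m graph_path_trans by blast
        then have "Inf (?S p r) \<le> l + m" using bdd by (rule cInf_lower)
        then show "Inf (?S p r) - m \<le> l" by simp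
      qed
      then have "Inf (?S p r) - Inf (?S p q) \<le> Inf (?S q r)"
        by (intro cInf_greatest[OF ne[OF pqr(2,3)]]) (auto simp: algebra_simps)
      then show ?thesis using pqr by (simp add: graph_dist_def)
    qed
  qed
qed


section \<open>Cayley graphs and growth\<close>

definition finite_sym_generating_set :: "('a, 'b) monoid_scheme \<Rightarrow> 'a set \<Rightarrow> bool" where
  "finite_sym_generating_set G A \<longleftrightarrow>
     finite A \<and> A \<subseteq> carrier G \<and> (\<lambda>a. inv\<^bsub>G\<^esub> a) ` A = A \<and> generate G A = carrier G"

definition cayley_adj :: "('a, 'b) monoid_scheme \<Rightarrow> 'a set \<Rightarrow> 'a \<Rightarrow> 'a \<Rightarrow> bool" where
  "cayley_adj G A g h \<longleftrightarrow> inv\<^bsub>G\<^esub> g \<otimes>\<^bsub>G\<^esub> h \<in> A"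

definition cayley_points :: "('a, 'b) monoid_scheme \<Rightarrow> 'a set \<Rightarrow> ('a \<Rightarrow> real) set" where
  "cayley_points G A = graph_points (carrier G) (cayley_adj G A)"

definition cayley_dist ::
  "('a, 'b) monoid_scheme \<Rightarrow> 'a set \<Rightarrow> ('a \<Rightarrow> real) \<Rightarrow> ('a \<Rightarrow> real) \<Rightarrow> real" where
  "cayley_dist G A = graph_dist (carrier G) (cayley_adj G A)"

lemma Metric_space_cayley:
  assumes "group G" "finite_sym_generating_set G A"
  shows "Metric_space (cayley_points G A) (cayley_dist G A)"
proof -
  interpret group G by fact
  have A: "A \<subseteq> carrier G" and inv_A: "\<And>a. a \<in> A \<Longrightarrow> inv\<^bsub>G\<^esub> a \<in> A"
    and gen: "generate G A = carrier G"
    using assms(2) by (auto simp: finite_sym_generating_set_def)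
  let ?path = "graph_path (carrier G) (cayley_adj G A)"
  have one: "\<exists>l. ?path (vertex u) l (vertex (u \<otimes>\<^bsub>G\<^esub> a))" if "a \<in> A" "u \<in> carrier G" for a u
  proof -
    have a: "a \<in> carrier G" using that A by auto
    then have "inv\<^bsub>G\<^esub> u \<otimes>\<^bsub>G\<^esub> (u \<otimes>\<^bsub>G\<^esub> a) = a"
      using that by (simp add: m_assoc[symmetric])
    then have "?path (vertex u) 1 (edge_point u (u \<otimes>\<^bsub>G\<^esub> a) 1)"
      using that a by (intro graph_path_edge) (auto simp: cayley_adj_def)
    then show ?thesis by (auto simp flip: vertex_eq_edge_point)
  qed
  have "\<exists>l. ?path (vertex u) l (vertex (u \<otimes>\<^bsub>G\<^esub> g))"
    if "g \<in> generate G A" "u \<in> carrier G" for g u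
    using that
  proof (induction arbitrary: u rule: generate.induct)
    case one
    then have "?path (vertex u) 0 (vertex u)"
      by (intro graph_path.refl) (simp add: graph_points_def)
    then show ?case using one.prems by auto
  next
    case (incl a)
    then show ?case using one by blast
  next
    case (inv a)
    then show ?case using one inv_A by blast
  next
    case (eng g h)
    have gh: "g \<in> carrier G" "h \<in> carrier G" using eng.hyps gen by auto
    obtain l where "?path (vertex u) l (vertex (u \<otimes>\<^bsub>G\<^esub> g))" using eng by blast
    moreover obtain m where "?path (vertex (u \<otimes>\<^bsub>G\<^esub> g)) m (vertex (u \<otimes>\<^bsub>G\<^esub> g \<otimes>\<^bsub>G\<^esub> h))"
      using eng.IH(2)[of "u \<otimes>\<^bsub>G\<^esub> g"] eng.prems gh by auto
    ultimately have "?path (vertex u) (l + m) (vertex (u \<otimes>\<^bsub>G\<^esub> g \<otimes>\<^bsub>G\<^esub> h))"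
      by (intro graph_path_trans)
    then show ?case using eng.prems gh by (auto simp: m_assoc)
  qed
  note path = this
  have "\<exists>l. ?path (vertex u) l (vertex v)" if "u \<in> carrier G" "v \<in> carrier G" for u v
  proof -
    have "u \<otimes>\<^bsub>G\<^esub> (inv\<^bsub>G\<^esub> u \<otimes>\<^bsub>G\<^esub> v) = v"
      using that by (simp add: m_assoc[symmetric])
    then show ?thesis using path[of "inv\<^bsub>G\<^esub> u \<otimes>\<^bsub>G\<^esub> v" u] that gen by simp
  qed
  then show ?thesis
    unfolding cayley_points_def cayley_dist_def by (rule Metric_space_graph_dist)
qed

definition word_norm :: "('a, 'b) monoid_scheme \<Rightarrow> 'a set \<Rightarrow> 'a \<Rightarrow> real" where
  "word_norm G A g = cayley_dist G A (vertex \<one>\<^bsub>G\<^esub>) (vertex g)"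

definition growth_fun :: "('a, 'b) monoid_scheme \<Rightarrow> 'a set \<Rightarrow> 'a set \<Rightarrow> nat \<Rightarrow> nat" where
  "growth_fun G A H n = card {h \<in> H. word_norm G A h \<le> real n}"

definition growth_rate :: "('a, 'b) monoid_scheme \<Rightarrow> 'a set \<Rightarrow> 'a set \<Rightarrow> ereal" where
  "growth_rate G A H = limsup (\<lambda>n. ereal (root n (real (growth_fun G A H n))))"


section \<open>Classes of groups and subgroups\<close>

definition morse_local_to_global_group :: "('a, 'b) monoid_scheme \<Rightarrow> bool" where
  "morse_local_to_global_group G \<longleftrightarrow>
     group G \<and>
     (\<exists>A. finite_sym_generating_set G A \<and>
          morse_local_to_global_space (cayley_points G A) (cayley_dist G A))"

definition stable_in_cayley ::
  "('a, 'b) monoid_scheme \<Rightarrow> 'a set \<Rightarrow> 'a set \<Rightarrow> (real \<Rightarrow> real \<Rightarrow> real) \<Rightarrow> real \<Rightarrow> bool" where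
  "stable_in_cayley G A H M k \<longleftrightarrow>
     (\<forall>h\<in>H. \<forall>a b \<gamma>. a \<le> b \<longrightarrow> geodesic (cayley_points G A) (cayley_dist G A) {a..b} \<gamma> \<longrightarrow>
        \<gamma> a = vertex \<one>\<^bsub>G\<^esub> \<longrightarrow> \<gamma> b = vertex h \<longrightarrow>
        morse (cayley_points G A) (cayley_dist G A) M {a..b} \<gamma> \<and>
        \<gamma> ` {a..b} \<subseteq> neighbourhood (cayley_points G A) (cayley_dist G A) k (vertex ` H))"

definition stable_subgroup :: "('a, 'b) monoid_scheme \<Rightarrow> 'a set \<Rightarrow> bool" where
  "stable_subgroup G H \<longleftrightarrow>
     subgroup H G \<and>
     (\<forall>A. finite_sym_generating_set G A \<longrightarrow>
        (\<exists>M k. morse_gauge M \<and> k \<ge> 0 \<and> stable_in_cayley G A H M k))"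

definition residually_finite :: "('a, 'b) monoid_scheme \<Rightarrow> bool" where
  "residually_finite K \<longleftrightarrow>
     group K \<and>
     (\<forall>x\<in>carrier K. x \<noteq> \<one>\<^bsub>K\<^esub> \<longrightarrow> (\<exists>N. N \<lhd> K \<and> finite (rcosets\<^bsub>K\<^esub> N) \<and> x \<notin> N))"

end

theory Submission
  imports Defs
begin

text \<open>
  Let \<open>\<mu>\<close> be the growth rate of \<open>H\<close> and \<open>|x|\<close> the length of \<open>x\<close>, both with respect to \<open>A\<close>.  If \<open>H\<close> is
  finite, then \<open>\<mu> \<le> 1\<close>, and the last hypothesis applies.  Let \<open>H\<close> be infinite, and \<open>q = 1 / \<mu>\<close>.

  Counting.  A geodesic from \<open>1\<close> to an element of \<open>H\<close> stays near \<open>H\<close>, so it can be cut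
  anywhere into two pieces that almost represent elements of \<open>H\<close>.  Therefore
  \<open>n \<mapsto> f\<^sub>H(n + const)\<close> is submultiplicative and at least \<open>\<mu>\<^sup>n\<close>
  (\<open>growth_rate_le_submult\<close>), and the sum of \<open>q\<^bsup>|h|\<^esup>\<close> over \<open>H\<close>, or over a subgroup \<open>K\<close> of
  finite index, diverges (\<open>poincare_diverges\<close>).  Suppose that for some \<open>g\<close> in \<open>G\<close> the
  products \<open>h\<^sub>1 g h\<^sub>2 g \<dots> h\<^sub>m g\<close> with nontrivial factors \<open>h\<^sub>i\<close> in \<open>K\<close> are pairwise distinct.
  Divergence gives a finite set \<open>T\<close> of nontrivial elements of \<open>K\<close> such that the sum of
  \<open>q\<^bsup>|h| + |g|\<^esup>\<close> over \<open>T\<close> exceeds 1, and the words of length \<open>m\<close> over \<open>T\<close> then contribute the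
  \<open>m\<close>-th power of this sum to the corresponding sum over \<open>G\<close>.  This forces the growth rate of \<open>G\<close> above
  \<open>\<mu>\<close> (\<open>growth_rate_gt_of_injective\<close>).

  Geometry.  The pair \<open>g\<close>, \<open>K\<close> is found in the word metric of a generating set whose Cayley
  graph has the local-to-global property.  The hypotheses are moved from the Cayley graph to
  its vertices, because quasi-geodesics may be discontinuous: rounding a path to vertices,
  moving its endpoints by a bounded amount, or inserting a jump of bounded size only changes
  the additive constant.  The one tool for producing quasi-geodesics is to run along a given one
  up to a point nearest to some \<open>e\<close>, and then straight to \<open>e\<close> (\<open>qg_concat\<close>).

  Some conjugate \<open>gHg\<^bsup>-1\<^esup>\<close> meets \<open>H\<close> in a finite set
  (\<open>exists_finite_conjugate_intersection\<close>).  Otherwise any two left cosets of \<open>H\<close>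
  come uniformly close to each other; by a Helly-type argument any finite family of cosets then
  meets a single ball of fixed radius, so that \<open>H\<close> has finite index.  For this \<open>g\<close> the cosets
  \<open>H\<close> and \<open>gH\<close> diverge, and a path in \<open>H\<close> followed by one in \<open>gH\<close> is a Morse quasi-geodesic
  with constants that depend on \<open>g\<close> but not on the two lengths
  (\<open>junction_uniformly_morse\<close>).  The local-to-global property provides a scale \<open>B\<close> for these
  constants, and residual finiteness a subgroup \<open>K\<close> of finite index in \<open>H\<close> whose nontrivial
  elements are longer than \<open>B\<close>.  On the scale \<open>B\<close> the path of a word that alternates between
  nontrivial elements of \<open>K\<close> and \<open>g\<close> or its inverse sees at most one junction, so it is a
  quasi-geodesic, and its endpoints differ (\<open>alternating_word_long\<close>).  Two distinct products with
  equal values would cancel to a nonempty alternating word with value \<open>1\<close> or \<open>g\<close>, which is too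
  short (\<open>alt_prod_injective\<close>).
\<close>

section \<open>Word metrics\<close>

lemma closed_interval_Icc [simp]: "closed_interval {a..b::real} \<longleftrightarrow> a \<le> b"
  by (simp add: closed_interval_def is_interval_cc)

locale word_metric = group G for G :: "('a, 'b) monoid_scheme" (structure) +
  fixes A :: "'a set"
  assumes generating: "finite_sym_generating_set G A"
begin

lemma inv_cancel: "x \<in> carrier G \<Longrightarrow> y \<in> carrier G \<Longrightarrow> inv x \<otimes> (x \<otimes> y) = y"
    "x \<in> carrier G \<Longrightarrow> y \<in> carrier G \<Longrightarrow> x \<otimes> (inv x \<otimes> y) = y"
  by (simp_all flip: m_assoc)

lemmas word_simps = inv_mult_group m_assoc inv_cancel

lemma finite_A: "finite A" and A_carrier: "a \<in> A \<Longrightarrow> a \<in> carrier G"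
  and inv_A: "a \<in> A \<Longrightarrow> inv a \<in> A" and generate_A: "generate G A = carrier G"
  using generating by (auto simp: finite_sym_generating_set_def)

text \<open>
  Words grow at the right end, so that the prefixes of a word are the vertices of a path from
  \<open>\<one>\<close> in the Cayley graph, whose edges are right multiplications.
\<close>

inductive spells :: "nat \<Rightarrow> 'a \<Rightarrow> bool" where
  Nil: "spells 0 \<one>"
| Snoc: "spells n x \<Longrightarrow> a \<in> A \<Longrightarrow> spells (Suc n) (x \<otimes> a)"

lemma spells_carrier: "spells n x \<Longrightarrow> x \<in> carrier G"
  by (induction rule: spells.induct) (auto simp: A_carrier)

lemma spells_mult: "spells n y \<Longrightarrow> spells m x \<Longrightarrow> spells (m + n) (x \<otimes> y)"
proof (induction rule: spells.induct)
  case Nil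
  then show ?case by (simp add: spells_carrier)
next
  case (Snoc n y a)
  then have "spells (Suc (m + n)) (x \<otimes> y \<otimes> a)" by (intro spells.Snoc) auto
  then show ?case using Snoc by (simp add: m_assoc spells_carrier A_carrier)
qed

lemma spells_generator: "a \<in> A \<Longrightarrow> spells 1 a"
  using spells.Snoc[OF spells.Nil, of a] by (simp add: A_carrier)

lemma spells_inv: "spells n x \<Longrightarrow> spells n (inv x)"
proof (induction rule: spells.induct)
  case Nil
  then show ?case by (simp add: spells.Nil)
next
  case (Snoc n x a)
  then have "spells (1 + n) (inv a \<otimes> inv x)"
    by (intro spells_mult) (auto simp: inv_A intro: spells_generator[simplified])
  then show ?case using Snoc by (simp add: inv_mult_group spells_carrier A_carrier)
qed

lemma spells_exists: assumes "x \<in> carrier G" shows "\<exists>n. spells n x"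
proof -
  have "x \<in> generate G A" using assms generate_A by simp
  then show ?thesis
  proof (induction rule: generate.induct)
    case one
    then show ?case using spells.Nil by blast
  next
    case (incl a)
    then show ?case using spells_generator by blast
  next
    case (inv a)
    then show ?case using spells_generator inv_A by blast
  next
    case (eng g h)
    then show ?case using spells_mult by blast
  qed
qed

lemma finite_spells: "finite {x. spells n x}"
proof (induction n)
  case 0
  have "{x. spells 0 x} \<subseteq> {\<one>}" by (auto elim: spells.cases)
  then show ?case by (rule finite_subset) simp
next
  case (Suc n)
  have "{x. spells (Suc n) x} \<subseteq> (\<lambda>(x, a). x \<otimes> a) ` ({x. spells n x} \<times> A)"
    by (auto elim: spells.cases)
  then show ?case by (rule finite_subset) (simp add: Suc finite_A)
qed

definition wlen :: "'a \<Rightarrow> nat" where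
  "wlen x = (LEAST n. spells n x)"

lemma spells_wlen: "x \<in> carrier G \<Longrightarrow> spells (wlen x) x"
  unfolding wlen_def by (rule LeastI_ex[OF spells_exists])

lemma wlen_le: "spells n x \<Longrightarrow> wlen x \<le> n"
  unfolding wlen_def by (rule Least_le)

lemma wlen_one [simp]: "wlen \<one> = 0"
  using wlen_le[OF spells.Nil] by simp

lemma wlen_eq_0: "x \<in> carrier G \<Longrightarrow> wlen x = 0 \<longleftrightarrow> x = \<one>"
  using spells_wlen[of x] by (auto elim: spells.cases)

lemma wlen_mult: "x \<in> carrier G \<Longrightarrow> y \<in> carrier G \<Longrightarrow> wlen (x \<otimes> y) \<le> wlen x + wlen y"
  by (intro wlen_le spells_mult spells_wlen)

lemma wlen_inv: assumes "x \<in> carrier G" shows "wlen (inv x) = wlen x"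
  using wlen_le[OF spells_inv[OF spells_wlen[OF assms]]]
    wlen_le[OF spells_inv[OF spells_wlen[of "inv x"]]] assms by simp

lemma finite_ball: "finite {x \<in> carrier G. wlen x \<le> n}"
proof (rule finite_subset)
  show "{x \<in> carrier G. wlen x \<le> n} \<subseteq> (\<Union>m\<le>n. {x. spells m x})"
    using spells_wlen by blast
qed (simp add: finite_spells)

definition wdist :: "'a \<Rightarrow> 'a \<Rightarrow> real" where
  "wdist x y = real (wlen (inv x \<otimes> y))"

lemma wdist_nonneg [simp]: "0 \<le> wdist x y"
  by (simp add: wdist_def)

lemma wdist_self [simp]: "x \<in> carrier G \<Longrightarrow> wdist x x = 0"
  by (simp add: wdist_def)

lemma wdist_eq_0: "x \<in> carrier G \<Longrightarrow> y \<in> carrier G \<Longrightarrow> wdist x y = 0 \<longleftrightarrow> x = y"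
  using wlen_eq_0[of "inv x \<otimes> y"] inv_cancel(2)[of x y] by (auto simp: wdist_def)

lemma wdist_commute: "x \<in> carrier G \<Longrightarrow> y \<in> carrier G \<Longrightarrow> wdist x y = wdist y x"
  using wlen_inv[of "inv x \<otimes> y"] by (simp add: wdist_def inv_mult_group)

lemma wdist_one: "x \<in> carrier G \<Longrightarrow> wdist \<one> x = real (wlen x)"
  by (simp add: wdist_def)

lemma wdist_triangle:
  assumes "x \<in> carrier G" "y \<in> carrier G" "z \<in> carrier G"
  shows "wdist x z \<le> wdist x y + wdist y z"
proof -
  have "inv x \<otimes> z = (inv x \<otimes> y) \<otimes> (inv y \<otimes> z)"
    using assms by (simp add: word_simps)
  then show ?thesis
    using wlen_mult[of "inv x \<otimes> y" "inv y \<otimes> z"] assms by (simp add: wdist_def)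
qed

lemma wdist_left_invariant:
  assumes "g \<in> carrier G" "x \<in> carrier G" "y \<in> carrier G"
  shows "wdist (g \<otimes> x) (g \<otimes> y) = wdist x y"
proof -
  have "inv (g \<otimes> x) \<otimes> (g \<otimes> y) = inv x \<otimes> y"
    using assms by (simp add: word_simps)
  then show ?thesis by (simp add: wdist_def)
qed

lemma wdist_mult_right: "x \<in> carrier G \<Longrightarrow> y \<in> carrier G \<Longrightarrow> wdist x (x \<otimes> y) = real (wlen y)"
  using wdist_left_invariant[of x \<one> y] by (simp add: wdist_one)

section \<open>Geodesic words and quasi-geodesics\<close>

lemma spells_path:
  "spells n x \<Longrightarrow> \<exists>p. p 0 = \<one> \<and> p n = x \<and> (\<forall>i. p i \<in> carrier G) \<and> (\<forall>i<n. \<exists>a\<in>A. p (Suc i) = p i \<otimes> a)"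
proof (induction rule: spells.induct)
  case Nil
  then show ?case by (intro exI[of _ "\<lambda>_. \<one>"]) auto
next
  case (Snoc n x a)
  then obtain p where p: "p 0 = \<one>" "p n = x" "\<And>i. p i \<in> carrier G"
    "\<And>i. i < n \<Longrightarrow> \<exists>a\<in>A. p (Suc i) = p i \<otimes> a" by blast
  show ?case
    using p Snoc A_carrier[of a]
    by (intro exI[of _ "\<lambda>i. if i \<le> n then p i else x \<otimes> a"]) (auto simp: less_Suc_eq spells_carrier)
qed

definition geoword :: "'a \<Rightarrow> nat \<Rightarrow> 'a" where
  "geoword x = (SOME p. p 0 = \<one> \<and> p (wlen x) = x \<and> (\<forall>i. p i \<in> carrier G) \<and>
     (\<forall>i<wlen x. \<exists>a\<in>A. p (Suc i) = p i \<otimes> a))"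

lemma geoword:
  assumes "x \<in> carrier G"
  shows "geoword x 0 = \<one>" "geoword x (wlen x) = x" "geoword x i \<in> carrier G"
    "i < wlen x \<Longrightarrow> \<exists>a\<in>A. geoword x (Suc i) = geoword x i \<otimes> a"
  using someI_ex[OF spells_path[OF spells_wlen[OF assms]]] unfolding geoword_def by blast+

lemma geoword_le:
  assumes "x \<in> carrier G" "i + j \<le> wlen x"
  shows "wdist (geoword x i) (geoword x (i + j)) \<le> real j"
  using assms(2)
proof (induction j)
  case 0
  then show ?case using geoword(3)[OF assms(1)] by simp
next
  case (Suc j)
  then obtain a where a: "a \<in> A" "geoword x (Suc (i + j)) = geoword x (i + j) \<otimes> a"
    using geoword(4)[OF assms(1), of "i + j"] by auto
  have "wdist (geoword x (i + j)) (geoword x (Suc (i + j))) \<le> 1"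
    using a geoword(3)[OF assms(1)] wlen_le[OF spells_generator[OF a(1)]]
    by (simp add: wdist_mult_right A_carrier)
  moreover have "wdist (geoword x i) (geoword x (i + j)) \<le> real j" using Suc by simp
  ultimately show ?case
    using wdist_triangle[of "geoword x i" "geoword x (i + j)" "geoword x (Suc (i + j))"]
      geoword(3)[OF assms(1)] by simp
qed

text \<open>
  If some subpath were shorter than its number of letters, the whole word could be shortened.
\<close>

lemma geoword_dist:
  assumes x: "x \<in> carrier G" and ij: "i \<le> j" "j \<le> wlen x"
  shows "wdist (geoword x i) (geoword x j) = real j - real i"
proof -
  note c = geoword(3)[OF x]
  have "real (wlen x) = wdist (geoword x 0) (geoword x (wlen x))"
    using geoword(1,2)[OF x] wdist_one[OF x] by simp
  also have "\<dots> \<le> wdist (geoword x 0) (geoword x i) + wdist (geoword x i) (geoword x j)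
     + wdist (geoword x j) (geoword x (wlen x))"
    using wdist_triangle[of "geoword x 0" "geoword x i" "geoword x (wlen x)"]
      wdist_triangle[of "geoword x i" "geoword x j" "geoword x (wlen x)"] c by fastforce
  finally show ?thesis
    using geoword_le[OF x, of 0 i] geoword_le[OF x, of i "j - i"] ij
      geoword_le[OF x, of j "wlen x - j"] by simp
qed

text \<open>
  A geodesic word from \<open>x\<close> to \<open>y\<close> as a path with real parameter: it stays at a vertex for one
  unit of time and then jumps to the next one. The jumps cost an additive constant 1.
\<close>

definition geo :: "'a \<Rightarrow> 'a \<Rightarrow> real \<Rightarrow> 'a" where
  "geo x y t = x \<otimes> geoword (inv x \<otimes> y) (nat \<lfloor>t\<rfloor>)"

lemma geo_carrier [simp]: "x \<in> carrier G \<Longrightarrow> y \<in> carrier G \<Longrightarrow> geo x y t \<in> carrier G"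
  by (simp add: geo_def geoword)

lemma geo_0: "x \<in> carrier G \<Longrightarrow> y \<in> carrier G \<Longrightarrow> geo x y 0 = x"
  by (simp add: geo_def geoword)

lemma geo_end: "x \<in> carrier G \<Longrightarrow> y \<in> carrier G \<Longrightarrow> geo x y (wdist x y) = y"
  by (simp add: geo_def geoword wdist_def word_simps)

lemma geo_mult:
  assumes "g \<in> carrier G" "x \<in> carrier G" "y \<in> carrier G"
  shows "geo (g \<otimes> x) (g \<otimes> y) t = g \<otimes> geo x y t"
proof -
  have "inv (g \<otimes> x) \<otimes> (g \<otimes> y) = inv x \<otimes> y"
    using assms by (simp add: word_simps)
  then show ?thesis using assms by (simp add: geo_def m_assoc geoword)
qed

lemma geo_dist:
  assumes "x \<in> carrier G" "y \<in> carrier G" "0 \<le> s" "s \<le> t" "t \<le> wdist x y"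
  shows "t - s - 1 \<le> wdist (geo x y s) (geo x y t)" "wdist (geo x y s) (geo x y t) \<le> t - s + 1"
proof -
  have "nat \<lfloor>t\<rfloor> \<le> wlen (inv x \<otimes> y)"
    using assms by (simp add: wdist_def nat_le_iff floor_le_iff)
  moreover have "nat \<lfloor>s\<rfloor> \<le> nat \<lfloor>t\<rfloor>"
    using assms by (intro nat_mono floor_mono)
  ultimately have "wdist (geo x y s) (geo x y t) = real (nat \<lfloor>t\<rfloor>) - real (nat \<lfloor>s\<rfloor>)"
    using assms by (simp add: geo_def wdist_left_invariant geoword geoword_dist)
  then have "wdist (geo x y s) (geo x y t) = real_of_int \<lfloor>t\<rfloor> - real_of_int \<lfloor>s\<rfloor>"
    using assms by simp
  then show "t - s - 1 \<le> wdist (geo x y s) (geo x y t)" "wdist (geo x y s) (geo x y t) \<le> t - s + 1"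
    by linarith+
qed


abbreviation qg :: "real \<Rightarrow> real \<Rightarrow> (real \<Rightarrow> 'a) \<Rightarrow> real \<Rightarrow> real \<Rightarrow> bool" where
  "qg a b \<equiv> quasi_geodesic (carrier G) wdist {a..b}"

text \<open>
  Ordered parameters and a multiplicative form of the lower bound spare later proofs the
  absolute values and quotients of the definition.
\<close>

lemma qgI:
  assumes "1 \<le> k" "0 \<le> c" "a \<le> b" "\<And>t. t \<in> {a..b} \<Longrightarrow> \<eta> t \<in> carrier G"
    "\<And>s t. a \<le> s \<Longrightarrow> s \<le> t \<Longrightarrow> t \<le> b \<Longrightarrow> t - s \<le> k * (wdist (\<eta> s) (\<eta> t) + c)"
    "\<And>s t. a \<le> s \<Longrightarrow> s \<le> t \<Longrightarrow> t \<le> b \<Longrightarrow> wdist (\<eta> s) (\<eta> t) \<le> k * (t - s) + c"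
  shows "qg a b \<eta> k c"
proof -
  have *: "1 / k * \<bar>s - t\<bar> - c \<le> wdist (\<eta> s) (\<eta> t) \<and> wdist (\<eta> s) (\<eta> t) \<le> k * \<bar>s - t\<bar> + c"
    if "a \<le> s" "s \<le> t" "t \<le> b" for s t
    using assms(1) assms(5,6)[OF that] that by (auto simp: field_simps)
  have "1 / k * \<bar>s - t\<bar> - c \<le> wdist (\<eta> s) (\<eta> t) \<and> wdist (\<eta> s) (\<eta> t) \<le> k * \<bar>s - t\<bar> + c"
    if "s \<in> {a..b}" "t \<in> {a..b}" for s t
  proof (cases "s \<le> t")
    case True
    then show ?thesis using *[of s t] that by auto
  next
    case False
    then show ?thesis using *[of t s] that assms(4)[of s] assms(4)[of t]
      by (simp add: wdist_commute abs_minus_commute)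
  qed
  then show ?thesis using assms(1-4) by (auto simp: quasi_geodesic_def)
qed

lemma qgD:
  assumes "qg a b \<eta> k c"
  shows "1 \<le> k" "0 \<le> c" "a \<le> b" "t \<in> {a..b} \<Longrightarrow> \<eta> t \<in> carrier G"
    "a \<le> s \<Longrightarrow> s \<le> t \<Longrightarrow> t \<le> b \<Longrightarrow> t - s \<le> k * (wdist (\<eta> s) (\<eta> t) + c)"
    "a \<le> s \<Longrightarrow> s \<le> t \<Longrightarrow> t \<le> b \<Longrightarrow> wdist (\<eta> s) (\<eta> t) \<le> k * (t - s) + c"
proof -
  show 1: "1 \<le> k" "0 \<le> c" "a \<le> b" "t \<in> {a..b} \<Longrightarrow> \<eta> t \<in> carrier G"
    using assms by (auto simp: quasi_geodesic_def)
  assume "a \<le> s" "s \<le> t" "t \<le> b"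
  then have "s \<in> {a..b}" "t \<in> {a..b}" by auto
  then have "1 / k * \<bar>s - t\<bar> - c \<le> wdist (\<eta> s) (\<eta> t)" "wdist (\<eta> s) (\<eta> t) \<le> k * \<bar>s - t\<bar> + c"
    using assms unfolding quasi_geodesic_def by simp_all
  with 1 \<open>s \<le> t\<close> show "t - s \<le> k * (wdist (\<eta> s) (\<eta> t) + c)" "wdist (\<eta> s) (\<eta> t) \<le> k * (t - s) + c"
    by (auto simp: field_simps)
qed

lemma qg_geo:
  assumes "x \<in> carrier G" "y \<in> carrier G"
  shows "qg 0 (wdist x y) (geo x y) 1 1"
  using assms geo_dist[OF assms] by (intro qgI) (auto simp: algebra_simps)

section \<open>The metric of the Cayley graph on vertices\<close>

abbreviation "\<Gamma> \<equiv> cayley_points G A"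
abbreviation "d\<^sub>\<Gamma> \<equiv> cayley_dist G A"
abbreviation "path\<^sub>\<Gamma> \<equiv> graph_path (carrier G) (cayley_adj G A)"

lemma cayley_metric: "Metric_space \<Gamma> d\<^sub>\<Gamma>"
  by (rule Metric_space_cayley[OF is_group generating])

sublocale \<Gamma>: Metric_space \<Gamma> d\<^sub>\<Gamma>
  by (rule cayley_metric)

lemma vertex_in [simp]: "x \<in> carrier G \<Longrightarrow> vertex x \<in> \<Gamma>"
  by (simp add: cayley_points_def graph_points_def)

lemma cayley_dist_le: "path\<^sub>\<Gamma> p l q \<Longrightarrow> d\<^sub>\<Gamma> p q \<le> l"
proof -
  assume l: "path\<^sub>\<Gamma> p l q"
  have "bdd_below {l. path\<^sub>\<Gamma> p l q}"
    using graph_path_coordinate by (intro bdd_belowI[of _ 0]) fastforce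
  then show ?thesis using l graph_path_points[OF l]
    by (auto simp: cayley_dist_def graph_dist_def intro: cInf_lower)
qed

lemma cayley_dist_same_edge:
  assumes "u \<in> carrier G" "v \<in> carrier G" "cayley_adj G A u v" "s \<in> {0..1}" "t \<in> {0..1}"
  shows "d\<^sub>\<Gamma> (edge_point u v s) (edge_point u v t) \<le> \<bar>s - t\<bar>"
proof -
  have "edge_point u v s \<in> graph_points (carrier G) (cayley_adj G A)"
    using assms by (auto simp: graph_points_def)
  from graph_path.step[OF graph_path.refl[OF this] assms] show ?thesis
    by (auto dest: cayley_dist_le)
qed

lemma adj_wdist: "u \<in> carrier G \<Longrightarrow> v \<in> carrier G \<Longrightarrow> cayley_adj G A u v \<Longrightarrow> wdist u v \<le> 1"
  unfolding cayley_adj_def wdist_def using wlen_le[OF spells_generator] by auto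

text \<open>
  The invariant is kept for both endpoints of the edge that contains \<open>q\<close>: the endpoint \<open>v\<close> lies
  at distance \<open>1 - q v\<close> from \<open>q\<close>, since \<open>q v\<close> is the barycentric coordinate. With only one
  endpoint, a path that turns back inside an edge could not be followed.
\<close>

lemma graph_path_wdist:
  assumes "path\<^sub>\<Gamma> p l q" "p = vertex u" "u \<in> carrier G"
  shows "\<forall>v\<in>carrier G. q v > 0 \<longrightarrow> wdist u v \<le> l + 1 - q v"
  using assms
proof (induction rule: graph_path.induct)
  case (refl p)
  then show ?case by (auto simp: vertex_def)
next
  case (step p l a b s t)
  then have IH: "\<And>v. v \<in> carrier G \<Longrightarrow> edge_point a b s v > 0 \<Longrightarrow> wdist u v \<le> l + 1 - edge_point a b s v"
    by auto
  have ab: "wdist a b \<le> 1" "wdist b a \<le> 1"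
    using adj_wdist[of a b] step wdist_commute[of a b] by auto
  have tri: "wdist u a \<le> wdist u b + wdist b a" "wdist u b \<le> wdist u a + wdist a b"
    using wdist_triangle step by auto
  show ?case
  proof (cases "a = b")
    case True
    then have "edge_point a b s = vertex a" "edge_point a b t = vertex a"
      by (auto simp: edge_point_def fun_eq_iff algebra_simps)
    then show ?thesis using IH by fastforce
  next
    case False
    have "wdist u a \<le> l + s" "wdist u b \<le> l + 1 - s"
    proof -
      have "s < 1 \<Longrightarrow> wdist u a \<le> l + s" "s > 0 \<Longrightarrow> wdist u b \<le> l + 1 - s"
        using IH[of a] IH[of b] False step by (auto simp: edge_point_def vertex_def)
      moreover have "s = 0 \<or> s = 1 \<or> 0 < s \<and> s < 1" using step by auto
      ultimately show "wdist u a \<le> l + s" "wdist u b \<le> l + 1 - s" using tri ab by auto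
    qed
    then show ?thesis using False by (auto simp: edge_point_def vertex_def)
  qed
qed

lemma adj_geoword: "x \<in> carrier G \<Longrightarrow> i < wlen x \<Longrightarrow> cayley_adj G A (geoword x i) (geoword x (Suc i))"
  using geoword(4)[of x i] geoword(3)[of x] A_carrier
  by (auto simp: cayley_adj_def m_assoc[symmetric])

lemma translate_adj:
  "g \<in> carrier G \<Longrightarrow> x \<in> carrier G \<Longrightarrow> y \<in> carrier G \<Longrightarrow>
   cayley_adj G A (g \<otimes> x) (g \<otimes> y) \<longleftrightarrow> cayley_adj G A x y"
  by (simp add: cayley_adj_def word_simps)

lemma graph_path_geoword:
  assumes u: "u \<in> carrier G" and x: "x \<in> carrier G"
  shows "n \<le> wlen x \<Longrightarrow> path\<^sub>\<Gamma> (vertex u) (real n) (vertex (u \<otimes> geoword x n))"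
proof (induction n)
  case 0
  then show ?case
    using u x by (auto simp: geoword graph_points_def intro: graph_path.refl)
next
  case (Suc n)
  note c = geoword(3)[OF x]
  have "cayley_adj G A (u \<otimes> geoword x n) (u \<otimes> geoword x (Suc n))"
    using Suc.prems u x c by (subst translate_adj) (auto intro: adj_geoword)
  then have "path\<^sub>\<Gamma> (vertex u) (real n + \<bar>0 - 1\<bar>) (edge_point (u \<otimes> geoword x n) (u \<otimes> geoword x (Suc n)) 1)"
    using Suc u c by (intro graph_path.step) (auto simp flip: vertex_eq_edge_point)
  then show ?case by (simp add: add.commute flip: vertex_eq_edge_point)
qed

lemma cayley_dist_vertex:
  assumes u: "u \<in> carrier G" and v: "v \<in> carrier G"
  shows "d\<^sub>\<Gamma> (vertex u) (vertex v) = wdist u v"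
proof -
  have path: "path\<^sub>\<Gamma> (vertex u) (wdist u v) (vertex v)"
    using graph_path_geoword[OF u, of "inv u \<otimes> v" "wlen (inv u \<otimes> v)"] u v
    by (simp add: geoword wdist_def word_simps)
  have "wdist u v \<le> l" if "path\<^sub>\<Gamma> (vertex u) l (vertex v)" for l
    using graph_path_wdist[OF that HOL.refl u] v by (auto simp: vertex_def)
  then have "wdist u v \<le> Inf {l. path\<^sub>\<Gamma> (vertex u) l (vertex v)}"
    using path by (intro cInf_greatest) auto
  then have "wdist u v \<le> d\<^sub>\<Gamma> (vertex u) (vertex v)"
    using vertex_in[OF u] vertex_in[OF v]
    by (simp add: cayley_dist_def graph_dist_def cayley_points_def)
  with cayley_dist_le[OF path] show ?thesis by simp
qed

end

lemma image_neighbourhoodD: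
  "f ` S \<subseteq> neighbourhood X d r (g ` T) \<Longrightarrow> x \<in> S \<Longrightarrow> \<exists>y\<in>T. d (f x) (g y) \<le> r"
  by (auto simp: neighbourhood_def)

context word_metric begin

section \<open>Geodesics of the Cayley graph\<close>

text \<open>
  Stability speaks of geodesics in the Cayley graph, so one has to exist for every \<open>x\<close>: the path
  that traverses the edges of a geodesic word at unit speed.
\<close>

definition edge_geo :: "'a \<Rightarrow> real \<Rightarrow> ('a \<Rightarrow> real)" where
  "edge_geo x t = edge_point (geoword x (nat \<lfloor>t\<rfloor>)) (geoword x (Suc (nat \<lfloor>t\<rfloor>))) (frac t)"

lemma edge_geo_nat: "edge_geo x (real n) = vertex (geoword x n)"
  by (simp add: edge_geo_def frac_def flip: vertex_eq_edge_point)

lemma edge_geo_on_edge: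
  assumes "real i \<le> t" "t \<le> real i + 1"
  shows "edge_geo x t = edge_point (geoword x i) (geoword x (Suc i)) (t - real i)"
proof (cases "t = real i + 1")
  case True
  then have "edge_geo x t = vertex (geoword x (Suc i))"
    using edge_geo_nat[of x "Suc i"] by (simp add: add.commute)
  then show ?thesis using True by (simp flip: vertex_eq_edge_point)
next
  case False
  then have "\<lfloor>t\<rfloor> = int i" using assms by (intro floor_unique) auto
  then show ?thesis by (simp add: edge_geo_def frac_def)
qed

lemma nat_floor_bounds:
  assumes "0 \<le> t" "t \<le> real n"
  shows "real (nat \<lfloor>t\<rfloor>) \<le> t" "t < real (nat \<lfloor>t\<rfloor>) + 1" "nat \<lfloor>t\<rfloor> \<le> n"
    "nat \<lfloor>t\<rfloor> = n \<Longrightarrow> t = real n"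
proof -
  show 1: "real (nat \<lfloor>t\<rfloor>) \<le> t" "t < real (nat \<lfloor>t\<rfloor>) + 1" using assms by linarith+
  show "nat \<lfloor>t\<rfloor> \<le> n" using assms by linarith
  show "nat \<lfloor>t\<rfloor> = n \<Longrightarrow> t = real n" using 1 assms by auto
qed

lemma edge_geo_in:
  assumes x: "x \<in> carrier G" and t: "0 \<le> t" "t \<le> real (wlen x)"
  shows "edge_geo x t \<in> \<Gamma>"
proof (cases "nat \<lfloor>t\<rfloor> = wlen x")
  case True
  then show ?thesis using nat_floor_bounds[OF t] x edge_geo_nat[of x "wlen x"] by (simp add: geoword)
next
  case False
  then have "nat \<lfloor>t\<rfloor> < wlen x" using nat_floor_bounds(3)[OF t] by simp
  moreover have "frac t \<in> {0..1}" using frac_lt_1[of t] by simp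
  ultimately show ?thesis
    using adj_geoword[OF x] geoword(3)[OF x]
    unfolding cayley_points_def graph_points_def edge_geo_def by blast
qed

lemma edge_geo_edge_dist:
  assumes x: "x \<in> carrier G" and "i < wlen x" "real i \<le> s" "s \<le> t" "t \<le> real i + 1"
  shows "d\<^sub>\<Gamma> (edge_geo x s) (edge_geo x t) \<le> t - s"
  using cayley_dist_same_edge[of "geoword x i" "geoword x (Suc i)" "s - real i" "t - real i"]
    adj_geoword[OF x] geoword(3)[OF x] assms
  by (simp add: edge_geo_on_edge[of i])

lemma edge_geo_dist_le:
  assumes x: "x \<in> carrier G" and st: "0 \<le> s" "s \<le> t" "t \<le> real (wlen x)"
  shows "d\<^sub>\<Gamma> (edge_geo x s) (edge_geo x t) \<le> t - s"
proof -
  define i j where "i = nat \<lfloor>s\<rfloor>" and "j = nat \<lfloor>t\<rfloor>"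
  have s: "0 \<le> s" "s \<le> real (wlen x)" and t: "0 \<le> t" "t \<le> real (wlen x)" using st by auto
  note i = nat_floor_bounds[OF s, folded i_def] and j = nat_floor_bounds[OF t, folded j_def]
  have "i \<le> j" unfolding i_def j_def using st by (intro nat_mono floor_mono)
  have in': "edge_geo x r \<in> \<Gamma>" if "0 \<le> r" "r \<le> real (wlen x)" for r
    using edge_geo_in[OF x that] .
  have last: "d\<^sub>\<Gamma> (edge_geo x r) (edge_geo x t) \<le> t - r" if "real j \<le> r" "r \<le> t" for r
  proof (cases "j = wlen x")
    case True
    then have "r = t" using j that by auto
    then show ?thesis using in'[OF t] \<Gamma>.mdist_zero by simp
  next
    case False
    then show ?thesis using j that by (intro edge_geo_edge_dist[OF x, of j]) auto
  qed
  show ?thesis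
  proof (cases "i = j")
    case True
    then show ?thesis using last[of s] i j st by auto
  next
    case False
    then have ij: "Suc i \<le> j" using \<open>i \<le> j\<close> by simp
    have 1: "d\<^sub>\<Gamma> (edge_geo x s) (edge_geo x (real (Suc i))) \<le> real (Suc i) - s"
      using i j ij by (intro edge_geo_edge_dist[OF x, of i]) auto
    have 2: "d\<^sub>\<Gamma> (edge_geo x (real (Suc i))) (edge_geo x (real j)) = real j - real (Suc i)"
      unfolding edge_geo_nat using ij j
      by (simp add: cayley_dist_vertex geoword[OF x] geoword_dist[OF x])
    have 3: "d\<^sub>\<Gamma> (edge_geo x (real j)) (edge_geo x t) \<le> t - real j"
      using last[of "real j"] j by auto
    have m: "edge_geo x s \<in> \<Gamma>" "edge_geo x t \<in> \<Gamma>" "edge_geo x (real (Suc i)) \<in> \<Gamma>" "edge_geo x (real j) \<in> \<Gamma>"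
      using s t i j ij by (auto intro!: in')
    show ?thesis
      using 1 2 3 \<Gamma>.triangle[OF m(1,3,2)] \<Gamma>.triangle[OF m(3,4,2)] by linarith
  qed
qed

lemma geodesic_edge_geo:
  assumes x: "x \<in> carrier G"
  shows "geodesic \<Gamma> d\<^sub>\<Gamma> {0..real (wlen x)} (edge_geo x)"
proof -
  let ?n = "real (wlen x)"
  have n: "d\<^sub>\<Gamma> (edge_geo x 0) (edge_geo x ?n) = ?n"
    using edge_geo_nat[of x 0] edge_geo_nat[of x "wlen x"] x
    by (simp add: geoword cayley_dist_vertex wdist_one)
  have eq: "d\<^sub>\<Gamma> (edge_geo x s) (edge_geo x t) = t - s" if st: "0 \<le> s" "s \<le> t" "t \<le> ?n" for s t
  proof -
    have m: "edge_geo x r \<in> \<Gamma>" if "0 \<le> r" "r \<le> ?n" for r using edge_geo_in[OF x that] .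
    have "d\<^sub>\<Gamma> (edge_geo x 0) (edge_geo x ?n) \<le>
      d\<^sub>\<Gamma> (edge_geo x 0) (edge_geo x s) + d\<^sub>\<Gamma> (edge_geo x s) (edge_geo x t) + d\<^sub>\<Gamma> (edge_geo x t) (edge_geo x ?n)"
      using \<Gamma>.triangle[of "edge_geo x 0" "edge_geo x s" "edge_geo x ?n"]
        \<Gamma>.triangle[of "edge_geo x s" "edge_geo x t" "edge_geo x ?n"] m st by simp
    then show ?thesis
      using n edge_geo_dist_le[OF x, of 0 s] edge_geo_dist_le[OF x st]
        edge_geo_dist_le[OF x, of t ?n] st by simp
  qed
  have "d\<^sub>\<Gamma> (edge_geo x s) (edge_geo x t) = \<bar>s - t\<bar>" if "s \<in> {0..?n}" "t \<in> {0..?n}" for s t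
  proof (cases "s \<le> t")
    case True
    then show ?thesis using eq[of s t] that by simp
  next
    case False
    then show ?thesis using eq[of t s] that by (simp add: \<Gamma>.commute)
  qed
  then show ?thesis using edge_geo_in[OF x] by (auto simp: quasi_geodesic_def)
qed

section \<open>Rounding to vertices\<close>

lemma inj_vertex: "vertex x = vertex y \<longleftrightarrow> x = y"
  by (auto simp: vertex_def fun_eq_iff split: if_splits)

lemma near_vertex: "p \<in> \<Gamma> \<Longrightarrow> \<exists>v\<in>carrier G. d\<^sub>\<Gamma> p (vertex v) \<le> 1 \<and> (p \<in> vertex ` carrier G \<longrightarrow> p = vertex v)"
proof (cases "p \<in> vertex ` carrier G")
  case True
  then obtain x where "x \<in> carrier G" "p = vertex x" by blast
  then show ?thesis by (intro bexI[of _ x]) (auto simp: cayley_dist_vertex)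
next
  case False
  assume "p \<in> \<Gamma>"
  with False obtain u v t where uv: "u \<in> carrier G" "v \<in> carrier G" "cayley_adj G A u v" "t \<in> {0..1}" "p = edge_point u v t"
    by (auto simp: cayley_points_def graph_points_def)
  then have "d\<^sub>\<Gamma> p (vertex u) \<le> 1"
    using cayley_dist_same_edge[OF uv(1-3), of t 0] by (auto simp flip: vertex_eq_edge_point)
  with uv False show ?thesis by blast
qed

text \<open>
  Vertices must be fixed, because rounded quasi-geodesics are compared with Morse paths that
  have exactly the same endpoints.
\<close>

definition round_point :: "('a \<Rightarrow> real) \<Rightarrow> 'a" where
  "round_point p = (SOME v. v \<in> carrier G \<and> d\<^sub>\<Gamma> p (vertex v) \<le> 1 \<and> (p \<in> vertex ` carrier G \<longrightarrow> p = vertex v))"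

lemma round_point:
  assumes "p \<in> \<Gamma>"
  shows "round_point p \<in> carrier G" "d\<^sub>\<Gamma> p (vertex (round_point p)) \<le> 1"
    "p \<in> vertex ` carrier G \<Longrightarrow> vertex (round_point p) = p"
  using someI_ex[OF near_vertex[OF assms, unfolded Bex_def]] unfolding round_point_def by auto

lemma round_point_vertex: "x \<in> carrier G \<Longrightarrow> round_point (vertex x) = x"
  using round_point(3)[of "vertex x"] by (simp add: inj_vertex)

lemma round_point_dist:
  assumes "p \<in> \<Gamma>" "q \<in> \<Gamma>"
  shows "\<bar>wdist (round_point p) (round_point q) - d\<^sub>\<Gamma> p q\<bar> \<le> 2"
proof -
  note p = round_point(1,2)[OF assms(1)] and q = round_point(1,2)[OF assms(2)]
  let ?p = "vertex (round_point p)" and ?q = "vertex (round_point q)"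
  have "d\<^sub>\<Gamma> p q \<le> d\<^sub>\<Gamma> p ?p + d\<^sub>\<Gamma> ?p ?q + d\<^sub>\<Gamma> q ?q"
    using \<Gamma>.triangle[of p ?p q] \<Gamma>.triangle[of ?p ?q q] assms p q \<Gamma>.commute[of q ?q] by simp
  moreover have "d\<^sub>\<Gamma> ?p ?q \<le> d\<^sub>\<Gamma> p ?p + d\<^sub>\<Gamma> p q + d\<^sub>\<Gamma> q ?q"
    using \<Gamma>.triangle[of ?p p ?q] \<Gamma>.triangle[of p q ?q] assms p q \<Gamma>.commute[of p ?p] by simp
  ultimately show ?thesis using p q by (simp add: cayley_dist_vertex)
qed

lemma quasi_geodesic_round:
  assumes "quasi_geodesic \<Gamma> d\<^sub>\<Gamma> I \<eta> k c"
  shows "quasi_geodesic (carrier G) wdist I (round_point \<circ> \<eta>) k (c + 2)"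
proof -
  have "1 / k * \<bar>s - t\<bar> - (c + 2) \<le> wdist (round_point (\<eta> s)) (round_point (\<eta> t)) \<and>
     wdist (round_point (\<eta> s)) (round_point (\<eta> t)) \<le> k * \<bar>s - t\<bar> + (c + 2)"
    if "s \<in> I" "t \<in> I" for s t
  proof -
    have "\<eta> s \<in> \<Gamma>" "\<eta> t \<in> \<Gamma>" using assms that by (auto simp: quasi_geodesic_def)
    then have "\<bar>wdist (round_point (\<eta> s)) (round_point (\<eta> t)) - d\<^sub>\<Gamma> (\<eta> s) (\<eta> t)\<bar> \<le> 2"
      by (rule round_point_dist)
    moreover have "1 / k * \<bar>s - t\<bar> - c \<le> d\<^sub>\<Gamma> (\<eta> s) (\<eta> t)" "d\<^sub>\<Gamma> (\<eta> s) (\<eta> t) \<le> k * \<bar>s - t\<bar> + c"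
      using assms that by (auto simp: quasi_geodesic_def)
    ultimately show ?thesis by linarith
  qed
  then show ?thesis using assms round_point(1) by (auto simp: quasi_geodesic_def Pi_iff)
qed

lemma quasi_geodesic_vertex:
  assumes "\<gamma> \<in> I \<rightarrow> carrier G"
  shows "quasi_geodesic \<Gamma> d\<^sub>\<Gamma> I (vertex \<circ> \<gamma>) k c \<longleftrightarrow> quasi_geodesic (carrier G) wdist I \<gamma> k c"
proof -
  have "d\<^sub>\<Gamma> (vertex (\<gamma> s)) (vertex (\<gamma> t)) = wdist (\<gamma> s) (\<gamma> t)" if "s \<in> I" "t \<in> I" for s t
    using assms that by (intro cayley_dist_vertex) auto
  then show ?thesis using assms by (auto simp: quasi_geodesic_def Pi_iff)
qed

lemma morse_vertexD:
  assumes "morse \<Gamma> d\<^sub>\<Gamma> M I (vertex \<circ> \<gamma>)" "\<gamma> \<in> I \<rightarrow> carrier G"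
  shows "morse (carrier G) wdist M I \<gamma>"
  unfolding morse_def
proof safe
  fix s t k c a b \<eta> \<tau>
  assume *: "s \<le> t" "{s..t} \<subseteq> I" "1 \<le> k" "0 \<le> c" "a \<le> b"
    "quasi_geodesic (carrier G) wdist {a..b} \<eta> k c" "\<eta> a = \<gamma> s" "\<eta> b = \<gamma> t" and \<tau>: "\<tau> \<in> {a..b}"
  have \<eta>: "\<eta> \<in> {a..b} \<rightarrow> carrier G" using * by (simp add: quasi_geodesic_def)
  with * have "quasi_geodesic \<Gamma> d\<^sub>\<Gamma> {a..b} (vertex \<circ> \<eta>) k c" by (simp add: quasi_geodesic_vertex)
  then have near: "(vertex \<circ> \<eta>) ` {a..b} \<subseteq> neighbourhood \<Gamma> d\<^sub>\<Gamma> (M k c) ((vertex \<circ> \<gamma>) ` {s..t})"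
    using assms(1)[unfolded morse_def, rule_format, OF *(1-5), of "vertex \<circ> \<eta>"] * by simp
  obtain r where r: "r \<in> {s..t}" "d\<^sub>\<Gamma> (vertex (\<eta> \<tau>)) (vertex (\<gamma> r)) \<le> M k c"
    using image_neighbourhoodD[OF near \<tau>] by auto
  moreover have "\<gamma> r \<in> carrier G" "\<eta> \<tau> \<in> carrier G" using r * assms \<eta> \<tau> by auto
  ultimately show "\<eta> \<tau> \<in> neighbourhood (carrier G) wdist (M k c) (\<gamma> ` {s..t})"
    by (auto simp: neighbourhood_def cayley_dist_vertex)
qed

text \<open>
  A quasi-geodesic in the graph with endpoints on the path is rounded to vertices, which moves
  each point by at most 1 and hence raises the additive constant by 2.
\<close>

lemma morse_vertexI:
  assumes "morse (carrier G) wdist M I \<gamma>" "\<gamma> \<in> I \<rightarrow> carrier G"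
  shows "morse \<Gamma> d\<^sub>\<Gamma> (\<lambda>k c. M k (c + 2) + 1) I (vertex \<circ> \<gamma>)"
  unfolding morse_def
proof safe
  fix s t k c a b \<eta> \<tau>
  assume *: "s \<le> t" "{s..t} \<subseteq> I" "1 \<le> k" "0 \<le> c" "a \<le> b"
    "quasi_geodesic \<Gamma> d\<^sub>\<Gamma> {a..b} \<eta> k c" "\<eta> a = (vertex \<circ> \<gamma>) s" "\<eta> b = (vertex \<circ> \<gamma>) t" and \<tau>: "\<tau> \<in> {a..b}"
  have "\<gamma> s \<in> carrier G" "\<gamma> t \<in> carrier G" using * assms by auto
  then have ends: "(round_point \<circ> \<eta>) a = \<gamma> s" "(round_point \<circ> \<eta>) b = \<gamma> t"
    using * by (auto simp: round_point_vertex)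
  have near: "(round_point \<circ> \<eta>) ` {a..b} \<subseteq> neighbourhood (carrier G) wdist (M k (c + 2)) (\<gamma> ` {s..t})"
    using assms(1)[unfolded morse_def, rule_format, OF *(1-3) _ *(5) quasi_geodesic_round[OF *(6)] ends] * by simp
  obtain r where r: "r \<in> {s..t}" "wdist (round_point (\<eta> \<tau>)) (\<gamma> r) \<le> M k (c + 2)"
    using image_neighbourhoodD[OF near \<tau>] by auto
  have \<eta>: "\<eta> \<tau> \<in> \<Gamma>" using * \<tau> by (auto simp: quasi_geodesic_def)
  have "\<gamma> r \<in> carrier G" using r * assms by auto
  then have "d\<^sub>\<Gamma> (\<eta> \<tau>) (vertex (\<gamma> r)) \<le> M k (c + 2) + 1"
    using round_point(1,2)[OF \<eta>] r(2) \<eta> \<Gamma>.triangle[of "\<eta> \<tau>" "vertex (round_point (\<eta> \<tau>))" "vertex (\<gamma> r)"]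
    by (simp add: cayley_dist_vertex)
  then show "\<eta> \<tau> \<in> neighbourhood \<Gamma> d\<^sub>\<Gamma> (M k (c + 2) + 1) ((vertex \<circ> \<gamma>) ` {s..t})"
    using \<eta> r(1) by (auto simp: neighbourhood_def)
qed

text \<open>
  A path of vertices has the same quasi-geodesic constants in the graph and in the word metric,
  and its Morse gauges for the two differ by a fixed change.
\<close>

lemma local_to_global_word_metric:
  assumes "morse_local_to_global_space \<Gamma> d\<^sub>\<Gamma>"
  shows "morse_local_to_global_space (carrier G) wdist"
  unfolding morse_local_to_global_space_def
proof (intro allI impI)
  fix M k c assume M: "morse_gauge M" and kc: "(k::real) \<ge> 1" "(c::real) \<ge> 0"
  let ?M = "\<lambda>k c. M k (c + 2) + 1"
  have "morse_gauge ?M" using M by (simp add: morse_gauge_def add_nonneg_nonneg)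
  then obtain B M' k' c' where B: "B \<ge> 0" "morse_gauge M'" "k' \<ge> 1" "c' \<ge> 0"
    "\<And>I \<gamma>. local_morse_quasi_geodesic \<Gamma> d\<^sub>\<Gamma> B ?M k c I \<gamma> \<Longrightarrow> morse_quasi_geodesic \<Gamma> d\<^sub>\<Gamma> M' k' c' I \<gamma>"
    using assms kc unfolding morse_local_to_global_space_def by blast
  have "morse_quasi_geodesic (carrier G) wdist M' k' c' I \<gamma>"
    if loc: "local_morse_quasi_geodesic (carrier G) wdist B M k c I \<gamma>" for I \<gamma>
  proof -
    have \<gamma>: "\<gamma> \<in> I \<rightarrow> carrier G" using loc by (simp add: local_morse_quasi_geodesic_def)
    have "morse_quasi_geodesic \<Gamma> d\<^sub>\<Gamma> ?M k c {s..t} (vertex \<circ> \<gamma>)"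
      if st: "s \<le> t" "{s..t} \<subseteq> I" "\<bar>s - t\<bar> \<le> B" for s t
    proof -
      have "morse_quasi_geodesic (carrier G) wdist M k c {s..t} \<gamma>"
        using loc st by (simp add: local_morse_quasi_geodesic_def)
      moreover have "\<gamma> \<in> {s..t} \<rightarrow> carrier G" using \<gamma> st by auto
      ultimately show ?thesis
        using morse_vertexI quasi_geodesic_vertex by (simp add: morse_quasi_geodesic_def)
    qed
    then have "local_morse_quasi_geodesic \<Gamma> d\<^sub>\<Gamma> B ?M k c I (vertex \<circ> \<gamma>)"
      using loc \<gamma> by (auto simp: local_morse_quasi_geodesic_def Pi_iff)
    from B(5)[OF this] show ?thesis
      using morse_vertexD[OF _ \<gamma>] quasi_geodesic_vertex[OF \<gamma>] by (simp add: morse_quasi_geodesic_def)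
  qed
  with B show "\<exists>B M' k' c'. B \<ge> 0 \<and> morse_gauge M' \<and> k' \<ge> 1 \<and> c' \<ge> 0 \<and>
     (\<forall>I \<gamma>. local_morse_quasi_geodesic (carrier G) wdist B M k c I \<gamma> \<longrightarrow>
        morse_quasi_geodesic (carrier G) wdist M' k' c' I \<gamma>)" by blast
qed

text \<open>
  The path \<open>geo\<close> visits the vertices of the graph geodesic \<open>edge_geo\<close>, and the two agree at
  integer times.
\<close>

lemma stable_geo:
  assumes stable: "stable_in_cayley G A H M k" and H: "H \<subseteq> carrier G" and h: "h \<in> H"
  shows "morse (carrier G) wdist (\<lambda>k c. M k c + 1) {0..real (wlen h)} (geo \<one> h)"
    and "geo \<one> h ` {0..real (wlen h)} \<subseteq> neighbourhood (carrier G) wdist k H"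
proof -
  let ?n = "real (wlen h)"
  have hG: "h \<in> carrier G" using h H by auto
  have geo_eq: "vertex (geo \<one> h t) = edge_geo h (of_int \<lfloor>t\<rfloor>)" if "0 \<le> t" for t
    using that hG edge_geo_nat[of h "nat \<lfloor>t\<rfloor>"] by (simp add: geo_def geoword)
  have "edge_geo h 0 = vertex \<one>" "edge_geo h ?n = vertex h"
    using edge_geo_nat[of h 0] edge_geo_nat[of h "wlen h"] hG by (auto simp: geoword)
  then have morse: "morse \<Gamma> d\<^sub>\<Gamma> M {0..?n} (edge_geo h)"
    and near: "edge_geo h ` {0..?n} \<subseteq> neighbourhood \<Gamma> d\<^sub>\<Gamma> k (vertex ` H)"
    using stable geodesic_edge_geo[OF hG] h unfolding stable_in_cayley_def by auto
  show "geo \<one> h ` {0..?n} \<subseteq> neighbourhood (carrier G) wdist k H"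
  proof (rule image_subsetI)
    fix t assume t: "t \<in> {0..?n}"
    then have "of_int \<lfloor>t\<rfloor> \<in> {0..?n}" by (auto intro: order_trans[OF of_int_floor_le])
    with near have "edge_geo h (of_int \<lfloor>t\<rfloor>) \<in> neighbourhood \<Gamma> d\<^sub>\<Gamma> k (vertex ` H)" by blast
    then have "vertex (geo \<one> h t) \<in> neighbourhood \<Gamma> d\<^sub>\<Gamma> k (vertex ` H)" using geo_eq t by simp
    then show "geo \<one> h t \<in> neighbourhood (carrier G) wdist k H"
      using H hG cayley_dist_vertex[OF geo_carrier[OF one_closed hG]]
      by (auto simp: neighbourhood_def subset_iff)
  qed
  show "morse (carrier G) wdist (\<lambda>k c. M k c + 1) {0..?n} (geo \<one> h)"
    unfolding morse_def
  proof safe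
    fix s t k c a b \<eta> \<tau>
    assume *: "s \<le> t" "{s..t} \<subseteq> {0..?n}" "1 \<le> k" "0 \<le> c" "a \<le> b"
      "qg a b \<eta> k c" "\<eta> a = geo \<one> h s" "\<eta> b = geo \<one> h t" and \<tau>: "\<tau> \<in> {a..b}"
    have st: "0 \<le> s" "s \<le> t" "t \<le> ?n" using * by auto
    have \<eta>: "\<eta> \<in> {a..b} \<rightarrow> carrier G" using * by (simp add: quasi_geodesic_def)
    have "quasi_geodesic \<Gamma> d\<^sub>\<Gamma> {a..b} (vertex \<circ> \<eta>) k c"
      using * \<eta> by (simp add: quasi_geodesic_vertex)
    moreover have "of_int \<lfloor>s\<rfloor> \<le> (of_int \<lfloor>t\<rfloor>::real)" "{of_int \<lfloor>s\<rfloor>..of_int \<lfloor>t\<rfloor>} \<subseteq> {0..?n}"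
      using st by (auto intro: floor_mono order_trans[OF _ order_trans[OF of_int_floor_le]])
    ultimately have near': "(vertex \<circ> \<eta>) ` {a..b} \<subseteq>
        neighbourhood \<Gamma> d\<^sub>\<Gamma> (M k c) (edge_geo h ` {of_int \<lfloor>s\<rfloor>..of_int \<lfloor>t\<rfloor>})"
      using morse[unfolded morse_def, rule_format, of "of_int \<lfloor>s\<rfloor>" "of_int \<lfloor>t\<rfloor>" k c a b "vertex \<circ> \<eta>"]
        * st geo_eq by simp
    obtain r where r: "of_int \<lfloor>s\<rfloor> \<le> r" "r \<le> of_int \<lfloor>t\<rfloor>"
      "d\<^sub>\<Gamma> (vertex (\<eta> \<tau>)) (edge_geo h r) \<le> M k c"
      using image_neighbourhoodD[OF near' \<tau>] by auto
    \<comment> \<open>The graph geodesic is near \<open>\<eta> \<tau>\<close> at a time \<open>r\<close> that may precede \<open>s\<close>; then \<open>r\<close> and \<open>s\<close> have the same floor.\<close>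
    define r' where "r' = max r s"
    have "r \<le> t" using r by linarith
    then have r': "s \<le> r'" "r' \<le> t" using st by (auto simp: r'_def)
    have "\<lfloor>r'\<rfloor> = \<lfloor>r\<rfloor>"
    proof (cases "s \<le> r")
      case False
      then have "\<lfloor>s\<rfloor> = \<lfloor>r\<rfloor>" using r by linarith
      then show ?thesis using False by (simp add: r'_def max_def)
    qed (simp add: r'_def max_def)
    then have eq: "vertex (geo \<one> h r') = edge_geo h (of_int \<lfloor>r\<rfloor>)" using geo_eq[of r'] r' st by simp
    have r0: "0 \<le> (of_int \<lfloor>r\<rfloor> :: real)" "r \<le> ?n" "of_int \<lfloor>r\<rfloor> \<le> r" "r - of_int \<lfloor>r\<rfloor> \<le> 1"
    proof -
      have "0 \<le> \<lfloor>s\<rfloor>" using st by simp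
      then have "0 \<le> (of_int \<lfloor>s\<rfloor> :: real)" by simp
      then have "0 \<le> r" using r by linarith
      then show "0 \<le> (of_int \<lfloor>r\<rfloor> :: real)" by simp
      show "r \<le> ?n" using \<open>r \<le> t\<close> st by linarith
    qed linarith+
    have "d\<^sub>\<Gamma> (edge_geo h r) (edge_geo h (of_int \<lfloor>r\<rfloor>)) \<le> 1"
      using edge_geo_dist_le[OF hG r0(1,3,2)] r0 by (simp add: \<Gamma>.commute)
    moreover have "edge_geo h r \<in> \<Gamma>" using edge_geo_in[OF hG] r0 by simp
    moreover have "\<eta> \<tau> \<in> carrier G" using \<eta> \<tau> by auto
    moreover have "vertex (geo \<one> h r') \<in> \<Gamma>" using hG by simp
    ultimately have "wdist (\<eta> \<tau>) (geo \<one> h r') \<le> M k c + 1"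
      using r(3) hG eq \<Gamma>.triangle[of "vertex (\<eta> \<tau>)" "edge_geo h r" "vertex (geo \<one> h r')"]
      by (simp flip: cayley_dist_vertex)
    then show "\<eta> \<tau> \<in> neighbourhood (carrier G) wdist (M k c + 1) (geo \<one> h ` {s..t})"
      using \<open>\<eta> \<tau> \<in> carrier G\<close> r' by (auto simp: neighbourhood_def)
  qed
qed


section \<open>Concatenation of quasi-geodesics\<close>

lemma wdist_perturb:
  assumes "x \<in> carrier G" "y \<in> carrier G" "x' \<in> carrier G" "y' \<in> carrier G"
  shows "\<bar>wdist x' y' - wdist x y\<bar> \<le> wdist x x' + wdist y y'"
  using wdist_triangle[of x' x y'] wdist_triangle[of x y y'] wdist_triangle[of x x' y]
    wdist_triangle[of x' y' y] wdist_commute[of x x'] wdist_commute[of y y'] assms by linarith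

lemma qg_mono:
  assumes "qg a b \<eta> k c" "k \<le> k'" "c \<le> c'"
  shows "qg a b \<eta> k' c'"
proof (rule qgI)
  note q = qgD[OF assms(1)]
  show "1 \<le> k'" "0 \<le> c'" "a \<le> b" "\<And>t. t \<in> {a..b} \<Longrightarrow> \<eta> t \<in> carrier G" using q assms by auto
  fix s t assume st: "a \<le> s" "s \<le> t" "t \<le> b"
  have "k * (wdist (\<eta> s) (\<eta> t) + c) \<le> k' * (wdist (\<eta> s) (\<eta> t) + c')"
    using q(1,2) assms by (intro mult_mono) auto
  then show "t - s \<le> k' * (wdist (\<eta> s) (\<eta> t) + c')" using q(5)[OF st] by linarith
  have "k * (t - s) \<le> k' * (t - s)" using assms st by (intro mult_right_mono) auto
  then show "wdist (\<eta> s) (\<eta> t) \<le> k' * (t - s) + c'" using q(6)[OF st] assms by linarith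
qed

lemma qg_subinterval:
  assumes "qg a b \<eta> k c" "a \<le> a'" "a' \<le> b'" "b' \<le> b"
  shows "qg a' b' \<eta> k c"
  using qgD[OF assms(1)] assms(2-4) by (intro qgI) auto

lemma qg_cong:
  assumes "qg a b \<eta> k c" "\<And>t. t \<in> {a..b} \<Longrightarrow> \<eta> t = \<eta>' t"
  shows "qg a b \<eta>' k c"
  using assms by (auto simp: quasi_geodesic_def Pi_iff)

lemma qg_translate:
  assumes "qg a b \<eta> k c" "g \<in> carrier G"
  shows "qg a b (\<lambda>t. g \<otimes> \<eta> t) k c"
  using qgD[OF assms(1)] assms(2) by (intro qgI) (auto simp: wdist_left_invariant)

lemma qg_shift:
  assumes "qg a b \<eta> k c"
  shows "qg (a + r) (b + r) (\<lambda>t. \<eta> (t - r)) k c"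
proof -
  note q = qgD[OF assms]
  have "t - s \<le> k * (wdist (\<eta> (s - r)) (\<eta> (t - r)) + c) \<and> wdist (\<eta> (s - r)) (\<eta> (t - r)) \<le> k * (t - s) + c"
    if "a + r \<le> s" "s \<le> t" "t \<le> b + r" for s t
    using q(5)[of "s - r" "t - r"] q(6)[of "s - r" "t - r"] that by simp
  then show ?thesis using q by (intro qgI) auto
qed

lemma qg_reverse:
  assumes "qg a b \<eta> k c"
  shows "qg (- b) (- a) (\<lambda>t. \<eta> (- t)) k c"
proof -
  note q = qgD[OF assms]
  have c: "\<eta> (- t) \<in> carrier G" if "t \<in> {- b..- a}" for t using that q(4)[of "- t"] by auto
  have "t - s \<le> k * (wdist (\<eta> (- s)) (\<eta> (- t)) + c) \<and> wdist (\<eta> (- s)) (\<eta> (- t)) \<le> k * (t - s) + c"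
    if "- b \<le> s" "s \<le> t" "t \<le> - a" for s t
    using q(5)[of "- t" "- s"] q(6)[of "- t" "- s"] that c wdist_commute[of "\<eta> (- s)" "\<eta> (- t)"] by simp
  then show ?thesis using q c by (intro qgI) auto
qed

lemma qg_change_ends:
  assumes q: "qg a b \<eta> k c" and ab: "a < b" and xy: "x \<in> carrier G" "y \<in> carrier G"
    and D: "wdist (\<eta> a) x \<le> D" "wdist (\<eta> b) y \<le> D"
  shows "qg a b (\<lambda>t. if t = a then x else if t = b then y else \<eta> t) k (c + 2 * D)"
proof -
  let ?\<eta> = "\<lambda>t. if t = a then x else if t = b then y else \<eta> t"
  note q = qgD[OF q]
  have D0: "0 \<le> D" using D(1) wdist_nonneg[of "\<eta> a" x] by linarith
  have c: "\<eta> t \<in> carrier G" "?\<eta> t \<in> carrier G" and d: "wdist (\<eta> t) (?\<eta> t) \<le> D" if "t \<in> {a..b}" for t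
    using q(4)[OF that] xy D D0 by auto
  have "t - s \<le> k * (wdist (?\<eta> s) (?\<eta> t) + (c + 2 * D)) \<and> wdist (?\<eta> s) (?\<eta> t) \<le> k * (t - s) + (c + 2 * D)"
    if st: "a \<le> s" "s \<le> t" "t \<le> b" for s t
  proof -
    have m: "s \<in> {a..b}" "t \<in> {a..b}" using st by auto
    have *: "\<bar>wdist (?\<eta> s) (?\<eta> t) - wdist (\<eta> s) (\<eta> t)\<bar> \<le> 2 * D"
      using wdist_perturb[OF c(1)[OF m(1)] c(1)[OF m(2)] c(2)[OF m(1)] c(2)[OF m(2)]] d[OF m(1)] d[OF m(2)]
      by linarith
    then have "k * (wdist (\<eta> s) (\<eta> t) + c) \<le> k * (wdist (?\<eta> s) (?\<eta> t) + (c + 2 * D))"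
      using q(1) by (intro mult_left_mono) auto
    then show ?thesis using * q(5,6)[OF st] by linarith
  qed
  then show ?thesis using q(1-3) c(2) D0 by (intro qgI) auto
qed

text \<open>
  Let \<open>z = \<eta> \<tau>\<close>, let \<open>p = \<eta> s\<close>, and let \<open>w\<close> be the point at distance about \<open>r\<close> from \<open>z\<close> on a
  geodesic from \<open>z\<close> to \<open>e\<close>. Since \<open>z\<close> is almost nearest to \<open>e\<close> among the earlier points, \<open>d p w\<close>
  is at least \<open>d z w = r\<close> up to an error, and then \<open>d p z \<le> 2 d p w\<close> by the triangle inequality.
  So \<open>d p w\<close> bounds a third of \<open>d p z + r\<close>, which gives the factor 3.
\<close>

lemma qg_concat:
  assumes q: "qg a b \<eta> k c" and \<tau>: "\<tau> \<in> {a..b}" and e: "e \<in> carrier G" and \<epsilon>: "0 \<le> \<epsilon>"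
    and nearest: "\<And>t. t \<in> {a..\<tau>} \<Longrightarrow> wdist e (\<eta> \<tau>) \<le> wdist e (\<eta> t) + \<epsilon>"
  shows "\<exists>b' \<zeta>. \<tau> \<le> b' \<and> qg a b' \<zeta> (3 * k) (c + 2 * \<epsilon> + 3) \<and> (\<forall>t\<in>{a..\<tau>}. \<zeta> t = \<eta> t) \<and> \<zeta> b' = e \<and>
    (\<forall>t\<in>{\<tau>..b'}. wdist e (\<zeta> t) \<le> wdist e (\<eta> \<tau>) + 1)"
proof -
  note q' = qgD[OF q]
  define z where "z = \<eta> \<tau>"
  define l where "l = wdist z e"
  define \<zeta> where "\<zeta> = (\<lambda>t. if t \<le> \<tau> then \<eta> t else geo z e (t - \<tau>))"
  have z: "z \<in> carrier G" using q'(4)[OF \<tau>] by (simp add: z_def)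
  have l: "l = wdist e z" "0 \<le> l" using wdist_commute[OF e z] by (auto simp: l_def)
  have c: "\<zeta> t \<in> carrier G" if "t \<in> {a..\<tau> + l}" for t
    using that q'(4)[of t] \<tau> z e by (auto simp: \<zeta>_def)
  have geo_z: "wdist z (geo z e r) \<le> r + 1" "wdist e (geo z e r) \<le> l - r + 1" "r - 1 \<le> wdist z (geo z e r)"
    if "0 \<le> r" "r \<le> l" for r
    using geo_dist[OF z e, of 0 r] geo_dist[OF z e, of r l] that geo_0[OF z e] geo_end[OF z e]
      wdist_commute[OF e geo_carrier[OF z e, of r]] unfolding l_def by auto
  have "t - s \<le> 3 * k * (wdist (\<zeta> s) (\<zeta> t) + (c + 2 * \<epsilon> + 3)) \<and>
      wdist (\<zeta> s) (\<zeta> t) \<le> 3 * k * (t - s) + (c + 2 * \<epsilon> + 3)"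
    if st: "a \<le> s" "s \<le> t" "t \<le> \<tau> + l" for s t
  proof -
    define \<delta> where "\<delta> = wdist (\<zeta> s) (\<zeta> t)"
    have \<delta>: "0 \<le> \<delta>" by (simp add: \<delta>_def)
    have k1: "x \<le> k * x" if "0 \<le> x" for x using mult_right_mono[OF q'(1) that] by simp
    have kc: "0 \<le> k * c" "0 \<le> k * \<epsilon>" "0 \<le> k * \<delta>" using q' \<epsilon> \<delta> by auto
    consider "t \<le> \<tau>" | "s \<le> \<tau>" "\<tau> < t" | "\<tau> < s" using st by linarith
    then have "t - s \<le> 3 * k * (\<delta> + (c + 2 * \<epsilon> + 3)) \<and> \<delta> \<le> 3 * k * (t - s) + (c + 2 * \<epsilon> + 3)"
    proof cases
      case 1
      then have "t - s \<le> k * (\<delta> + c)" "\<delta> \<le> k * (t - s) + c"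
        using q'(5)[of s t] q'(6)[of s t] st \<tau> by (auto simp: \<delta>_def \<zeta>_def)
      moreover have "0 \<le> k * (t - s)" using q'(1) st by auto
      ultimately show ?thesis
        using kc q'(1) \<epsilon> by (intro conjI; simp only: algebra_simps; linarith)
    next
      case 2
      define r where "r = t - \<tau>"
      have r: "0 < r" "r \<le> l" using 2 st by (auto simp: r_def)
      have \<zeta>: "\<zeta> s = \<eta> s" "\<zeta> t = geo z e r" using 2 by (auto simp: \<zeta>_def r_def)
      have s: "\<eta> s \<in> carrier G" using q'(4)[of s] st 2 \<tau> by auto
      have g: "geo z e r \<in> carrier G" using z e by simp
      have n: "l \<le> wdist e (\<eta> s) + \<epsilon>" using nearest[of s] st 2 by (simp add: l(1) z_def)
      have "wdist e (\<eta> s) \<le> wdist e (geo z e r) + wdist (geo z e r) (\<eta> s)"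
        using wdist_triangle[OF e g s] .
      then have A: "r \<le> \<delta> + \<epsilon> + 1"
        using n geo_z(2)[of r] r wdist_commute[OF g s] by (simp add: \<delta>_def \<zeta>)
      have "wdist (\<eta> s) z \<le> \<delta> + (r + 1)"
        using wdist_triangle[OF s g z] geo_z(1)[of r] r wdist_commute[OF g z] by (simp add: \<delta>_def \<zeta>)
      moreover have "\<tau> - s \<le> k * (wdist (\<eta> s) z + c)"
        using q'(5)[of s \<tau>] 2 st \<tau> by (simp add: z_def)
      moreover have "k * (wdist (\<eta> s) z + c) \<le> k * (2 * \<delta> + \<epsilon> + 2 + c)"
        using calculation A q'(1) by (intro mult_left_mono) auto
      ultimately have "\<tau> - s \<le> k * (2 * \<delta> + \<epsilon> + 2 + c)" by linarith
      moreover have "r \<le> k * (\<delta> + \<epsilon> + 1)" using A k1[of "\<delta> + \<epsilon> + 1"] \<delta> \<epsilon> by linarith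
      ultimately have "t - s \<le> k * (2 * \<delta> + \<epsilon> + 2 + c) + k * (\<delta> + \<epsilon> + 1)" by (simp add: r_def)
      moreover have "\<delta> \<le> wdist (\<eta> s) z + (r + 1)"
        using wdist_triangle[OF s z g] geo_z(1)[of r] r by (simp add: \<delta>_def \<zeta>)
      moreover have "wdist (\<eta> s) z \<le> k * (\<tau> - s) + c" using q'(6)[of s \<tau>] 2 st \<tau> by (simp add: z_def)
      moreover have "r \<le> k * r" "0 \<le> k * (\<tau> - s)" using k1[of r] r q'(1) 2 by auto
      ultimately show ?thesis
        using kc q'(1) \<epsilon> r(1) unfolding r_def by (intro conjI; simp only: algebra_simps; linarith)
    next
      case 3
      have "t - s - 1 \<le> \<delta>" "\<delta> \<le> t - s + 1"
        using geo_dist[OF z e, of "s - \<tau>" "t - \<tau>"] 3 st by (auto simp: \<delta>_def \<zeta>_def l_def)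
      moreover have "t - s \<le> k * (t - s)" "\<delta> \<le> k * \<delta>" using k1[of "t - s"] k1[of \<delta>] st \<delta> by auto
      ultimately show ?thesis
        using st(2) kc q'(1,2) \<epsilon> \<delta> by (intro conjI; simp only: algebra_simps; linarith)
    qed
    then show ?thesis by (simp add: \<delta>_def)
  qed
  then have "qg a (\<tau> + l) \<zeta> (3 * k) (c + 2 * \<epsilon> + 3)"
    using q' \<epsilon> \<tau> l(2) c by (intro qgI) auto
  moreover have "\<zeta> (\<tau> + l) = e"
  proof (cases "l = 0")
    case True
    then have "z = e" using wdist_eq_0[OF z e] by (simp add: l_def)
    then show ?thesis using True by (simp add: \<zeta>_def z_def)
  next
    case False
    then have "0 < l" using l(2) by simp
    then show ?thesis using geo_end[OF z e] by (simp add: \<zeta>_def l_def)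
  qed
  moreover have "wdist e (\<zeta> t) \<le> wdist e (\<eta> \<tau>) + 1" if "t \<in> {\<tau>..\<tau> + l}" for t
  proof (cases "t = \<tau>")
    case False
    then show ?thesis using that geo_z(2)[of "t - \<tau>"] by (auto simp: \<zeta>_def l(1) z_def)
  qed (simp add: \<zeta>_def)
  ultimately show ?thesis using l(2) by (intro exI[of _ "\<tau> + l"] exI[of _ \<zeta>]) (auto simp: \<zeta>_def)
qed

lemma qg_concat_left:
  assumes q: "qg a b \<eta> k c" and \<tau>: "\<tau> \<in> {a..b}" and e: "e \<in> carrier G" and \<epsilon>: "0 \<le> \<epsilon>"
    and nearest: "\<And>t. t \<in> {\<tau>..b} \<Longrightarrow> wdist e (\<eta> \<tau>) \<le> wdist e (\<eta> t) + \<epsilon>"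
  shows "\<exists>a' \<zeta>. a' \<le> \<tau> \<and> qg a' b \<zeta> (3 * k) (c + 2 * \<epsilon> + 3) \<and> (\<forall>t\<in>{\<tau>..b}. \<zeta> t = \<eta> t) \<and> \<zeta> a' = e \<and>
    (\<forall>t\<in>{a'..\<tau>}. wdist e (\<zeta> t) \<le> wdist e (\<eta> \<tau>) + 1)"
proof -
  have n: "wdist e (\<eta> (- (- \<tau>))) \<le> wdist e (\<eta> (- t)) + \<epsilon>" if "t \<in> {- b..- \<tau>}" for t
    using nearest[of "- t"] that by auto
  from qg_concat[OF qg_reverse[OF q] _ e \<epsilon> n] \<tau> obtain b' \<zeta> where \<zeta>: "- \<tau> \<le> b'"
    "qg (- b) b' \<zeta> (3 * k) (c + 2 * \<epsilon> + 3)" "\<And>t. t \<in> {- b..- \<tau>} \<Longrightarrow> \<zeta> t = \<eta> (- t)" "\<zeta> b' = e"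
    "\<And>t. t \<in> {- \<tau>..b'} \<Longrightarrow> wdist e (\<zeta> t) \<le> wdist e (\<eta> \<tau>) + 1" by auto
  show ?thesis
    using \<zeta>(1,4) qg_reverse[OF \<zeta>(2)] \<zeta>(3)[of "- t" for t] \<zeta>(5)[of "- t" for t]
    by (intro exI[of _ "- b'"] exI[of _ "\<lambda>t. \<zeta> (- t)"]) auto
qed

text \<open>
  Distances are natural numbers, so a minimum is attained even on infinite sets.
\<close>

lemma nearest_point_exists:
  assumes "S \<noteq> {}"
  shows "\<exists>p\<in>S. \<forall>q\<in>S. wdist e p \<le> wdist e q"
proof -
  from assms obtain x where "x \<in> S" by blast
  from ex_has_least_nat[of "\<lambda>q. q \<in> S" x "\<lambda>q. wlen (inv e \<otimes> q)", OF this] show ?thesis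
    by (auto simp: wdist_def)
qed

end

section \<open>Stable subgroups\<close>

text \<open>
  What stability says about the vertices, for one generating set, one gauge and one radius.
\<close>

locale stable_in_word_metric = word_metric +
  fixes H :: "'a set" and N :: "real \<Rightarrow> real \<Rightarrow> real" and r\<^sub>H :: real
  assumes subgroup_H: "subgroup H G" and gauge: "morse_gauge N" and r\<^sub>H: "0 \<le> r\<^sub>H"
    and morse_H: "h \<in> H \<Longrightarrow> morse (carrier G) wdist N {0..real (wlen h)} (geo \<one> h)"
    and near_H: "h \<in> H \<Longrightarrow> geo \<one> h ` {0..real (wlen h)} \<subseteq> neighbourhood (carrier G) wdist r\<^sub>H H"
begin

lemma H_carrier: "h \<in> H \<Longrightarrow> h \<in> carrier G"
  and H_one: "\<one> \<in> H"
  and H_mult: "h \<in> H \<Longrightarrow> h' \<in> H \<Longrightarrow> h \<otimes> h' \<in> H"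
  and H_inv: "h \<in> H \<Longrightarrow> inv h \<in> H"
  using subgroup_H by (auto simp: subgroup.mem_carrier subgroup.one_closed subgroup.m_closed subgroup.m_inv_closed)

lemmas H_closed = H_carrier H_one H_mult H_inv

lemma geo_translate:
  assumes "x \<in> carrier G" "y \<in> carrier G"
  shows "geo x y t = x \<otimes> geo \<one> (inv x \<otimes> y) t"
  using assms geo_mult[of x \<one> "inv x \<otimes> y"] by (simp add: word_simps)

lemma geo_near_coset:
  assumes x: "x \<in> carrier G" and y: "y \<in> carrier G" and H: "inv x \<otimes> y \<in> H" and t: "t \<in> {0..wdist x y}"
  shows "\<exists>h\<in>H. wdist (geo x y t) (x \<otimes> h) \<le> r\<^sub>H"
proof -
  have "geo \<one> (inv x \<otimes> y) t \<in> neighbourhood (carrier G) wdist r\<^sub>H H"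
    using near_H[OF H] t by (auto simp: wdist_def)
  then obtain h where h: "h \<in> H" "wdist (geo \<one> (inv x \<otimes> y) t) h \<le> r\<^sub>H" by (auto simp: neighbourhood_def)
  then have "wdist (geo x y t) (x \<otimes> h) \<le> r\<^sub>H"
    using x y H_carrier by (simp add: geo_translate[OF x y] wdist_left_invariant)
  with h(1) show ?thesis by blast
qed

lemma geo_morse:
  assumes x: "x \<in> carrier G" and y: "y \<in> carrier G" and H: "inv x \<otimes> y \<in> H"
    and st: "0 \<le> s" "s \<le> t" "t \<le> wdist x y"
    and q: "qg a b \<eta> k c" "\<eta> a = geo x y s" "\<eta> b = geo x y t" and \<tau>: "\<tau> \<in> {a..b}"
  shows "\<exists>\<sigma>\<in>{s..t}. wdist (\<eta> \<tau>) (geo x y \<sigma>) \<le> N k c"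
proof -
  let ?\<eta> = "\<lambda>r. inv x \<otimes> \<eta> r"
  have g: "geo \<one> (inv x \<otimes> y) r = inv x \<otimes> geo x y r" for r
    using x y by (simp add: geo_translate[OF x y] word_simps)
  have "?\<eta> ` {a..b} \<subseteq> neighbourhood (carrier G) wdist (N k c) (geo \<one> (inv x \<otimes> y) ` {s..t})"
    using morse_H[OF H, unfolded morse_def, rule_format, of s t k c a b ?\<eta>] st q g
      qg_translate[OF q(1) inv_closed[OF x]] qgD(1-3)[OF q(1)] by (auto simp: wdist_def)
  from image_neighbourhoodD[OF this \<tau>] obtain \<sigma> where
    "\<sigma> \<in> {s..t}" "wdist (inv x \<otimes> \<eta> \<tau>) (inv x \<otimes> geo x y \<sigma>) \<le> N k c" unfolding g by blast
  then show ?thesis using x y qgD(4)[OF q(1) \<tau>] by (auto simp: wdist_left_invariant)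
qed

lemma N_nonneg: "1 \<le> k \<Longrightarrow> 0 \<le> c \<Longrightarrow> 0 \<le> N k c"
  using gauge by (simp add: morse_gauge_def)

text \<open>
  Quasi-geodesics may jump, so replacing the two endpoint values gives a quasi-geodesic with the
  right endpoints. Only for a one-point parameter interval is this impossible, and then the
  claim is trivial.
\<close>

lemma geo_morse_near:
  assumes x: "x \<in> carrier G" and y: "y \<in> carrier G" and H: "inv x \<otimes> y \<in> H"
    and st: "0 \<le> s" "s \<le> t" "t \<le> wdist x y"
    and q: "qg a b \<eta> k c" and D: "wdist (\<eta> a) (geo x y s) \<le> D" "wdist (\<eta> b) (geo x y t) \<le> D"
    and \<tau>: "\<tau> \<in> {a..b}"
  shows "\<exists>\<sigma>\<in>{s..t}. wdist (\<eta> \<tau>) (geo x y \<sigma>) \<le> N k (c + 2 * D) + D"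
proof -
  have D0: "0 \<le> D" using D(1) wdist_nonneg order_trans by blast
  have N0: "0 \<le> N k (c + 2 * D)" using qgD[OF q] D0 by (intro N_nonneg) auto
  consider "\<tau> = a" | "\<tau> = b" | "a < \<tau>" "\<tau> < b" using \<tau> by force
  then show ?thesis
  proof cases
    case 1
    then show ?thesis using D(1) N0 st by (intro bexI[of _ s]) auto
  next
    case 2
    then show ?thesis using D(2) N0 st by (intro bexI[of _ t]) auto
  next
    case 3
    let ?\<eta> = "\<lambda>r. if r = a then geo x y s else if r = b then geo x y t else \<eta> r"
    have "qg a b ?\<eta> k (c + 2 * D)"
      using 3 x y D by (intro qg_change_ends[OF q]) auto
    from geo_morse[OF x y H st this _ _ \<tau>] 3 obtain \<sigma> where
      "\<sigma> \<in> {s..t}" "wdist (\<eta> \<tau>) (geo x y \<sigma>) \<le> N k (c + 2 * D)" by auto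
    then show ?thesis using D0 by (intro bexI[of _ \<sigma>]) auto
  qed
qed

lemma coset_quasiconvex:
  assumes x: "x \<in> carrier G" and h: "h\<^sub>1 \<in> H" "h\<^sub>2 \<in> H"
    and q: "qg a b \<eta> k c" and D: "wdist (\<eta> a) (x \<otimes> h\<^sub>1) \<le> D" "wdist (\<eta> b) (x \<otimes> h\<^sub>2) \<le> D"
    and \<tau>: "\<tau> \<in> {a..b}"
  shows "\<exists>h\<in>H. wdist (\<eta> \<tau>) (x \<otimes> h) \<le> N k (c + 2 * D) + D + r\<^sub>H"
proof -
  let ?x = "x \<otimes> h\<^sub>1" and ?y = "x \<otimes> h\<^sub>2"
  have xy: "?x \<in> carrier G" "?y \<in> carrier G" using x h H_carrier by auto
  have H: "inv ?x \<otimes> ?y \<in> H" using x h by (simp add: word_simps H_closed)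
  obtain \<sigma> where \<sigma>: "\<sigma> \<in> {0..wdist ?x ?y}" "wdist (\<eta> \<tau>) (geo ?x ?y \<sigma>) \<le> N k (c + 2 * D) + D"
    using geo_morse_near[OF xy H _ _ _ q _ _ \<tau>, of 0 "wdist ?x ?y" D] D xy by (auto simp: geo_0 geo_end)
  obtain h where h': "h \<in> H" "wdist (geo ?x ?y \<sigma>) (?x \<otimes> h) \<le> r\<^sub>H"
    using geo_near_coset[OF xy H \<sigma>(1)] by blast
  have "wdist (\<eta> \<tau>) (x \<otimes> (h\<^sub>1 \<otimes> h)) \<le> N k (c + 2 * D) + D + r\<^sub>H"
    using \<sigma>(2) h' wdist_triangle[of "\<eta> \<tau>" "geo ?x ?y \<sigma>" "?x \<otimes> h"] xy x h H_carrier qgD(4)[OF q \<tau>]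
    by (simp add: m_assoc)
  then show ?thesis using H_mult[OF h(1) h'(1)] by blast
qed

text \<open>
  The geodesic from \<open>x h\<close> to the point \<open>p = x h'\<close> of the coset nearest to \<open>y\<close> stays near the
  coset, so none of its points is much nearer to \<open>y\<close> than \<open>p\<close>, and \<open>qg_concat\<close> extends it to
  \<open>y\<close>.
\<close>

lemma path_through_nearest_point:
  assumes x: "x \<in> carrier G" and y: "y \<in> carrier G" and h: "h \<in> H" "h' \<in> H"
    and nearest: "\<And>h''. h'' \<in> H \<Longrightarrow> wdist y (x \<otimes> h') \<le> wdist y (x \<otimes> h'')"
  obtains a b \<zeta> \<tau> where "qg a b \<zeta> 3 (2 * r\<^sub>H + 4)" "\<zeta> a = x \<otimes> h" "\<zeta> b = y" "\<tau> \<in> {a..b}" "\<zeta> \<tau> = x \<otimes> h'"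
proof -
  let ?x = "x \<otimes> h" and ?p = "x \<otimes> h'"
  have xp: "?x \<in> carrier G" "?p \<in> carrier G" using x h H_carrier by auto
  have H: "inv ?x \<otimes> ?p \<in> H" using x h by (simp add: word_simps H_closed)
  let ?l = "wdist ?x ?p"
  have near: "wdist y (geo ?x ?p ?l) \<le> wdist y (geo ?x ?p t) + r\<^sub>H" if t: "t \<in> {0..?l}" for t
  proof -
    obtain h'' where h'': "h'' \<in> H" "wdist (geo ?x ?p t) (?x \<otimes> h'') \<le> r\<^sub>H"
      using geo_near_coset[OF xp H t] by blast
    have "wdist y ?p \<le> wdist y (?x \<otimes> h'')"
      using nearest[of "h \<otimes> h''"] h h'' x by (simp add: m_assoc H_closed)
    also have "\<dots> \<le> wdist y (geo ?x ?p t) + r\<^sub>H"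
      using wdist_triangle[of y "geo ?x ?p t" "?x \<otimes> h''"] h'' y xp H_carrier by simp
    finally show ?thesis using geo_end[OF xp] by simp
  qed
  from qg_concat[OF qg_geo[OF xp] _ y r\<^sub>H near] obtain b \<zeta> where
    "?l \<le> b" "qg 0 b \<zeta> (3 * 1) (1 + 2 * r\<^sub>H + 3)" "\<And>t. t \<in> {0..?l} \<Longrightarrow> \<zeta> t = geo ?x ?p t" "\<zeta> b = y" by auto
  then show ?thesis
    using that[of 0 b \<zeta> ?l] geo_0[OF xp] geo_end[OF xp] by (simp add: add.commute)
qed

section \<open>A conjugate with finite intersection\<close>

text \<open>
  Two applications of \<open>qg_concat\<close> to a geodesic turn the constants \<open>(1, 1)\<close> into
  \<open>(3, 2 r\<^sub>H + 4)\<close> and then \<open>(9, 4 r\<^sub>H + 7)\<close>.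
\<close>

definition coset_gap :: real where
  "coset_gap = N 9 (4 * r\<^sub>H + 7) + r\<^sub>H"

text \<open>
  Let \<open>p \<in> H\<close> and \<open>q \<in> gH\<close> be at minimal distance \<open>m\<close>. An element \<open>w \<in> H \<inter> gHg\<^bsup>-1\<^esup>\<close> preserves
  both cosets, so \<open>w p\<close> and \<open>w q\<close> are again at distance \<open>m\<close>. If \<open>w\<close> moves \<open>p\<close> by much more than
  \<open>m\<close>, then the path from \<open>p\<close> to \<open>q\<close>, along \<open>gH\<close> to \<open>w q\<close>, and to \<open>w p\<close> is a quasi-geodesic with
  constants that do not involve \<open>m\<close>. Its endpoints lie in \<open>H\<close>, so its point \<open>q\<close> is close to \<open>H\<close>,
  and \<open>m\<close> is bounded.
\<close>

lemma double_coset_short: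
  assumes g: "g \<in> carrier G" and inf: "infinite {w \<in> H. \<exists>v\<in>H. w \<otimes> g = g \<otimes> v}"
  shows "\<exists>h\<^sub>1\<in>H. \<exists>h\<^sub>2\<in>H. wdist h\<^sub>1 (g \<otimes> h\<^sub>2) \<le> coset_gap"
proof -
  obtain h\<^sub>1 h\<^sub>2 where h: "h\<^sub>1 \<in> H" "h\<^sub>2 \<in> H"
    and min: "\<And>h h'. h \<in> H \<Longrightarrow> h' \<in> H \<Longrightarrow> wdist h\<^sub>1 (g \<otimes> h\<^sub>2) \<le> wdist h (g \<otimes> h')"
    using ex_has_least_nat[of "\<lambda>(h, h'). h \<in> H \<and> h' \<in> H" "(\<one>, \<one>)" "\<lambda>(h, h'). wlen (inv h \<otimes> (g \<otimes> h'))"]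
    by (auto simp: H_one wdist_def)
  define p q where "p = h\<^sub>1" and "q = g \<otimes> h\<^sub>2"
  have pq: "p \<in> carrier G" "q \<in> carrier G" using g h H_carrier by (auto simp: p_def q_def)
  define m where "m = wdist p q"
  have mq: "m \<le> wdist h (q \<otimes> h')" if "h \<in> H" "h' \<in> H" for h h'
    using min[of h "h\<^sub>2 \<otimes> h'"] that h g by (simp add: m_def p_def q_def m_assoc H_closed)
  obtain w v where w: "w \<in> H" "v \<in> H" "w \<otimes> g = g \<otimes> v" and far: "wdist p (w \<otimes> p) > 2 * m + 1"
  proof (rule ccontr)
    assume *: "\<not> thesis"
    let ?W = "{w \<in> H. \<exists>v\<in>H. w \<otimes> g = g \<otimes> v}"
    have "inj_on (\<lambda>w. inv p \<otimes> (w \<otimes> p)) ?W"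
      using pq H_carrier by (intro inj_onI) auto
    moreover have "(\<lambda>w. inv p \<otimes> (w \<otimes> p)) ` ?W \<subseteq> {x \<in> carrier G. wlen x \<le> nat \<lfloor>2 * m + 1\<rfloor>}"
    proof safe
      fix w v assume "w \<in> H" "v \<in> H" "w \<otimes> g = g \<otimes> v"
      then have "wdist p (w \<otimes> p) \<le> 2 * m + 1" using * that by fastforce
      then show "wlen (inv p \<otimes> (w \<otimes> p)) \<le> nat \<lfloor>2 * m + 1\<rfloor>" by (simp add: wdist_def) linarith
    qed (use pq H_carrier in auto)
    ultimately show False using inf finite_ball by (meson finite_imageD finite_subset)
  qed
  have wG: "w \<in> carrier G" "v \<in> carrier G" using w H_carrier by auto
  have wp: "w \<otimes> p \<in> H" "w \<otimes> p \<in> carrier G" "w \<otimes> q \<in> carrier G"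
    using w h pq wG by (auto simp: p_def H_mult)
  \<comment> \<open>Since \<open>w g = g v\<close>, left multiplication by \<open>w\<close> maps \<open>gH\<close> to itself.\<close>
  have wq: "w \<otimes> q = q \<otimes> (inv h\<^sub>2 \<otimes> v \<otimes> h\<^sub>2)"
  proof -
    have "w \<otimes> q = g \<otimes> v \<otimes> h\<^sub>2" using w wG g h H_carrier by (simp add: q_def flip: m_assoc)
    then show ?thesis using wG g h H_carrier by (simp add: q_def word_simps)
  qed
  have H: "inv q \<otimes> (w \<otimes> q) \<in> H"
    using wq pq w h by (simp add: word_simps H_closed)
  let ?l = "wdist q (w \<otimes> q)" and ?\<beta> = "geo q (w \<otimes> q)"
  have \<beta>: "m \<le> wdist h (?\<beta> t) + r\<^sub>H" if t: "t \<in> {0..?l}" and "h \<in> H" for t h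
  proof -
    obtain h' where h': "h' \<in> H" "wdist (?\<beta> t) (q \<otimes> h') \<le> r\<^sub>H"
      using geo_near_coset[OF pq(2) wp(3) H t] by blast
    then show ?thesis
      using wdist_triangle[of h "?\<beta> t" "q \<otimes> h'"] mq[OF \<open>h \<in> H\<close> h'(1)] pq wp H_carrier that by simp
  qed
  have "wdist p (?\<beta> 0) = m" using geo_0[OF pq(2) wp(3)] by (simp add: m_def)
  with \<beta> h have "wdist p (?\<beta> 0) \<le> wdist p (?\<beta> t) + r\<^sub>H" if "t \<in> {0..?l}" for t using that by (simp add: p_def)
  from qg_concat_left[OF qg_geo[OF pq(2) wp(3)] _ pq(1) r\<^sub>H this] obtain a \<zeta> where
    \<zeta>: "a \<le> 0" "qg a ?l \<zeta> 3 (2 * r\<^sub>H + 4)" "\<And>t. t \<in> {0..?l} \<Longrightarrow> \<zeta> t = ?\<beta> t" "\<zeta> a = p"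
      "\<And>t. t \<in> {a..0} \<Longrightarrow> wdist p (\<zeta> t) \<le> m + 1"
    using \<open>wdist p (?\<beta> 0) = m\<close> by (auto simp: add.commute)
  have \<zeta>l: "\<zeta> ?l = w \<otimes> q" "\<zeta> 0 = q" using \<zeta>(3) geo_end[OF pq(2) wp(3)] geo_0[OF pq(2) wp(3)] by auto
  have mw: "wdist (w \<otimes> p) (w \<otimes> q) = m" using wG pq by (simp add: m_def wdist_left_invariant)
  have "wdist (w \<otimes> p) (\<zeta> ?l) \<le> wdist (w \<otimes> p) (\<zeta> t) + r\<^sub>H" if t: "t \<in> {a..?l}" for t
  proof (cases "t \<le> 0")
    case True
    then have "wdist p (\<zeta> t) \<le> m + 1" using \<zeta>(5) t by auto
    moreover have "wdist p (w \<otimes> p) \<le> wdist p (\<zeta> t) + wdist (w \<otimes> p) (\<zeta> t)"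
      using wdist_triangle[of p "\<zeta> t" "w \<otimes> p"] wdist_commute[of "w \<otimes> p" "\<zeta> t"] pq wp qgD(4)[OF \<zeta>(2) t] by simp
    ultimately show ?thesis using far mw \<zeta>l r\<^sub>H by simp
  next
    case False
    then show ?thesis using \<beta>[of t "w \<otimes> p"] wp \<zeta>(3)[of t] t mw \<zeta>l by simp
  qed
  note n2 = this
  have al: "a \<le> ?l" using order_trans[OF \<zeta>(1) wdist_nonneg] .
  from qg_concat[OF \<zeta>(2) _ wp(2) r\<^sub>H n2] al obtain b \<xi> where
    \<xi>: "?l \<le> b" "qg a b \<xi> 9 (4 * r\<^sub>H + 7)" "\<And>t. t \<in> {a..?l} \<Longrightarrow> \<xi> t = \<zeta> t" "\<xi> b = w \<otimes> p"
    by (auto simp: add.commute)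
  have "\<xi> a = p" "\<xi> 0 = q" using \<xi>(3) \<zeta>l \<zeta>(1,4) al by auto
  then obtain h where "h \<in> H" "wdist q h \<le> N 9 (4 * r\<^sub>H + 7) + r\<^sub>H"
    using coset_quasiconvex[OF one_closed h(1) wp(1) \<xi>(2), of 0 0] \<xi> \<zeta>(1) pq wp H_carrier
    by (auto simp: p_def order_trans[OF \<zeta>(1)] order_trans[OF wdist_nonneg \<xi>(1)])
  then show ?thesis using wdist_commute[of q h] pq h H_carrier by (auto simp: coset_gap_def q_def)
qed

text \<open>
  Suppose that \<open>H \<inter> xHx\<^bsup>-1\<^esup>\<close> is infinite for all \<open>x\<close>. Then \<open>double_coset_short\<close> provides such an
  \<open>R\<close>, and left multiplication makes any two left cosets \<open>R\<close>-close. The aim is that \<open>H\<close> has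
  finite index.
\<close>

context
  fixes R :: real
  assumes close: "\<And>x. x \<in> carrier G \<Longrightarrow> \<exists>h\<^sub>1\<in>H. \<exists>h\<^sub>2\<in>H. wdist h\<^sub>1 (x \<otimes> h\<^sub>2) \<le> R"
begin

definition D\<^sub>1 where "D\<^sub>1 = N 3 (2 * r\<^sub>H + 4 + 2 * R) + R + r\<^sub>H"

text \<open>
  The path from a point of \<open>x\<^sub>2 H\<close> close to \<open>x\<^sub>1 H\<close>, to the nearest point \<open>x\<^sub>2 h'\<close>, and on to
  \<open>x\<^sub>1 h\<close> is a quasi-geodesic with both ends at \<open>x\<^sub>1 H\<close>, so \<open>x\<^sub>2 h'\<close> is close to \<open>x\<^sub>1 H\<close>,
  wherever \<open>x\<^sub>1 h\<close> is.
\<close>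

lemma nearest_point_close:
  assumes x: "x\<^sub>1 \<in> carrier G" "x\<^sub>2 \<in> carrier G" and h: "h \<in> H" "h' \<in> H"
    and nearest: "\<And>h''. h'' \<in> H \<Longrightarrow> wdist (x\<^sub>1 \<otimes> h) (x\<^sub>2 \<otimes> h') \<le> wdist (x\<^sub>1 \<otimes> h) (x\<^sub>2 \<otimes> h'')"
  shows "\<exists>u\<in>H. wdist (x\<^sub>2 \<otimes> h') (x\<^sub>1 \<otimes> u) \<le> D\<^sub>1"
proof -
  obtain h\<^sub>1 h\<^sub>2 where h12: "h\<^sub>1 \<in> H" "h\<^sub>2 \<in> H" "wdist h\<^sub>1 (inv x\<^sub>1 \<otimes> x\<^sub>2 \<otimes> h\<^sub>2) \<le> R"
    using close[of "inv x\<^sub>1 \<otimes> x\<^sub>2"] x by auto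
  have "wdist (x\<^sub>1 \<otimes> h\<^sub>1) (x\<^sub>1 \<otimes> (inv x\<^sub>1 \<otimes> x\<^sub>2 \<otimes> h\<^sub>2)) \<le> R"
    using h12 x H_carrier by (subst wdist_left_invariant) auto
  then have R: "wdist (x\<^sub>2 \<otimes> h\<^sub>2) (x\<^sub>1 \<otimes> h\<^sub>1) \<le> R"
    using h12 x H_carrier wdist_commute[of "x\<^sub>2 \<otimes> h\<^sub>2" "x\<^sub>1 \<otimes> h\<^sub>1"] by (simp add: word_simps)
  then have R0: "0 \<le> R" using wdist_nonneg order_trans by blast
  obtain a b \<zeta> \<tau> where \<zeta>: "qg a b \<zeta> 3 (2 * r\<^sub>H + 4)" "\<zeta> a = x\<^sub>2 \<otimes> h\<^sub>2" "\<zeta> b = x\<^sub>1 \<otimes> h" "\<tau> \<in> {a..b}"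
    "\<zeta> \<tau> = x\<^sub>2 \<otimes> h'"
    using path_through_nearest_point[OF x(2) _ h12(2) h(2) nearest] x h H_carrier by (metis m_closed)
  show ?thesis
    using coset_quasiconvex[OF x(1) h12(1) h(1) \<zeta>(1) _ _ \<zeta>(4), of R] R R0 \<zeta> x h H_carrier
    by (simp add: D\<^sub>1_def)
qed

definition D\<^sub>2 where "D\<^sub>2 = N 3 (2 * r\<^sub>H + 4 + 2 * D\<^sub>1) + D\<^sub>1 + r\<^sub>H"
definition D\<^sub>3 where "D\<^sub>3 = N 3 (2 * r\<^sub>H + 4 + 2 * (D\<^sub>1 + D\<^sub>2)) + (D\<^sub>1 + D\<^sub>2)"
definition D\<^sub>4 where "D\<^sub>4 = N 1 (1 + 2 * (D\<^sub>2 + D\<^sub>3)) + (D\<^sub>2 + D\<^sub>3) + r\<^sub>H + 3 + 4 * D\<^sub>3"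

text \<open>
  This is the Helly property. Let \<open>p\<^sub>i\<close> be the point of \<open>x\<^sub>i H\<close> nearest to \<open>\<one>\<close>, and \<open>q\<close> the
  point of \<open>x\<^sub>2 H\<close> nearest to \<open>p\<^sub>1\<close>. The paths from \<open>\<one>\<close> through \<open>p\<^sub>1\<close> along \<open>x\<^sub>1 H\<close>, and from
  \<open>\<one>\<close> through \<open>p\<^sub>2\<close> along \<open>x\<^sub>2 H\<close>, both end near \<open>q\<close>, and \<open>q\<close> is near some \<open>h\<^sub>q \<in> H\<close>. So \<open>p\<^sub>1\<close>
  and \<open>p\<^sub>2\<close> are both near a geodesic \<open>\<alpha>\<close> between \<open>h\<^sub>q\<close> and \<open>\<one>\<close>. As \<open>p\<^sub>1\<close> is at least as far from
  \<open>\<one>\<close> as \<open>p\<^sub>2\<close>, it lies near the part of \<open>\<alpha>\<close> between \<open>h\<^sub>q\<close> and \<open>p\<^sub>2\<close>, whose ends are near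
  \<open>x\<^sub>2 H\<close>.
\<close>

lemma farthest_nearest_point_close:
  assumes x: "x\<^sub>1 \<in> carrier G" "x\<^sub>2 \<in> carrier G" and a: "a\<^sub>1 \<in> H" "a\<^sub>2 \<in> H"
    and nearest: "\<And>h. h \<in> H \<Longrightarrow> wdist \<one> (x\<^sub>1 \<otimes> a\<^sub>1) \<le> wdist \<one> (x\<^sub>1 \<otimes> h)"
      "\<And>h. h \<in> H \<Longrightarrow> wdist \<one> (x\<^sub>2 \<otimes> a\<^sub>2) \<le> wdist \<one> (x\<^sub>2 \<otimes> h)"
    and le: "wdist \<one> (x\<^sub>2 \<otimes> a\<^sub>2) \<le> wdist \<one> (x\<^sub>1 \<otimes> a\<^sub>1)"
  shows "\<exists>h\<in>H. wdist (x\<^sub>1 \<otimes> a\<^sub>1) (x\<^sub>2 \<otimes> h) \<le> D\<^sub>4"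
proof -
  define p\<^sub>1 p\<^sub>2 where "p\<^sub>1 = x\<^sub>1 \<otimes> a\<^sub>1" and "p\<^sub>2 = x\<^sub>2 \<otimes> a\<^sub>2"
  have p: "p\<^sub>1 \<in> carrier G" "p\<^sub>2 \<in> carrier G" using x a H_carrier by (auto simp: p\<^sub>1_def p\<^sub>2_def)
  obtain u\<^sub>1 where u\<^sub>1: "u\<^sub>1 \<in> H" "wdist p\<^sub>1 u\<^sub>1 \<le> D\<^sub>1"
    using nearest_point_close[OF one_closed x(1) H_one a(1)] nearest(1) H_carrier by (auto simp: p\<^sub>1_def)
  obtain u\<^sub>2 where u\<^sub>2: "u\<^sub>2 \<in> H" "wdist p\<^sub>2 u\<^sub>2 \<le> D\<^sub>1"
    using nearest_point_close[OF one_closed x(2) H_one a(2)] nearest(2) H_carrier by (auto simp: p\<^sub>2_def)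
  have D1: "0 \<le> D\<^sub>1" using u\<^sub>1(2) wdist_nonneg order_trans by blast
  then have D2: "0 \<le> D\<^sub>2" using r\<^sub>H by (auto simp: D\<^sub>2_def intro!: add_nonneg_nonneg N_nonneg)
  then have D3: "0 \<le> D\<^sub>3" using r\<^sub>H D1 by (auto simp: D\<^sub>3_def intro!: add_nonneg_nonneg N_nonneg)
  have N1: "0 \<le> N 1 (1 + 2 * (D\<^sub>2 + D\<^sub>3))" using D2 D3 by (intro N_nonneg) auto
  obtain b where b: "b \<in> H" "\<And>h. h \<in> H \<Longrightarrow> wdist p\<^sub>1 (x\<^sub>2 \<otimes> b) \<le> wdist p\<^sub>1 (x\<^sub>2 \<otimes> h)"
    using nearest_point_exists[of "(\<lambda>h. x\<^sub>2 \<otimes> h) ` H" p\<^sub>1] H_one by auto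
  define q where "q = x\<^sub>2 \<otimes> b"
  have q: "q \<in> carrier G" using x b H_carrier by (auto simp: q_def)
  obtain c where c: "c \<in> H" "wdist q (x\<^sub>1 \<otimes> c) \<le> D\<^sub>1"
    using nearest_point_close[OF x a(1) b(1)] b(2) by (auto simp: p\<^sub>1_def q_def)
  have cG: "x\<^sub>1 \<otimes> c \<in> carrier G" using x c H_carrier by auto
  obtain h\<^sub>q where hq: "h\<^sub>q \<in> H" "wdist q h\<^sub>q \<le> D\<^sub>2"
  proof -
    obtain s t \<zeta> \<tau> where \<zeta>: "qg s t \<zeta> 3 (2 * r\<^sub>H + 4)" "\<zeta> s = p\<^sub>2" "\<zeta> t = p\<^sub>1" "\<tau> \<in> {s..t}" "\<zeta> \<tau> = q"
      using path_through_nearest_point[OF x(2) p(1) a(2) b(1) b(2)] by (metis p\<^sub>2_def q_def)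
    show ?thesis
      using coset_quasiconvex[OF one_closed u\<^sub>2(1) u\<^sub>1(1) \<zeta>(1) _ _ \<zeta>(4), of D\<^sub>1] u\<^sub>1 u\<^sub>2 \<zeta> H_carrier that
      by (auto simp: D\<^sub>2_def)
  qed
  have hqG: "h\<^sub>q \<in> carrier G" using hq H_carrier by auto
  define \<alpha> L where "\<alpha> = geo h\<^sub>q \<one>" and "L = wdist h\<^sub>q \<one>"
  have \<alpha>H: "inv h\<^sub>q \<otimes> \<one> \<in> H" using hq by (simp add: H_closed)
  have \<alpha>G: "\<alpha> s \<in> carrier G" for s using hqG by (simp add: \<alpha>_def)
  have \<alpha>0: "\<alpha> 0 = h\<^sub>q" "\<alpha> L = \<one>" using geo_0 geo_end hqG by (auto simp: \<alpha>_def L_def)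
  have near: "\<exists>\<sigma>\<in>{0..L}. wdist z (\<alpha> \<sigma>) \<le> D\<^sub>3"
    if "qg s t \<zeta> 3 (2 * r\<^sub>H + 4)" "wdist (\<zeta> s) h\<^sub>q \<le> D\<^sub>1 + D\<^sub>2" "\<zeta> t = \<one>" "\<tau> \<in> {s..t}" "\<zeta> \<tau> = z" for s t \<zeta> \<tau> z
    using geo_morse_near[OF hqG one_closed \<alpha>H, of 0 L s t \<zeta> 3 "2 * r\<^sub>H + 4" "D\<^sub>1 + D\<^sub>2" \<tau>] that \<alpha>0 D1 D2
    by (simp add: \<alpha>_def L_def D\<^sub>3_def)
  obtain s\<^sub>1 where s\<^sub>1: "s\<^sub>1 \<in> {0..L}" "wdist p\<^sub>1 (\<alpha> s\<^sub>1) \<le> D\<^sub>3"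
  proof -
    obtain s t \<zeta> \<tau> where \<zeta>: "qg s t \<zeta> 3 (2 * r\<^sub>H + 4)" "\<zeta> s = x\<^sub>1 \<otimes> c" "\<zeta> t = \<one>" "\<tau> \<in> {s..t}" "\<zeta> \<tau> = p\<^sub>1"
      using path_through_nearest_point[OF x(1) one_closed c(1) a(1) nearest(1)] by (metis p\<^sub>1_def)
    have "wdist (x\<^sub>1 \<otimes> c) h\<^sub>q \<le> D\<^sub>1 + D\<^sub>2"
      using wdist_triangle[of "x\<^sub>1 \<otimes> c" q h\<^sub>q] wdist_commute[of "x\<^sub>1 \<otimes> c" q] c hq hqG q cG by simp
    with near[OF \<zeta>(1) _ \<zeta>(3,4,5)] \<zeta>(2) that show ?thesis by auto
  qed
  obtain s\<^sub>2 where s\<^sub>2: "s\<^sub>2 \<in> {0..L}" "wdist p\<^sub>2 (\<alpha> s\<^sub>2) \<le> D\<^sub>3"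
  proof -
    obtain s t \<zeta> \<tau> where \<zeta>: "qg s t \<zeta> 3 (2 * r\<^sub>H + 4)" "\<zeta> s = q" "\<zeta> t = \<one>" "\<tau> \<in> {s..t}" "\<zeta> \<tau> = p\<^sub>2"
      using path_through_nearest_point[OF x(2) one_closed b(1) a(2) nearest(2)] by (metis p\<^sub>2_def q_def)
    have "wdist q h\<^sub>q \<le> D\<^sub>1 + D\<^sub>2" using hq D1 by simp
    with near[OF \<zeta>(1) _ \<zeta>(3,4,5)] \<zeta>(2) that show ?thesis by auto
  qed
  have "\<exists>h\<in>H. wdist (\<alpha> s\<^sub>1) (x\<^sub>2 \<otimes> h) \<le> D\<^sub>4 - D\<^sub>3"
  proof (cases "s\<^sub>1 \<le> s\<^sub>2")
    case True
    have "qg 0 s\<^sub>2 \<alpha> 1 1"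
      using qg_subinterval[OF qg_geo[OF hqG one_closed]] s\<^sub>2 by (simp add: \<alpha>_def L_def)
    moreover have "wdist (\<alpha> 0) (x\<^sub>2 \<otimes> b) \<le> D\<^sub>2 + D\<^sub>3"
      using hq D3 wdist_commute[OF q hqG] by (simp add: \<alpha>0 q_def)
    moreover have "wdist (\<alpha> s\<^sub>2) (x\<^sub>2 \<otimes> a\<^sub>2) \<le> D\<^sub>2 + D\<^sub>3"
      using s\<^sub>2 D2 wdist_commute[OF p(2) \<alpha>G] by (simp add: p\<^sub>2_def)
    ultimately obtain h where "h \<in> H" "wdist (\<alpha> s\<^sub>1) (x\<^sub>2 \<otimes> h) \<le> N 1 (1 + 2 * (D\<^sub>2 + D\<^sub>3)) + (D\<^sub>2 + D\<^sub>3) + r\<^sub>H"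
      using coset_quasiconvex[OF x(2) b(1) a(2), of 0 s\<^sub>2 \<alpha> 1 1 "D\<^sub>2 + D\<^sub>3" s\<^sub>1] True s\<^sub>1 by auto
    then show ?thesis using D3 by (intro bexI[of _ h]) (auto simp: D\<^sub>4_def)
  next
    case False
    have "wdist \<one> p\<^sub>1 \<le> L - s\<^sub>1 + 1 + D\<^sub>3"
      using wdist_triangle[of \<one> "\<alpha> s\<^sub>1" p\<^sub>1] wdist_commute[of p\<^sub>1 "\<alpha> s\<^sub>1"] wdist_commute[of \<one> "\<alpha> s\<^sub>1"]
        geo_dist(2)[OF hqG one_closed, of s\<^sub>1 L] s\<^sub>1 p \<alpha>G \<alpha>0 by (simp add: L_def \<alpha>_def)
    moreover have "L - s\<^sub>2 - 1 \<le> wdist \<one> p\<^sub>2 + D\<^sub>3"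
      using wdist_triangle[of \<one> p\<^sub>2 "\<alpha> s\<^sub>2"] wdist_commute[of \<one> "\<alpha> s\<^sub>2"]
        geo_dist(1)[OF hqG one_closed, of s\<^sub>2 L] s\<^sub>2 p \<alpha>G \<alpha>0 by (simp add: L_def \<alpha>_def)
    ultimately have "s\<^sub>1 - s\<^sub>2 \<le> 2 + 2 * D\<^sub>3" using le by (simp add: p\<^sub>1_def p\<^sub>2_def)
    moreover have "wdist (\<alpha> s\<^sub>2) (\<alpha> s\<^sub>1) \<le> s\<^sub>1 - s\<^sub>2 + 1"
      using geo_dist(2)[OF hqG one_closed, of s\<^sub>2 s\<^sub>1] False s\<^sub>1 s\<^sub>2 by (simp add: L_def \<alpha>_def)
    ultimately have "wdist (\<alpha> s\<^sub>1) p\<^sub>2 \<le> 3 + 3 * D\<^sub>3"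
      using wdist_triangle[of "\<alpha> s\<^sub>1" "\<alpha> s\<^sub>2" p\<^sub>2] wdist_commute[of "\<alpha> s\<^sub>1" "\<alpha> s\<^sub>2"] wdist_commute[of p\<^sub>2 "\<alpha> s\<^sub>2"]
        s\<^sub>2 p \<alpha>G by simp
    then show ?thesis using a N1 D2 D3 r\<^sub>H by (intro bexI[of _ a\<^sub>2]) (auto simp: D\<^sub>4_def p\<^sub>2_def)
  qed
  then obtain h where "h \<in> H" "wdist (\<alpha> s\<^sub>1) (x\<^sub>2 \<otimes> h) \<le> D\<^sub>4 - D\<^sub>3" by blast
  then show ?thesis
    using wdist_triangle[of p\<^sub>1 "\<alpha> s\<^sub>1" "x\<^sub>2 \<otimes> h"] s\<^sub>1 p \<alpha>G x H_carrier
    by (intro bexI[of _ h]) (auto simp: p\<^sub>1_def)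
qed

text \<open>
  In a finite family of left cosets, choose the one farthest from \<open>\<one>\<close>, and let \<open>p\<close> be its point
  nearest to \<open>\<one>\<close>. By the Helly property all cosets of the family meet the ball of radius \<open>D\<^sub>4\<close>
  around \<open>p\<close>, so there are no more of them than points in that ball. Inversion turns the right
  cosets \<open>H r\<close> into the left cosets \<open>r\<^bsup>-1\<^esup> H\<close>.
\<close>

lemma finite_rcosets_if_close: "finite (rcosets H)"
proof (rule ccontr)
  assume inf: "infinite (rcosets H)"
  define B where "B = {x \<in> carrier G. wlen x \<le> nat \<lfloor>D\<^sub>4\<rfloor>}"
  have B: "finite B" unfolding B_def by (rule finite_ball)
  obtain F where F: "F \<subseteq> rcosets H" "finite F" "card F = Suc (card B)"
    using infinite_arbitrarily_large[OF inf] by blast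
  have "\<exists>r\<in>carrier G. \<exists>a\<in>H. C = H #> r \<and> (\<forall>h\<in>H. wdist \<one> (inv r \<otimes> a) \<le> wdist \<one> (inv r \<otimes> h))"
    if C: "C \<in> F" for C
  proof -
    obtain r where r: "r \<in> carrier G" "C = H #> r" using C F(1) by (auto simp: RCOSETS_def)
    obtain a where "a \<in> H" "\<forall>h\<in>H. wdist \<one> (inv r \<otimes> a) \<le> wdist \<one> (inv r \<otimes> h)"
      using nearest_point_exists[of "(\<lambda>h. inv r \<otimes> h) ` H" \<one>] H_one by auto
    with r show ?thesis by blast
  qed
  then obtain r a where ra: "\<And>C. C \<in> F \<Longrightarrow> r C \<in> carrier G" "\<And>C. C \<in> F \<Longrightarrow> a C \<in> H" "\<And>C. C \<in> F \<Longrightarrow> C = H #> r C"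
    "\<And>C h. C \<in> F \<Longrightarrow> h \<in> H \<Longrightarrow> wdist \<one> (inv (r C) \<otimes> a C) \<le> wdist \<one> (inv (r C) \<otimes> h)"
    by metis
  define p where "p C = inv (r C) \<otimes> a C" for C
  have p: "p C \<in> carrier G" if "C \<in> F" for C using ra that H_carrier by (auto simp: p_def)
  have "F \<noteq> {}" using F by auto
  then have "Max ((\<lambda>C. wdist \<one> (p C)) ` F) \<in> (\<lambda>C. wdist \<one> (p C)) ` F"
    using F(2) by (intro Max_in) auto
  then obtain C\<^sub>0 where C0': "C\<^sub>0 \<in> F" "Max ((\<lambda>C. wdist \<one> (p C)) ` F) = wdist \<one> (p C\<^sub>0)"
    by blast
  have C0: "C\<^sub>0 \<in> F" "\<And>C. C \<in> F \<Longrightarrow> wdist \<one> (p C) \<le> wdist \<one> (p C\<^sub>0)"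
    unfolding C0'(2)[symmetric] using C0'(1) F(2) by (auto intro: Max_ge)
  have "C \<in> (\<lambda>b. H #> (inv b \<otimes> inv (p C\<^sub>0))) ` B" if C: "C \<in> F" for C
  proof -
    obtain h where h: "h \<in> H" "wdist (p C\<^sub>0) (inv (r C) \<otimes> h) \<le> D\<^sub>4"
      using farthest_nearest_point_close[of "inv (r C\<^sub>0)" "inv (r C)" "a C\<^sub>0" "a C"] ra C C0
      unfolding p_def by blast
    define b where "b = inv (p C\<^sub>0) \<otimes> (inv (r C) \<otimes> h)"
    have c: "r C \<in> carrier G" "h \<in> carrier G" "p C\<^sub>0 \<in> carrier G" using ra(1) C C0 h p H_carrier by auto
    have "b \<in> B" using h(2) c by (simp add: b_def B_def wdist_def) linarith
    moreover have "inv b \<otimes> inv (p C\<^sub>0) = inv h \<otimes> r C" using c by (simp add: b_def word_simps)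
    moreover have "H #> (inv h \<otimes> r C) = C"
      using ra(3)[OF C] coset_mult_assoc[of H "inv h" "r C"] c h H_carrier
        coset_join2[OF _ subgroup_H H_inv[OF h(1)]] by auto
    ultimately show ?thesis by (intro image_eqI[of _ _ b]) simp_all
  qed
  then have "F \<subseteq> (\<lambda>b. H #> (inv b \<otimes> inv (p C\<^sub>0))) ` B" by blast
  then have "card F \<le> card B" using B by (meson card_image_le card_mono finite_imageI le_trans)
  then show False using F by simp
qed

end

theorem exists_finite_conjugate_intersection:
  assumes "infinite (rcosets H)"
  shows "\<exists>g\<in>carrier G. finite {w \<in> H. \<exists>v\<in>H. w \<otimes> g = g \<otimes> v}"
proof (rule ccontr)
  assume *: "\<not> ?thesis"
  have "\<exists>h\<^sub>1\<in>H. \<exists>h\<^sub>2\<in>H. wdist h\<^sub>1 (x \<otimes> h\<^sub>2) \<le> coset_gap" if "x \<in> carrier G" for x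
    using double_coset_short[OF that] * that by blast
  from finite_rcosets_if_close[OF this] assms show False by simp
qed


section \<open>Morse quasi-geodesics\<close>

abbreviation mqg :: "(real \<Rightarrow> real \<Rightarrow> real) \<Rightarrow> real \<Rightarrow> real \<Rightarrow> real \<Rightarrow> real \<Rightarrow> (real \<Rightarrow> 'a) \<Rightarrow> bool" where
  "mqg M k c a b \<equiv> morse_quasi_geodesic (carrier G) wdist M k c {a..b}"

lemma mqgI:
  assumes "qg a b \<gamma> k c"
    and "\<And>s t k' c' a' b' \<eta> \<tau>. a \<le> s \<Longrightarrow> s \<le> t \<Longrightarrow> t \<le> b \<Longrightarrow> qg a' b' \<eta> k' c' \<Longrightarrow>
      \<eta> a' = \<gamma> s \<Longrightarrow> \<eta> b' = \<gamma> t \<Longrightarrow> \<tau> \<in> {a'..b'} \<Longrightarrow> \<exists>\<sigma>\<in>{s..t}. wdist (\<eta> \<tau>) (\<gamma> \<sigma>) \<le> M k' c'"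
  shows "mqg M k c a b \<gamma>"
  unfolding morse_quasi_geodesic_def morse_def
proof (intro conjI allI impI image_subsetI)
  fix s t k' c' a' b' \<eta> \<tau>
  assume *: "s \<le> t" "{s..t} \<subseteq> {a..b}" "qg a' b' \<eta> k' c'" "\<eta> a' = \<gamma> s" "\<eta> b' = \<gamma> t" "\<tau> \<in> {a'..b'}"
  then show "\<eta> \<tau> \<in> neighbourhood (carrier G) wdist (M k' c') (\<gamma> ` {s..t})"
    using assms(2)[of s t a' b' \<eta> k' c' \<tau>] qgD(4)[OF *(3,6)] by (auto simp: neighbourhood_def)
qed fact

lemma mqgD:
  assumes "mqg M k c a b \<gamma>"
  shows "qg a b \<gamma> k c"
    and "a \<le> s \<Longrightarrow> s \<le> t \<Longrightarrow> t \<le> b \<Longrightarrow> qg a' b' \<eta> k' c' \<Longrightarrow>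
      \<eta> a' = \<gamma> s \<Longrightarrow> \<eta> b' = \<gamma> t \<Longrightarrow> \<tau> \<in> {a'..b'} \<Longrightarrow> \<exists>\<sigma>\<in>{s..t}. wdist (\<eta> \<tau>) (\<gamma> \<sigma>) \<le> M k' c'"
proof -
  show "qg a b \<gamma> k c" using assms by (simp add: morse_quasi_geodesic_def)
  assume *: "a \<le> s" "s \<le> t" "t \<le> b" "qg a' b' \<eta> k' c'" "\<eta> a' = \<gamma> s" "\<eta> b' = \<gamma> t" "\<tau> \<in> {a'..b'}"
  then have "\<eta> ` {a'..b'} \<subseteq> neighbourhood (carrier G) wdist (M k' c') (\<gamma> ` {s..t})"
    using assms[unfolded morse_quasi_geodesic_def morse_def] qgD(1-3)[OF *(4)] by simp
  from image_neighbourhoodD[OF this *(7)] show "\<exists>\<sigma>\<in>{s..t}. wdist (\<eta> \<tau>) (\<gamma> \<sigma>) \<le> M k' c'" .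
qed

lemma mqg_subinterval:
  assumes "mqg M k c a b \<gamma>" "a \<le> a'" "a' \<le> b'" "b' \<le> b"
  shows "mqg M k c a' b' \<gamma>"
proof (rule mqgI)
  show "qg a' b' \<gamma> k c" using qg_subinterval[OF mqgD(1)[OF assms(1)] assms(2-4)] .
qed (use assms mqgD(2)[OF assms(1)] in \<open>meson order_trans\<close>)

lemma mqg_cong:
  assumes "mqg M k c a b \<gamma>" "\<And>t. t \<in> {a..b} \<Longrightarrow> \<gamma> t = \<gamma>' t"
  shows "mqg M k c a b \<gamma>'"
proof (rule mqgI)
  show "qg a b \<gamma>' k c" using qg_cong[OF mqgD(1)[OF assms(1)] assms(2)] .
  fix s t k' c' a' b' \<eta> \<tau>
  assume *: "a \<le> s" "s \<le> t" "t \<le> b" "qg a' b' \<eta> k' c'" "\<eta> a' = \<gamma>' s" "\<eta> b' = \<gamma>' t" "\<tau> \<in> {a'..b'}"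
  then have "\<eta> a' = \<gamma> s" "\<eta> b' = \<gamma> t" using assms(2) by auto
  from mqgD(2)[OF assms(1) *(1-4) this *(7)] obtain \<sigma> where "\<sigma> \<in> {s..t}" "wdist (\<eta> \<tau>) (\<gamma> \<sigma>) \<le> M k' c'" ..
  then show "\<exists>\<sigma>\<in>{s..t}. wdist (\<eta> \<tau>) (\<gamma>' \<sigma>) \<le> M k' c'"
    using assms(2)[of \<sigma>] * by (intro bexI[of _ \<sigma>]) auto
qed

lemma mqg_translate:
  assumes "mqg M k c a b \<gamma>" and g: "g \<in> carrier G"
  shows "mqg M k c a b (\<lambda>t. g \<otimes> \<gamma> t)"
proof (rule mqgI)
  note q = mqgD(1)[OF assms(1)]
  show "qg a b (\<lambda>t. g \<otimes> \<gamma> t) k c" by (rule qg_translate[OF q g])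
  fix s t k' c' a' b' \<eta> \<tau>
  assume *: "a \<le> s" "s \<le> t" "t \<le> b" "qg a' b' \<eta> k' c'" "\<eta> a' = g \<otimes> \<gamma> s" "\<eta> b' = g \<otimes> \<gamma> t" "\<tau> \<in> {a'..b'}"
  have "inv g \<otimes> \<eta> a' = \<gamma> s" "inv g \<otimes> \<eta> b' = \<gamma> t"
    using * g qgD(4)[OF q, of s] qgD(4)[OF q, of t] by (auto simp: word_simps)
  from mqgD(2)[OF assms(1) *(1-3) qg_translate[OF *(4) inv_closed[OF g]] this *(7)]
  obtain \<sigma> where \<sigma>: "\<sigma> \<in> {s..t}" "wdist (inv g \<otimes> \<eta> \<tau>) (\<gamma> \<sigma>) \<le> M k' c'" ..
  have c: "\<eta> \<tau> \<in> carrier G" "\<gamma> \<sigma> \<in> carrier G" using qgD(4)[OF *(4,7)] qgD(4)[OF q, of \<sigma>] \<sigma> * by auto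
  then have "wdist (\<eta> \<tau>) (g \<otimes> \<gamma> \<sigma>) \<le> M k' c'"
    using wdist_left_invariant[of g "inv g \<otimes> \<eta> \<tau>" "\<gamma> \<sigma>"] \<sigma>(2) g by (simp add: word_simps)
  with \<sigma>(1) show "\<exists>\<sigma>\<in>{s..t}. wdist (\<eta> \<tau>) (g \<otimes> \<gamma> \<sigma>) \<le> M k' c'" ..
qed

lemma mqg_shift:
  assumes "mqg M k c a b \<gamma>"
  shows "mqg M k c (a + r) (b + r) (\<lambda>t. \<gamma> (t - r))"
proof (rule mqgI)
  show "qg (a + r) (b + r) (\<lambda>t. \<gamma> (t - r)) k c" by (rule qg_shift[OF mqgD(1)[OF assms]])
  fix s t k' c' a' b' \<eta> \<tau>
  assume *: "a + r \<le> s" "s \<le> t" "t \<le> b + r" "qg a' b' \<eta> k' c'" "\<eta> a' = \<gamma> (s - r)" "\<eta> b' = \<gamma> (t - r)" "\<tau> \<in> {a'..b'}"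
  from mqgD(2)[OF assms _ _ _ *(4-7)] * obtain \<sigma> where "\<sigma> \<in> {s - r..t - r}" "wdist (\<eta> \<tau>) (\<gamma> \<sigma>) \<le> M k' c'" by auto
  then show "\<exists>\<sigma>\<in>{s..t}. wdist (\<eta> \<tau>) (\<gamma> (\<sigma> - r)) \<le> M k' c'" by (intro bexI[of _ "\<sigma> + r"]) auto
qed

end

context stable_in_word_metric begin

section \<open>Diverging cosets\<close>

text \<open>
  The set is \<open>H \<inter> xHx\<^bsup>-1\<^esup>\<close>.
\<close>

definition diverging :: "'a \<Rightarrow> bool" where
  "diverging x \<longleftrightarrow> x \<in> carrier G \<and> finite {w \<in> H. \<exists>v\<in>H. w \<otimes> x = x \<otimes> v}"

lemma diverging_inv:
  assumes "diverging x"
  shows "diverging (inv x)"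
proof -
  have x: "x \<in> carrier G" using assms by (simp add: diverging_def)
  have "{w \<in> H. \<exists>v\<in>H. w \<otimes> inv x = inv x \<otimes> v} \<subseteq> (\<lambda>w. inv x \<otimes> (w \<otimes> x)) ` {w \<in> H. \<exists>v\<in>H. w \<otimes> x = x \<otimes> v}"
  proof safe
    fix w v assume *: "w \<in> H" "v \<in> H" "w \<otimes> inv x = inv x \<otimes> v"
    have c: "w \<in> carrier G" "v \<in> carrier G" using * H_carrier by auto
    have "v = x \<otimes> (w \<otimes> inv x)" using * x c by (simp add: word_simps)
    then have "v \<otimes> x = x \<otimes> w" using x c by (simp add: word_simps)
    then show "w \<in> (\<lambda>w. inv x \<otimes> (w \<otimes> x)) ` {w \<in> H. \<exists>v\<in>H. w \<otimes> x = x \<otimes> v}"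
      using * x c by (intro image_eqI[of _ _ v]) (auto simp: word_simps)
  qed
  then show ?thesis using assms x unfolding diverging_def by (meson finite_imageI finite_subset inv_closed)
qed

text \<open>
  The pairs \<open>(h, x h')\<close> with a given difference \<open>b = h\<^bsup>-1\<^esup> x h'\<close> have first components in a
  single coset of \<open>H \<inter> xHx\<^bsup>-1\<^esup>\<close>, and only finitely many \<open>b\<close> have length at most \<open>r\<close>.
\<close>

lemma diverging_bounded:
  assumes "diverging x"
  shows "\<exists>\<rho>::nat. \<forall>h\<in>H. \<forall>h'\<in>H. wdist h (x \<otimes> h') \<le> r \<longrightarrow> wlen h \<le> \<rho>"
proof -
  have x: "x \<in> carrier G" and fin: "finite {w \<in> H. \<exists>v\<in>H. w \<otimes> x = x \<otimes> v}"
    using assms by (auto simp: diverging_def)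
  define U where "U b = {h \<in> H. \<exists>h'\<in>H. inv h \<otimes> (x \<otimes> h') = b}" for b
  have U: "finite (U b)" for b
  proof (cases "U b = {}")
    case False
    then obtain h\<^sub>0 h\<^sub>0' where h0: "h\<^sub>0 \<in> H" "h\<^sub>0' \<in> H" "inv h\<^sub>0 \<otimes> (x \<otimes> h\<^sub>0') = b" by (auto simp: U_def)
    have "U b \<subseteq> (\<lambda>w. inv w \<otimes> h\<^sub>0) ` {w \<in> H. \<exists>v\<in>H. w \<otimes> x = x \<otimes> v}"
    proof
      fix h assume "h \<in> U b"
      then obtain h' where h: "h \<in> H" "h' \<in> H" "inv h \<otimes> (x \<otimes> h') = b" by (auto simp: U_def)
      have c: "h \<in> carrier G" "h' \<in> carrier G" "h\<^sub>0 \<in> carrier G" "h\<^sub>0' \<in> carrier G" using h h0 H_carrier by auto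
      have "h\<^sub>0 \<otimes> (inv h \<otimes> (x \<otimes> h')) = h\<^sub>0 \<otimes> (inv h\<^sub>0 \<otimes> (x \<otimes> h\<^sub>0'))" using h(3) h0(3) by simp
      also have "\<dots> = x \<otimes> h\<^sub>0'" using c x by (intro inv_cancel) auto
      finally have "h\<^sub>0 \<otimes> (inv h \<otimes> (x \<otimes> h')) = x \<otimes> h\<^sub>0'" .
      then have "h\<^sub>0 \<otimes> (inv h \<otimes> (x \<otimes> h')) \<otimes> inv h' = x \<otimes> h\<^sub>0' \<otimes> inv h'" by simp
      then have "h\<^sub>0 \<otimes> inv h \<otimes> x = x \<otimes> (h\<^sub>0' \<otimes> inv h')" using c x by (simp add: word_simps)
      then show "h \<in> (\<lambda>w. inv w \<otimes> h\<^sub>0) ` {w \<in> H. \<exists>v\<in>H. w \<otimes> x = x \<otimes> v}"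
        using h h0 c by (intro image_eqI[of _ _ "h\<^sub>0 \<otimes> inv h"]) (auto simp: word_simps H_closed)
    qed
    then show ?thesis using fin by (meson finite_imageI finite_subset)
  qed simp
  define V where "V = {h \<in> H. \<exists>h'\<in>H. wdist h (x \<otimes> h') \<le> r}"
  have "V \<subseteq> (\<Union>b\<in>{b \<in> carrier G. wlen b \<le> nat \<lfloor>r\<rfloor>}. U b)"
  proof
    fix h assume "h \<in> V"
    then obtain h' where h: "h \<in> H" "h' \<in> H" "wdist h (x \<otimes> h') \<le> r" by (auto simp: V_def)
    have "wlen (inv h \<otimes> (x \<otimes> h')) \<le> nat \<lfloor>r\<rfloor>" using h(3) by (simp add: wdist_def) linarith
    moreover have "inv h \<otimes> (x \<otimes> h') \<in> carrier G" using h x H_carrier by auto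
    moreover have "h \<in> U (inv h \<otimes> (x \<otimes> h'))" using h by (auto simp: U_def)
    ultimately show "h \<in> (\<Union>b\<in>{b \<in> carrier G. wlen b \<le> nat \<lfloor>r\<rfloor>}. U b)" by blast
  qed
  then have V: "finite V" using U finite_ball by (meson finite_UN finite_subset)
  have "wlen h \<le> Max (wlen ` V)" if "h \<in> H" "h' \<in> H" "wdist h (x \<otimes> h') \<le> r" for h h'
    using V that by (intro Max_ge) (auto simp: V_def)
  then show ?thesis by blast
qed

text \<open>
  The point of \<open>xH\<close> nearest to \<open>h\<close> lies on a quasi-geodesic whose ends are near \<open>H\<close>, so it is
  near \<open>H\<close>, and by divergence near \<open>\<one>\<close>. Therefore the distance from \<open>h\<close> to \<open>xH\<close> is \<open>|h|\<close> up to a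
  constant.
\<close>

lemma diverging_spread:
  assumes "diverging x"
  shows "\<exists>c\<ge>0. \<forall>h\<in>H. \<forall>h'\<in>H. real (wlen h) + real (wlen h') \<le> 3 * wdist h (x \<otimes> h') + c"
proof -
  have x: "x \<in> carrier G" using assms by (simp add: diverging_def)
  define D where "D = real (wlen x)"
  define r where "r = N 3 (2 * r\<^sub>H + 4 + 2 * D) + D + r\<^sub>H"
  have r: "0 \<le> r" using r\<^sub>H by (auto simp: r_def D_def intro!: add_nonneg_nonneg N_nonneg)
  obtain \<rho> :: nat where \<rho>: "\<And>h h'. h \<in> H \<Longrightarrow> h' \<in> H \<Longrightarrow> wdist h (x \<otimes> h') \<le> r \<Longrightarrow> wlen h \<le> \<rho>"
    using diverging_bounded[OF assms, of r] by blast
  have "real (wlen h) + real (wlen h') \<le> 3 * wdist h (x \<otimes> h') + (2 * (real \<rho> + r) + D)"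
    if h: "h \<in> H" "h' \<in> H" for h h'
  proof -
    obtain b where b: "b \<in> H" "\<And>h'. h' \<in> H \<Longrightarrow> wdist h (x \<otimes> b) \<le> wdist h (x \<otimes> h')"
      using nearest_point_exists[of "(\<lambda>h. x \<otimes> h) ` H" h] H_one by auto
    have c: "h \<in> carrier G" "h' \<in> carrier G" "b \<in> carrier G" using h b H_carrier by auto
    obtain s t \<zeta> \<tau> where \<zeta>: "qg s t \<zeta> 3 (2 * r\<^sub>H + 4)" "\<zeta> s = x \<otimes> \<one>" "\<zeta> t = h" "\<tau> \<in> {s..t}" "\<zeta> \<tau> = x \<otimes> b"
      using path_through_nearest_point[OF x c(1) H_one b] by metis
    have "wdist (\<zeta> s) (\<one> \<otimes> \<one>) \<le> D"
      using x \<zeta> wdist_commute[of x \<one>] by (simp add: wdist_one D_def)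
    moreover have "wdist (\<zeta> t) (\<one> \<otimes> h) \<le> D" using \<zeta> c by (simp add: D_def)
    ultimately obtain u where u: "u \<in> H" "wdist (x \<otimes> b) u \<le> r"
      using coset_quasiconvex[OF one_closed H_one h(1) \<zeta>(1) _ _ \<zeta>(4)] \<zeta>(5) H_carrier
      by (fastforce simp: r_def)
    have uG: "u \<in> carrier G" using u H_carrier by auto
    have "wlen u \<le> \<rho>" using \<rho>[OF u(1) b(1)] u(2) wdist_commute[of u "x \<otimes> b"] uG x c by simp
    then have "wdist \<one> (x \<otimes> b) \<le> \<rho> + r"
      using wdist_triangle[of \<one> u "x \<otimes> b"] wdist_commute[of u "x \<otimes> b"] u uG x c by (simp add: wdist_one)
    then have 1: "real (wlen h) \<le> \<rho> + r + wdist h (x \<otimes> h')"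
      using wdist_triangle[of \<one> "x \<otimes> b" h] wdist_commute[of h "x \<otimes> b"] b(2)[OF h(2)] x c by (simp add: wdist_one)
    have "wdist x (x \<otimes> h') \<le> wdist x \<one> + (wdist \<one> h + wdist h (x \<otimes> h'))"
      using wdist_triangle[of x \<one> "x \<otimes> h'"] wdist_triangle[of \<one> h "x \<otimes> h'"] x c by simp
    then have "real (wlen h') \<le> D + wlen h + wdist h (x \<otimes> h')"
      using wdist_commute[of x \<one>] x c by (simp add: wdist_one D_def wdist_mult_right)
    with 1 show ?thesis by simp
  qed
  moreover have "0 \<le> 2 * (real \<rho> + r) + D" using r by (simp add: D_def)
  ultimately show ?thesis by blast
qed

text \<open>
  The path along a geodesic from \<open>\<one>\<close> to \<open>u \<in> H\<close>, then a jump over \<open>x\<close>, then along a geodesic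
  that represents \<open>v \<in> H\<close>. The jump takes no time, so the parameter length of a word is the sum
  of the lengths of its letters from \<open>H\<close>.
\<close>

definition junction :: "'a \<Rightarrow> 'a \<Rightarrow> 'a \<Rightarrow> real \<Rightarrow> 'a" where
  "junction u x v t = (if t < real (wlen u) then geo \<one> u t else geo (u \<otimes> x) (u \<otimes> x \<otimes> v) (t - real (wlen u)))"

lemma junction_qg:
  assumes "diverging x"
  shows "\<exists>C\<ge>0. \<forall>u\<in>H. \<forall>v\<in>H. qg 0 (real (wlen u) + real (wlen v)) (junction u x v) 3 C"
proof -
  have x: "x \<in> carrier G" using assms by (simp add: diverging_def)
  obtain c where c: "0 \<le> c" "\<And>h h'. h \<in> H \<Longrightarrow> h' \<in> H \<Longrightarrow> real (wlen h) + real (wlen h') \<le> 3 * wdist h (x \<otimes> h') + c"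
    using diverging_spread[OF assms] by blast
  define C where "C = c + 8 * r\<^sub>H + 2 + real (wlen x)"
  have C: "0 \<le> C" using c r\<^sub>H by (simp add: C_def)
  have "qg 0 (real (wlen u) + real (wlen v)) (junction u x v) 3 C" if uv: "u \<in> H" "v \<in> H" for u v
  proof -
    define l where "l = real (wlen u)"
    have G: "u \<in> carrier G" "v \<in> carrier G" "u \<otimes> x \<in> carrier G" "u \<otimes> x \<otimes> v \<in> carrier G"
      using uv x H_carrier by auto
    have l: "wdist \<one> u = l" "wdist (u \<otimes> x) (u \<otimes> x \<otimes> v) = real (wlen v)"
      using G by (auto simp: l_def wdist_one wdist_mult_right)
    have Hv: "inv (u \<otimes> x) \<otimes> (u \<otimes> x \<otimes> v) \<in> H" "inv \<one> \<otimes> u \<in> H"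
      using G x uv by (auto simp: word_simps)
    let ?\<gamma> = "junction u x v" and ?\<beta> = "geo (u \<otimes> x) (u \<otimes> x \<otimes> v)"
    have "t - s \<le> 3 * (wdist (?\<gamma> s) (?\<gamma> t) + C) \<and> wdist (?\<gamma> s) (?\<gamma> t) \<le> 3 * (t - s) + C"
      if st: "0 \<le> s" "s \<le> t" "t \<le> l + real (wlen v)" for s t
    proof -
      consider "t < l" | "l \<le> s" | "s < l" "l \<le> t" by linarith
      then show ?thesis
      proof cases
        case 1
        have "t - s - 1 \<le> wdist (?\<gamma> s) (?\<gamma> t)" "wdist (?\<gamma> s) (?\<gamma> t) \<le> t - s + 1"
          using geo_dist[OF one_closed G(1), of s t] st 1 l by (auto simp: junction_def l_def)
        then show ?thesis using st c r\<^sub>H by (simp add: C_def)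
      next
        case 2
        have "t - s - 1 \<le> wdist (?\<gamma> s) (?\<gamma> t)" "wdist (?\<gamma> s) (?\<gamma> t) \<le> t - s + 1"
          using geo_dist[OF G(3,4), of "s - l" "t - l"] st 2 l by (auto simp: junction_def l_def)
        then show ?thesis using st c r\<^sub>H by (simp add: C_def)
      next
        case 3
        define \<alpha> \<beta> where "\<alpha> = geo \<one> u s" and "\<beta> = ?\<beta> (t - l)"
        have \<gamma>: "?\<gamma> s = \<alpha>" "?\<gamma> t = \<beta>" using 3 by (auto simp: junction_def \<alpha>_def \<beta>_def l_def)
        have \<alpha>\<beta>: "\<alpha> \<in> carrier G" "\<beta> \<in> carrier G" using G by (auto simp: \<alpha>_def \<beta>_def)
        have ds: "l - s - 1 \<le> wdist u \<alpha>" "wdist u \<alpha> \<le> l - s + 1"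
          using geo_dist[OF one_closed G(1), of s l] 3 st l geo_end[OF one_closed G(1)]
            wdist_commute[OF G(1) \<alpha>\<beta>(1)] by (auto simp: \<alpha>_def)
        have dt: "t - l - 1 \<le> wdist (u \<otimes> x) \<beta>" "wdist (u \<otimes> x) \<beta> \<le> t - l + 1"
          using geo_dist[OF G(3,4), of 0 "t - l"] 3 st l geo_0[OF G(3,4)] by (auto simp: \<beta>_def)
        obtain h where h: "h \<in> H" "wdist \<alpha> h \<le> r\<^sub>H"
          using geo_near_coset[OF one_closed G(1) Hv(2), of s] 3 st l H_carrier by (auto simp: \<alpha>_def)
        obtain h' where h': "h' \<in> H" "wdist \<beta> (u \<otimes> x \<otimes> h') \<le> r\<^sub>H"
          using geo_near_coset[OF G(3,4) Hv(1), of "t - l"] 3 st l by (auto simp: \<beta>_def)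
        have hG: "h \<in> carrier G" "h' \<in> carrier G" "u \<otimes> x \<otimes> h' \<in> carrier G" using h h' G H_carrier by auto
        have "real (wlen (inv u \<otimes> h)) + real (wlen h') \<le> 3 * wdist (inv u \<otimes> h) (x \<otimes> h') + c"
          using c(2)[of "inv u \<otimes> h" h'] h h' uv by (simp add: H_closed)
        moreover have "wdist (inv u \<otimes> h) (x \<otimes> h') = wdist h (u \<otimes> x \<otimes> h')"
          using wdist_left_invariant[of u "inv u \<otimes> h" "x \<otimes> h'"] G hG x by (simp add: word_simps)
        moreover have "l - s - 1 - r\<^sub>H \<le> real (wlen (inv u \<otimes> h))"
          using ds h wdist_triangle[of u h \<alpha>] wdist_commute[of h \<alpha>] G hG \<alpha>\<beta> by (simp flip: wdist_def)
        moreover have "t - l - 1 - r\<^sub>H \<le> real (wlen h')"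
          using dt h' wdist_triangle[of "u \<otimes> x" "u \<otimes> x \<otimes> h'" \<beta>] wdist_commute[of "u \<otimes> x \<otimes> h'" \<beta>] G hG \<alpha>\<beta>
          by (simp add: wdist_mult_right)
        moreover have "wdist h (u \<otimes> x \<otimes> h') \<le> wdist \<alpha> \<beta> + 2 * r\<^sub>H"
          using wdist_perturb[of \<alpha> \<beta> h "u \<otimes> x \<otimes> h'"] h h' hG \<alpha>\<beta> by linarith
        ultimately have "t - s \<le> 3 * (wdist \<alpha> \<beta> + C)" using r\<^sub>H c by (simp add: C_def)
        moreover have "wdist \<alpha> \<beta> \<le> wdist u \<alpha> + wdist u (u \<otimes> x) + wdist (u \<otimes> x) \<beta>"
          using wdist_triangle[of \<alpha> u \<beta>] wdist_triangle[of u "u \<otimes> x" \<beta>] wdist_commute[of \<alpha> u] G \<alpha>\<beta> by simp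
        then have "wdist \<alpha> \<beta> \<le> 3 * (t - s) + C"
          using ds dt st r\<^sub>H c G x by (simp add: C_def wdist_mult_right)
        ultimately show ?thesis by (simp add: \<gamma>)
      qed
    qed
    then show ?thesis
      using C G by (intro qgI) (auto simp: l_def junction_def)
  qed
  with C show ?thesis by blast
qed

definition junction_gauge :: "real \<Rightarrow> real \<Rightarrow> real \<Rightarrow> real" where
  "junction_gauge r k c = N k c + N (3 * k) (c + 3 + 2 * r) + 2 * r"

text \<open>
  A quasi-geodesic \<open>\<eta>\<close> from the first part to the second is cut at its point nearest to the
  corner \<open>u\<close>. By \<open>qg_concat\<close> each half, continued to \<open>u\<close>, is a quasi-geodesic with endpoints on
  a single part, and both parts are Morse. Divergence of the cosets is what makes the junction a
  quasi-geodesic; apart from \<open>H\<close>, its Morse gauge depends on \<open>|x|\<close> alone.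
\<close>

lemma junction_morse:
  assumes x: "x \<in> carrier G" and uv: "u \<in> H" "v \<in> H"
    and st: "0 \<le> s" "s \<le> t" "t \<le> real (wlen u) + real (wlen v)"
    and q: "qg a b \<eta> k c" "\<eta> a = junction u x v s" "\<eta> b = junction u x v t" and \<tau>: "\<tau> \<in> {a..b}"
  shows "\<exists>\<sigma>\<in>{s..t}. wdist (\<eta> \<tau>) (junction u x v \<sigma>) \<le> junction_gauge (real (wlen x)) k c"
proof -
  define l where "l = real (wlen u)"
  define r where "r = real (wlen x)"
  have G: "u \<in> carrier G" "v \<in> carrier G" "u \<otimes> x \<in> carrier G" "u \<otimes> x \<otimes> v \<in> carrier G"
    using uv x H_carrier by auto
  have l: "wdist \<one> u = l" "wdist (u \<otimes> x) (u \<otimes> x \<otimes> v) = real (wlen v)" "0 \<le> l"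
    using G by (auto simp: l_def wdist_one wdist_mult_right)
  have Hv: "inv (u \<otimes> x) \<otimes> (u \<otimes> x \<otimes> v) \<in> H" "inv \<one> \<otimes> u \<in> H"
    using G x uv by (auto simp: word_simps)
  let ?\<gamma> = "junction u x v" and ?\<beta> = "geo (u \<otimes> x) (u \<otimes> x \<otimes> v)"
  have \<gamma>: "t < l \<Longrightarrow> ?\<gamma> t = geo \<one> u t" "l \<le> t \<Longrightarrow> ?\<gamma> t = ?\<beta> (t - l)" for t
    by (auto simp: junction_def l_def)
  note q' = qgD(1,2)[OF q(1)]
  have r: "0 \<le> r" by (simp add: r_def)
  have N: "0 \<le> N k c" "0 \<le> N (3 * k) (c + 3 + 2 * r)" using q' r by (auto intro!: N_nonneg)
  consider "t < l" | "l \<le> s" | "s < l" "l \<le> t" by linarith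
  then have "\<exists>\<sigma>\<in>{s..t}. wdist (\<eta> \<tau>) (?\<gamma> \<sigma>) \<le> junction_gauge r k c"
  proof cases
    case 1
    then obtain \<sigma> where "\<sigma> \<in> {s..t}" "wdist (\<eta> \<tau>) (geo \<one> u \<sigma>) \<le> N k c"
      using geo_morse[OF one_closed G(1) Hv(2) st(1,2) _ q(1) _ _ \<tau>] q l \<gamma> st by auto
    then show ?thesis using 1 \<gamma> N r by (intro bexI[of _ \<sigma>]) (auto simp: junction_gauge_def)
  next
    case 2
    then obtain \<sigma> where "\<sigma> \<in> {s - l..t - l}" "wdist (\<eta> \<tau>) (?\<beta> \<sigma>) \<le> N k c"
      using geo_morse[OF G(3,4) Hv(1) _ _ _ q(1) _ _ \<tau>, of "s - l" "t - l"] q l \<gamma> st by (auto simp: l_def)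
    then show ?thesis using 2 \<gamma>(2)[of "\<sigma> + l"] N r by (intro bexI[of _ "\<sigma> + l"]) (auto simp: junction_gauge_def)
  next
    case 3
    have ux: "wdist u (u \<otimes> x) = r" using G x by (simp add: r_def wdist_mult_right)
    obtain \<tau>\<^sub>0 where \<tau>0: "\<tau>\<^sub>0 \<in> {a..b}" "\<And>t. t \<in> {a..b} \<Longrightarrow> wdist u (\<eta> \<tau>\<^sub>0) \<le> wdist u (\<eta> t) + 0"
      using nearest_point_exists[of "\<eta> ` {a..b}" u] \<tau> by auto
    have \<eta>G: "\<eta> \<tau> \<in> carrier G" using qgD(4)[OF q(1) \<tau>] .
    show ?thesis
    proof (cases "\<tau> \<le> \<tau>\<^sub>0")
      case True
      from qg_concat[OF q(1) \<tau>0(1) G(1) order.refl \<tau>0(2)] \<tau>0(1) obtain b' \<zeta> where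
        \<zeta>: "\<tau>\<^sub>0 \<le> b'" "qg a b' \<zeta> (3 * k) (c + 3)" "\<And>t. t \<in> {a..\<tau>\<^sub>0} \<Longrightarrow> \<zeta> t = \<eta> t" "\<zeta> b' = u" by auto
      have "\<zeta> a = geo \<one> u s" "\<zeta> b' = geo \<one> u l" "\<zeta> \<tau> = \<eta> \<tau>" "\<tau> \<in> {a..b'}"
        using \<zeta> \<tau> \<tau>0 True q(2) \<gamma> 3 geo_end[OF one_closed G(1)] l by auto
      then obtain \<sigma> where \<sigma>: "\<sigma> \<in> {s..l}" "wdist (\<eta> \<tau>) (geo \<one> u \<sigma>) \<le> N (3 * k) (c + 3 + 2 * r) + r"
        using geo_morse_near[OF one_closed G(1) Hv(2) st(1) _ _ \<zeta>(2), of l r \<tau>] 3 l r G by auto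
      have "wdist (\<eta> \<tau>) (?\<gamma> \<sigma>) \<le> N (3 * k) (c + 3 + 2 * r) + 2 * r"
      proof (cases "\<sigma> < l")
        case True
        then show ?thesis using \<sigma> \<gamma> r by simp
      next
        case False
        then have "\<sigma> = l" using \<sigma> by simp
        then have "geo \<one> u \<sigma> = u" "?\<gamma> \<sigma> = u \<otimes> x"
          using geo_end[OF one_closed G(1)] l \<gamma>(2)[of l] geo_0[OF G(3,4)] by auto
        then show ?thesis using \<sigma>(2) wdist_triangle[of "\<eta> \<tau>" u "u \<otimes> x"] ux G \<eta>G by simp
      qed
      then show ?thesis using \<sigma>(1) 3 N by (intro bexI[of _ \<sigma>]) (auto simp: junction_gauge_def)
    next
      case False
      have "wdist u (\<eta> \<tau>\<^sub>0) \<le> wdist u (\<eta> t) + 0" if "t \<in> {\<tau>\<^sub>0..b}" for t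
        using \<tau>0 that by auto
      from qg_concat_left[OF q(1) \<tau>0(1) G(1) order.refl this] obtain a' \<zeta> where
        \<zeta>: "a' \<le> \<tau>\<^sub>0" "qg a' b \<zeta> (3 * k) (c + 3)" "\<And>t. t \<in> {\<tau>\<^sub>0..b} \<Longrightarrow> \<zeta> t = \<eta> t" "\<zeta> a' = u" by auto
      have "wdist (\<zeta> a') (?\<beta> 0) \<le> r" "\<zeta> b = ?\<beta> (t - l)" "\<zeta> \<tau> = \<eta> \<tau>" "\<tau> \<in> {a'..b}"
        using \<zeta> \<tau> \<tau>0 False q(3) \<gamma> 3 geo_0[OF G(3,4)] ux by auto
      then obtain \<sigma> where \<sigma>: "\<sigma> \<in> {0..t - l}" "wdist (\<eta> \<tau>) (?\<beta> \<sigma>) \<le> N (3 * k) (c + 3 + 2 * r) + r"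
        using geo_morse_near[OF G(3,4) Hv(1) order.refl _ _ \<zeta>(2), of "t - l" r \<tau>] 3 l r G st by (auto simp: l_def)
      then show ?thesis
        using 3 \<gamma>(2)[of "\<sigma> + l"] N r by (intro bexI[of _ "\<sigma> + l"]) (auto simp: junction_gauge_def)
    qed
  qed
  then show ?thesis by (simp add: r_def)
qed

lemma junction_uniformly_morse:
  assumes "diverging g"
  shows "\<exists>M C. morse_gauge M \<and> C \<ge> 0 \<and> (\<forall>u\<in>H. \<forall>v\<in>H. \<forall>x\<in>{g, inv g}.
    mqg M 3 C 0 (real (wlen u) + real (wlen v)) (junction u x v))"
proof -
  have g: "g \<in> carrier G" using assms by (simp add: diverging_def)
  obtain C C' where C: "0 \<le> C" "0 \<le> C'"
    "\<And>u v. u \<in> H \<Longrightarrow> v \<in> H \<Longrightarrow> qg 0 (real (wlen u) + real (wlen v)) (junction u g v) 3 C"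
    "\<And>u v. u \<in> H \<Longrightarrow> v \<in> H \<Longrightarrow> qg 0 (real (wlen u) + real (wlen v)) (junction u (inv g) v) 3 C'"
    using junction_qg[OF assms] junction_qg[OF diverging_inv[OF assms]] by blast
  have "mqg (junction_gauge (real (wlen g))) 3 (max C C') 0 (real (wlen u) + real (wlen v)) (junction u x v)"
    if "u \<in> H" "v \<in> H" "x \<in> {g, inv g}" for u v x
  proof (rule mqgI)
    show "qg 0 (real (wlen u) + real (wlen v)) (junction u x v) 3 (max C C')"
      using that C qg_mono[of 0 _ _ 3 C 3 "max C C'"] qg_mono[of 0 _ _ 3 C' 3 "max C C'"] by auto
    have "x \<in> carrier G" "wlen x = wlen g" using that g wlen_inv by auto
    then show "\<exists>\<sigma>\<in>{s..t}. wdist (\<eta> \<tau>) (junction u x v \<sigma>) \<le> junction_gauge (real (wlen g)) k' c'"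
      if "0 \<le> s" "s \<le> t" "t \<le> real (wlen u) + real (wlen v)" "qg a' b' \<eta> k' c'"
        "\<eta> a' = junction u x v s" "\<eta> b' = junction u x v t" "\<tau> \<in> {a'..b'}" for s t k' c' a' b' \<eta> \<tau>
      using junction_morse[OF _ \<open>u \<in> H\<close> \<open>v \<in> H\<close> that] by simp
  qed
  moreover have "morse_gauge (junction_gauge (real (wlen g)))"
    by (auto simp: morse_gauge_def junction_gauge_def intro!: add_nonneg_nonneg N_nonneg)
  ultimately show ?thesis using C(1) by (intro exI[of _ "junction_gauge (real (wlen g))"] exI[of _ "max C C'"]) auto
qed

end

context group begin

text \<open>
  Defined without a word metric, since the two generating sets of the final argument share it.
\<close>

fun alt_prod :: "'a \<Rightarrow> 'a list \<Rightarrow> 'a" where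
  "alt_prod g [] = \<one>"
| "alt_prod g (h # hs) = h \<otimes> g \<otimes> alt_prod g hs"

lemma alt_prod_carrier: "g \<in> carrier G \<Longrightarrow> set hs \<subseteq> carrier G \<Longrightarrow> alt_prod g hs \<in> carrier G"
  by (induction hs) auto

end

context stable_in_word_metric begin

section \<open>Alternating words\<close>

text \<open>
  A list of pairs \<open>(h\<^sub>i, x\<^sub>i)\<close> stands for the product \<open>h\<^sub>1 x\<^sub>1 h\<^sub>2 x\<^sub>2 \<dots>\<close>; its path takes time
  \<open>|h\<^sub>i|\<close> for \<open>h\<^sub>i\<close> and jumps over \<open>x\<^sub>i\<close>.
\<close>

fun word_prod :: "('a \<times> 'a) list \<Rightarrow> 'a" where
  "word_prod [] = \<one>"
| "word_prod ((h, x) # ws) = h \<otimes> x \<otimes> word_prod ws"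

fun word_length :: "('a \<times> 'a) list \<Rightarrow> real" where
  "word_length [] = 0"
| "word_length ((h, x) # ws) = real (wlen h) + word_length ws"

fun word_path :: "('a \<times> 'a) list \<Rightarrow> real \<Rightarrow> 'a" where
  "word_path [] t = \<one>"
| "word_path ((h, x) # ws) t =
    (if t < real (wlen h) then geo \<one> h t else h \<otimes> x \<otimes> word_path ws (t - real (wlen h)))"

definition long_letters :: "'a set \<Rightarrow> real \<Rightarrow> ('a \<times> 'a) set" where
  "long_letters X B = {(h, x). h \<in> H \<and> x \<in> X \<and> B < real (wlen h)}"

lemma word_length_nonneg: "0 \<le> word_length ws"
  by (induction ws rule: word_length.induct) auto

lemma word_path_end: "word_path ws (word_length ws) = word_prod ws"
  using word_length_nonneg by (induction ws rule: word_length.induct) (auto simp: not_less[symmetric])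

lemma word_carrier:
  assumes "X \<subseteq> carrier G" "set ws \<subseteq> long_letters X B"
  shows "word_prod ws \<in> carrier G" "word_path ws t \<in> carrier G"
proof -
  show "word_prod ws \<in> carrier G"
    using assms by (induction ws rule: word_prod.induct) (auto simp: long_letters_def H_carrier)
  show "word_path ws t \<in> carrier G"
    using assms by (induction ws t rule: word_path.induct) (auto simp: long_letters_def H_carrier)
qed

text \<open>
  All letters from \<open>H\<close> are longer than \<open>B\<close>, so a parameter interval of length at most \<open>B\<close> meets
  at most two consecutive ones, and there the path is a translate of a junction.
\<close>

lemma word_path_local:
  assumes X: "X \<subseteq> carrier G" "X \<noteq> {}" and B: "0 \<le> B"
    and J: "\<And>u v x. u \<in> H \<Longrightarrow> v \<in> H \<Longrightarrow> x \<in> X \<Longrightarrow> mqg M k c 0 (real (wlen u) + real (wlen v)) (junction u x v)"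
    and ws: "set ws \<subseteq> long_letters X B"
    and st: "0 \<le> s" "s \<le> t" "t \<le> word_length ws" "t - s \<le> B"
  shows "mqg M k c s t (word_path ws)"
  using ws st
proof (induction ws arbitrary: s t)
  case Nil
  obtain x where x: "x \<in> X" using X by blast
  then have xG: "x \<in> carrier G" using X by auto
  have "mqg M k c 0 0 (\<lambda>t. inv x \<otimes> junction \<one> x \<one> t)"
    using mqg_translate[OF J[OF H_one H_one x] inv_closed[OF xG]] by simp
  then have "mqg M k c 0 0 (word_path [])"
    by (rule mqg_cong) (use xG in \<open>auto simp: junction_def geo_0\<close>)
  moreover have "s = 0" "t = 0" using Nil by auto
  ultimately show ?case by (simp only:)
next
  case (Cons a ws)
  obtain h x where a: "a = (h, x)" by (cases a)
  have h: "h \<in> H" "x \<in> X" "B < real (wlen h)" and ws: "set ws \<subseteq> long_letters X B"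
    using Cons.prems(1) by (auto simp: a long_letters_def)
  have G: "h \<in> carrier G" "x \<in> carrier G" "h \<otimes> x \<in> carrier G" using h X H_carrier by auto
  define l where "l = real (wlen h)"
  show ?case
  proof (cases "l \<le> s")
    case True
    have "mqg M k c (s - l) (t - l) (word_path ws)"
      using Cons.prems True by (intro Cons.IH[OF ws]) (auto simp: a l_def)
    from mqg_shift[OF mqg_translate[OF this G(3)], of l]
    have "mqg M k c s t (\<lambda>r. h \<otimes> x \<otimes> word_path ws (r - l))" by simp
    then show ?thesis by (rule mqg_cong) (use True in \<open>auto simp: a l_def\<close>)
  next
    case False
    \<comment> \<open>After the last letter, the junction with \<open>v = \<one>\<close> accounts for the final jump.\<close>
    define v where "v = (case ws of [] \<Rightarrow> \<one> | b # _ \<Rightarrow> fst b)"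
    have v: "v \<in> H" using ws by (auto simp: v_def H_one long_letters_def split: list.splits)
    have vG: "v \<in> carrier G" using v H_carrier by auto
    have tv: "t \<le> l + real (wlen v)"
      using Cons.prems False ws by (cases ws) (auto simp: v_def a l_def long_letters_def)
    have "mqg M k c s t (junction h x v)"
      using mqg_subinterval[OF J[OF h(1) v h(2)]] Cons.prems tv by (simp add: l_def)
    moreover have "junction h x v r = word_path (a # ws) r" if r: "r \<in> {s..t}" for r
    proof (cases "r < l")
      case True
      then show ?thesis by (simp add: a junction_def l_def)
    next
      case rl: False
      have "geo (h \<otimes> x) (h \<otimes> x \<otimes> v) (r - l) = h \<otimes> x \<otimes> geo \<one> v (r - l)"
        using geo_mult[OF G(3) one_closed vG, of "r - l"] G vG by simp
      moreover have "geo \<one> v (r - l) = word_path ws (r - l)"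
      proof (cases ws)
        case Nil
        then have "r = l" using Cons.prems r rl by (auto simp: a l_def)
        then show ?thesis using Nil by (simp add: v_def geo_0)
      next
        case (Cons b ws')
        then have "B < real (wlen (fst b))" using ws by (auto simp: long_letters_def)
        then have "r - l < real (wlen (fst b))" using Cons.prems(4,5) r False \<open>t - s \<le> B\<close> by auto
        then show ?thesis using Cons by (cases b) (auto simp: v_def)
      qed
      ultimately show ?thesis using rl by (simp add: a junction_def l_def)
    qed
    ultimately show ?thesis by (rule mqg_cong)
  qed
qed

text \<open>
  The path of a word is a local Morse quasi-geodesic, hence a quasi-geodesic whose parameter
  length is at least the length of its first letter from \<open>H\<close>; a large bound on the letters
  therefore separates its endpoints by any desired amount.
\<close>

lemma alternating_word_long:
  assumes ltg: "morse_local_to_global_space (carrier G) wdist" and g: "diverging g"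
  shows "\<exists>B\<ge>0. \<forall>ws. ws \<noteq> [] \<longrightarrow> set ws \<subseteq> long_letters {g, inv g} B \<longrightarrow> 2 * wlen g < wlen (word_prod ws)"
proof -
  let ?X = "{g, inv g}"
  have X: "?X \<subseteq> carrier G" "?X \<noteq> {}" using g by (auto simp: diverging_def)
  obtain M c where M: "morse_gauge M" "c \<ge> 0"
    "\<And>u v x. u \<in> H \<Longrightarrow> v \<in> H \<Longrightarrow> x \<in> ?X \<Longrightarrow> mqg M 3 c 0 (real (wlen u) + real (wlen v)) (junction u x v)"
    using junction_uniformly_morse[OF g] by metis
  obtain B M' k' c' where B: "B \<ge> 0" "k' \<ge> 1" "c' \<ge> 0"
    "\<And>I \<gamma>. local_morse_quasi_geodesic (carrier G) wdist B M 3 c I \<gamma> \<Longrightarrow>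
       morse_quasi_geodesic (carrier G) wdist M' k' c' I \<gamma>"
    using ltg M(1,2) unfolding morse_local_to_global_space_def
    by (metis one_le_numeral)
  \<comment> \<open>The second bound makes the lower estimate for the global constants exceed twice the length of \<open>g\<close>.\<close>
  define B' where "B' = max B (k' * (c' + 2 * real (wlen g)))"
  have "2 * wlen g < wlen (word_prod ws)" if ws: "ws \<noteq> []" "set ws \<subseteq> long_letters ?X B'" for ws
  proof -
    define L where "L = word_length ws"
    have ws': "set ws \<subseteq> long_letters ?X B" using ws(2) by (auto simp: long_letters_def B'_def)
    obtain h x ws1 where w: "ws = (h, x) # ws1" using ws(1) by (cases ws) auto
    have h: "h \<in> carrier G" "B' < real (wlen h)" using ws(2) by (auto simp: w long_letters_def H_carrier)
    have L: "B' < L" using h(2) word_length_nonneg[of ws1] by (simp add: L_def w)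
    have L0: "0 \<le> L" by (simp add: L_def word_length_nonneg)
    have "local_morse_quasi_geodesic (carrier G) wdist B M 3 c {0..L} (word_path ws)"
      unfolding local_morse_quasi_geodesic_def
      using word_path_local[OF X B(1) M(3) ws'] word_carrier(2)[OF X(1) ws'] L0 by (auto simp: L_def)
    from B(4)[OF this] have "qg 0 L (word_path ws) k' c'" by (rule mqgD(1))
    from qgD(5)[OF this order.refl L0 order.refl]
    have "L \<le> k' * (wdist (word_path ws 0) (word_path ws L) + c')" by simp
    moreover have "word_path ws 0 = \<one>"
      using h B(1) by (auto simp: w geo_0 B'_def)
    ultimately have "L \<le> k' * (real (wlen (word_prod ws)) + c')"
      using word_path_end[of ws] word_carrier(1)[OF X(1) ws'] by (simp add: L_def wdist_one)
    with L have "k' * (c' + 2 * real (wlen g)) < k' * (real (wlen (word_prod ws)) + c')"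
      by (simp add: B'_def)
    then have "c' + 2 * real (wlen g) < real (wlen (word_prod ws)) + c'"
      using B(2) by simp
    then show ?thesis by simp
  qed
  moreover have "0 \<le> B'" using B(1) by (simp add: B'_def)
  ultimately show ?thesis by blast
qed

lemma alt_prod_word_prod: "alt_prod g hs = word_prod (map (\<lambda>h. (h, g)) hs)"
  by (induction hs) auto

text \<open>
  Moving a letter \<open>h\<close> of the inverted product to the right prepends the pair \<open>(h\<^bsup>-1\<^esup>, g\<^bsup>-1\<^esup>)\<close> to
  the alternating word, and the leading \<open>g\<^bsup>-1\<^esup>\<close> reappears.
\<close>

lemma alt_prod_inv_prefix:
  assumes g: "g \<in> carrier G"
    and K: "\<And>h. h \<in> K \<Longrightarrow> inv h \<in> K \<and> (h, inv g) \<in> long_letters {g, inv g} B"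
    and hs: "set hs \<subseteq> K" and ws: "ws \<noteq> []" "set ws \<subseteq> long_letters {g, inv g} B"
  shows "\<exists>ws'. ws' \<noteq> [] \<and> set ws' \<subseteq> long_letters {g, inv g} B \<and>
    inv (alt_prod g hs) \<otimes> inv g \<otimes> word_prod ws = inv g \<otimes> word_prod ws'"
  using hs ws
proof (induction hs arbitrary: ws)
  case Nil
  have "{g, inv g} \<subseteq> carrier G" using g by auto
  from word_carrier(1)[OF this Nil(3)] have "word_prod ws \<in> carrier G" .
  then show ?case using Nil g by (intro exI[of _ ws]) auto
next
  case (Cons h hs)
  have X: "{g, inv g} \<subseteq> carrier G" using g by auto
  have w: "word_prod ws \<in> carrier G" using word_carrier(1)[OF X Cons.prems(3)] .
  have KH: "k \<in> H" if "k \<in> K" for k using K[OF that] by (auto simp: long_letters_def)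
  have h: "h \<in> K" "set hs \<subseteq> K" "h \<in> carrier G" using Cons.prems KH H_carrier by auto
  have a: "alt_prod g hs \<in> carrier G" using h KH H_carrier g by (intro alt_prod_carrier) auto
  let ?ws = "(inv h, inv g) # ws"
  have "(inv h, inv g) \<in> long_letters {g, inv g} B" using K[of "inv h"] K[OF h(1)] by auto
  then have "set ?ws \<subseteq> long_letters {g, inv g} B" using Cons.prems by auto
  from Cons.IH[OF h(2) _ this] obtain ws' where ws': "ws' \<noteq> []" "set ws' \<subseteq> long_letters {g, inv g} B"
    "inv (alt_prod g hs) \<otimes> inv g \<otimes> word_prod ?ws = inv g \<otimes> word_prod ws'" by auto
  have "inv (alt_prod g (h # hs)) \<otimes> inv g \<otimes> word_prod ws = inv (alt_prod g hs) \<otimes> inv g \<otimes> word_prod ?ws"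
    using h a w g by (simp add: word_simps)
  with ws' show ?case by auto
qed

text \<open>
  After cancelling a common prefix, equal products of different lists give an alternating word
  whose value \<open>\<one>\<close> or \<open>g\<close> is too short: if both lists go on, with first letters \<open>h \<noteq> h'\<close>, the
  letter in the middle is \<open>h'\<^bsup>-1\<^esup> h\<close>, a nontrivial element of \<open>K\<close>. This is where \<open>K\<close> must be a
  subgroup and where its nontrivial elements must avoid a finite set.
\<close>

theorem alt_prod_injective:
  assumes ltg: "morse_local_to_global_space (carrier G) wdist" and inf: "infinite (rcosets H)"
  shows "\<exists>g\<in>carrier G. \<exists>S. finite S \<and> (\<forall>K. subgroup K G \<longrightarrow> K \<subseteq> H \<longrightarrow> K \<inter> S \<subseteq> {\<one>} \<longrightarrow>
    inj_on (alt_prod g) (lists (K - {\<one>})))"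
proof -
  obtain g where g: "g \<in> carrier G" "diverging g"
    using exists_finite_conjugate_intersection[OF inf] by (auto simp: diverging_def)
  obtain B where B: "B \<ge> 0"
    "\<And>ws. ws \<noteq> [] \<Longrightarrow> set ws \<subseteq> long_letters {g, inv g} B \<Longrightarrow> 2 * wlen g < wlen (word_prod ws)"
    using alternating_word_long[OF ltg g(2)] by blast
  define S where "S = {x \<in> carrier G. wlen x \<le> nat \<lfloor>B\<rfloor>}"
  have "inj_on (alt_prod g) (lists (K - {\<one>}))"
    if K: "subgroup K G" "K \<subseteq> H" "K \<inter> S \<subseteq> {\<one>}" for K
  proof -
    have KG: "h \<in> carrier G" if "h \<in> K" for h using that K H_carrier by auto
    have K_inv: "inv h \<in> K" if "h \<in> K" for h using that K(1) by (rule subgroup.m_inv_closed[rotated])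
    have long: "(h, x) \<in> long_letters {g, inv g} B" if "h \<in> K - {\<one>}" "x \<in> {g, inv g}" for h x
    proof -
      have "h \<notin> S" using that K(3) by auto
      then have "nat \<lfloor>B\<rfloor> < wlen h" using that KG by (auto simp: S_def)
      then have "B < real (wlen h)" by linarith
      then show ?thesis using that K(2) by (auto simp: long_letters_def)
    qed
    have inv_ne: "inv h \<noteq> \<one>" if "h \<in> K - {\<one>}" for h
      using that KG by (metis Diff_iff inv_inv inv_one singletonI)
    have letters: "set (map (\<lambda>h. (h, g)) hs) \<subseteq> long_letters {g, inv g} B" if "set hs \<subseteq> K - {\<one>}" for hs
      using that long by auto
    have "hs = hs'" if "set hs \<subseteq> K - {\<one>}" "set hs' \<subseteq> K - {\<one>}" "alt_prod g hs = alt_prod g hs'" for hs hs'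
      using that
    proof (induction hs arbitrary: hs')
      case Nil
      then have "wlen (alt_prod g hs') = 0" by (simp flip: Nil(3))
      then show ?case using B(2)[OF _ letters[OF Nil(2)]] by (auto simp: alt_prod_word_prod)
    next
      case (Cons h hs)
      show ?case
      proof (cases hs')
        case Nil
        then show ?thesis using Cons.prems B(2)[OF _ letters[of "h # hs"]] by (simp add: alt_prod_word_prod)
      next
        case (Cons h' ks)
        have c: "h \<in> carrier G" "h' \<in> carrier G" "alt_prod g hs \<in> carrier G" "alt_prod g ks \<in> carrier G"
          using Cons.prems Cons KG K(2) by (auto intro!: alt_prod_carrier[OF g(1)])
        have eq: "h \<otimes> g \<otimes> alt_prod g hs = h' \<otimes> g \<otimes> alt_prod g ks" using Cons.prems Cons by simp
        show ?thesis
        proof (cases "h = h'")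
          case True
          then have "alt_prod g hs = alt_prod g ks" using eq c g by simp
          then show ?thesis using Cons.IH[of ks] Cons.prems Cons True by simp
        next
          case False
          let ?w = "(inv h' \<otimes> h, g) # map (\<lambda>h. (h, g)) hs"
          have "inv h' \<otimes> h \<in> K"
            using Cons.prems Cons K_inv subgroup.m_closed[OF K(1)] by auto
          moreover have "inv h' \<otimes> h \<noteq> \<one>" using False c by (metis inv_equality inv_inv inv_closed)
          ultimately have w: "set ?w \<subseteq> long_letters {g, inv g} B" using long letters[of hs] Cons.prems by auto
          have ks: "set ks \<subseteq> K - {\<one>}" using Cons.prems Cons by auto
          obtain ws' where ws': "ws' \<noteq> []" "set ws' \<subseteq> long_letters {g, inv g} B"
            "inv (alt_prod g ks) \<otimes> inv g \<otimes> word_prod ?w = inv g \<otimes> word_prod ws'"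
            using alt_prod_inv_prefix[OF g(1) _ ks _ w] long inv_ne K_inv by fastforce
          have "word_prod ?w = inv h' \<otimes> (h \<otimes> g \<otimes> alt_prod g hs)"
            using c g by (simp add: alt_prod_word_prod m_assoc)
          also have "\<dots> = g \<otimes> alt_prod g ks" unfolding eq using c g by (simp add: word_simps)
          finally have "inv (alt_prod g ks) \<otimes> inv g \<otimes> word_prod ?w = \<one>" using c g by (simp add: word_simps)
          then have "inv g \<otimes> word_prod ws' = \<one>" using ws'(3) by simp
          moreover have "word_prod ws' \<in> carrier G" using word_carrier(1)[OF _ ws'(2)] g by auto
          ultimately have "word_prod ws' = g" using g by (metis inv_cancel(2) inv_closed r_one)
          then show ?thesis using B(2)[OF ws'(1,2)] by simp
        qed
      qed
    qed
    then show ?thesis by (auto intro!: inj_onI)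
  qed
  moreover have "finite S" unfolding S_def by (rule finite_ball)
  ultimately show ?thesis using g(1) by blast
qed

end

section \<open>Growth\<close>

text \<open>
  The upper bound of Fekete's lemma, for a function bounded by a submultiplicative one: write
  \<open>m = q n + r\<close> with \<open>r < n\<close>.
\<close>

lemma limsup_root_le:
  fixes f F :: "nat \<Rightarrow> nat"
  assumes submult: "\<And>m n. F (m + n) \<le> F m * F n" and fF: "\<And>n. f n \<le> F n" and pos: "\<And>n. 1 \<le> F n"
    and n: "1 \<le> n"
  shows "limsup (\<lambda>m. ereal (root m (real (f m)))) \<le> ereal (root n (real (F n)))"
proof -
  define a where "a = root n (real (F n))"
  have a1: "1 \<le> a" using pos[of n] n by (simp add: a_def)
  have an: "a ^ n = real (F n)" using n by (simp add: a_def)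
  define C where "C = Max (F ` {..<n})"
  have C: "F r \<le> C" if "r < n" for r using that by (auto simp: C_def)
  have C1: "1 \<le> C" using C[of 0] pos[of 0] n by simp
  have Fq: "real (F (q * n + r)) \<le> a ^ (q * n) * real (F r)" for q r
  proof (induction q)
    case (Suc q)
    have "real (F (Suc q * n + r)) \<le> real (F n * F (q * n + r))"
      using submult[of n "q * n + r"] by (simp add: add.assoc del: of_nat_mult)
    also have "\<dots> \<le> a ^ n * (a ^ (q * n) * real (F r))"
      using Suc an by (simp add: mult_left_mono)
    finally show ?case by (simp add: power_add)
  qed simp
  have le: "root m (real (f m)) \<le> root m (real C) * a" if "1 \<le> m" for m
  proof -
    have "real (f m) \<le> real (F m)" using fF by simp
    also have "\<dots> \<le> a ^ (m div n * n) * real (F (m mod n))"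
      using Fq[of "m div n" "m mod n"] by simp
    also have "\<dots> \<le> a ^ m * real C"
      using a1 n C[of "m mod n"] by (intro mult_mono power_increasing) auto
    finally have "root m (real (f m)) \<le> root m (a ^ m * real C)" using that by simp
    also have "\<dots> = root m (real C) * a" using that a1 by (simp add: real_root_mult real_root_power_cancel)
    finally show ?thesis .
  qed
  have "(\<lambda>m. root m (real C) * a) \<longlonglongrightarrow> 1 * a"
    using C1 by (intro tendsto_mult LIMSEQ_root_const tendsto_const) auto
  then have "limsup (\<lambda>m. ereal (root m (real C) * a)) = ereal a"
    by (intro lim_imp_Limsup) auto
  moreover have "limsup (\<lambda>m. ereal (root m (real (f m)))) \<le> limsup (\<lambda>m. ereal (root m (real C) * a))"
    using le by (intro Limsup_mono) (auto simp: eventually_sequentially intro!: exI[of _ 1])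
  ultimately show ?thesis by (simp add: a_def)
qed

lemma le_limsup_infinitely_often:
  fixes u :: "nat \<Rightarrow> ereal"
  assumes "\<And>n. \<exists>m\<ge>n. c \<le> u m"
  shows "c \<le> limsup u"
  unfolding limsup_INF_SUP
proof (rule INF_greatest)
  fix n
  obtain m where "m \<ge> n" "c \<le> u m" using assms by blast
  then show "c \<le> (SUP m\<in>{n..}. u m)" by (intro SUP_upper2[of m]) auto
qed

context word_metric begin

lemma word_norm_wlen: "x \<in> carrier G \<Longrightarrow> word_norm G A x = real (wlen x)"
  by (simp add: word_norm_def cayley_dist_vertex wdist_one)

lemma growth_fun_wlen:
  assumes "S \<subseteq> carrier G"
  shows "growth_fun G A S n = card {x \<in> S. wlen x \<le> n}"
proof -
  have "{x \<in> S. word_norm G A x \<le> real n} = {x \<in> S. wlen x \<le> n}"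
    using assms by (auto simp: word_norm_wlen)
  then show ?thesis by (simp add: growth_fun_def)
qed

lemma finite_ball_in: "S \<subseteq> carrier G \<Longrightarrow> finite {x \<in> S. wlen x \<le> n}"
  by (rule finite_subset[OF _ finite_ball[of n]]) auto

lemma growth_fun_pos:
  assumes "S \<subseteq> carrier G" "\<one> \<in> S"
  shows "1 \<le> growth_fun G A S n"
proof -
  have "{\<one>} \<subseteq> {x \<in> S. wlen x \<le> n}" using assms by auto
  from card_mono[OF finite_ball_in[OF assms(1)] this] show ?thesis by (simp add: growth_fun_wlen assms)
qed

text \<open>
  A geodesic to \<open>h \<in> H\<close> passes at time \<open>m\<close> near some \<open>u \<in> H\<close>, and \<open>h = u (u\<^bsup>-1\<^esup> h)\<close>. Shifting
  the argument of the growth function by \<open>2 K\<close> absorbs the error.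
\<close>

lemma growth_fun_submult:
  assumes H: "subgroup H G" and stable: "stable_in_cayley G A H M k" and k: "0 \<le> k"
  shows "\<exists>K::nat. \<forall>m n. growth_fun G A H (m + n + 2 * K) \<le> growth_fun G A H (m + 2 * K) * growth_fun G A H (n + 2 * K)"
proof -
  note HG = subgroup.subset[OF H]
  define K where "K = nat \<lceil>k\<rceil> + 1"
  have K: "k + 1 \<le> real K" unfolding K_def by linarith
  have *: "growth_fun G A H (m + n) \<le> growth_fun G A H (m + K) * growth_fun G A H (n + K)" for m n
  proof -
    let ?B = "\<lambda>n. {h \<in> H. wlen h \<le> n}"
    have "?B (m + n) \<subseteq> (\<lambda>(a, b). a \<otimes> b) ` (?B (m + K) \<times> ?B (n + K))"
    proof
      fix h assume h: "h \<in> ?B (m + n)"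
      then have hG: "h \<in> carrier G" using HG by auto
      have "\<exists>u\<in>H. wlen u \<le> m + K \<and> wlen (inv u \<otimes> h) \<le> n + K"
      proof (cases "wlen h \<le> m")
        case True
        then show ?thesis using h hG by (intro bexI[of _ h]) auto
      next
        case False
        define z where "z = geo \<one> h (real m)"
        have d: "wdist \<one> h = real (wlen h)" using hG by (simp add: wdist_one)
        have zG: "z \<in> carrier G" using hG by (simp add: z_def)
        have "z \<in> neighbourhood (carrier G) wdist k H"
          using stable_geo(2)[OF stable HG, of h] h False by (auto simp: z_def)
        then obtain u where u: "u \<in> H" "wdist z u \<le> k" by (auto simp: neighbourhood_def)
        have uG: "u \<in> carrier G" using u HG by auto
        have "wdist \<one> z \<le> m + 1" "wdist z h \<le> wlen h - real m + 1"
          using geo_dist(2)[OF one_closed hG, of 0 "real m"] geo_dist(2)[OF one_closed hG, of "real m" "wlen h"]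
            False d hG geo_0[OF one_closed hG] geo_end[OF one_closed hG] by (auto simp: z_def)
        then have "wdist \<one> u \<le> m + 1 + k" "wdist u h \<le> wlen h - real m + 1 + k"
          using wdist_triangle[of \<one> z u] wdist_triangle[of u z h] wdist_commute[of u z] u uG zG hG by auto
        then have "real (wlen u) \<le> real (m + K)" "real (wlen (inv u \<otimes> h)) \<le> real (n + K)"
          using K h uG by (auto simp: wdist_one simp flip: wdist_def)
        then show ?thesis using u(1) by (intro bexI[of _ u] conjI) (simp_all only: of_nat_le_iff)
      qed
      then obtain u where u: "u \<in> H" "wlen u \<le> m + K" "wlen (inv u \<otimes> h) \<le> n + K" by blast
      then have "inv u \<otimes> h \<in> H" using H h by (auto simp: subgroup.m_closed subgroup.m_inv_closed)
      then show "h \<in> (\<lambda>(a, b). a \<otimes> b) ` (?B (m + K) \<times> ?B (n + K))"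
        using u hG HG by (intro image_eqI[of _ _ "(u, inv u \<otimes> h)"]) (auto simp: word_simps)
    qed
    then have "card (?B (m + n)) \<le> card (?B (m + K) \<times> ?B (n + K))"
      using finite_ball_in[OF HG] by (intro surj_card_le) auto
    then show ?thesis by (simp add: growth_fun_wlen[OF HG] card_cartesian_product)
  qed
  have "growth_fun G A H (m + n + 2 * K) \<le> growth_fun G A H (m + 2 * K) * growth_fun G A H (n + 2 * K)" for m n
  proof -
    have "m + K + (n + K) = m + n + 2 * K" "m + K + K = m + 2 * K" "n + K + K = n + 2 * K" by simp_all
    then show ?thesis using *[of "m + K" "n + K"] by (simp only:)
  qed
  then show ?thesis by blast
qed

lemma growth_rate_le_submult:
  assumes H: "subgroup H G" and stable: "stable_in_cayley G A H M k" and k: "0 \<le> k"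
  obtains \<mu> :: real and K :: nat where "growth_rate G A H = ereal \<mu>" "1 \<le> \<mu>"
    "\<And>n. \<mu> ^ n \<le> real (growth_fun G A H (n + K))"
proof -
  note HG = subgroup.subset[OF H]
  obtain K where K: "\<And>m n. growth_fun G A H (m + n + 2 * K) \<le> growth_fun G A H (m + 2 * K) * growth_fun G A H (n + 2 * K)"
    using growth_fun_submult[OF assms] by blast
  define F where "F n = growth_fun G A H (n + 2 * K)" for n
  have pos: "1 \<le> growth_fun G A H n" for n using growth_fun_pos[OF HG subgroup.one_closed[OF H]] .
  have mono: "growth_fun G A H n \<le> F n" for n
    unfolding F_def growth_fun_wlen[OF HG] by (intro card_mono finite_ball_in[OF HG]) auto
  have le: "growth_rate G A H \<le> ereal (root n (real (F n)))" if "1 \<le> n" for n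
    unfolding growth_rate_def using K pos mono that by (intro limsup_root_le) (auto simp: F_def)
  have ge: "1 \<le> growth_rate G A H"
    unfolding growth_rate_def
  proof (rule le_limsup_infinitely_often)
    fix n show "\<exists>m\<ge>n. 1 \<le> ereal (root m (real (growth_fun G A H m)))"
      using pos[of "Suc n"] by (intro exI[of _ "Suc n"]) (auto simp: one_ereal_def)
  qed
  obtain \<mu> where \<mu>: "growth_rate G A H = ereal \<mu>"
    using le[of 1] ge by (cases "growth_rate G A H") auto
  have \<mu>1: "1 \<le> \<mu>" using ge \<mu> by (simp add: one_ereal_def)
  have "\<mu> ^ n \<le> real (growth_fun G A H (n + 2 * K))" for n
  proof (cases "n = 0")
    case True
    then show ?thesis using pos[of "2 * K"] by simp
  next
    case False
    then have "\<mu> \<le> root n (real (F n))" using le[of n] \<mu> by simp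
    then have "\<mu> ^ n \<le> root n (real (F n)) ^ n" using \<mu>1 by (intro power_mono) auto
    then show ?thesis using False by (simp add: F_def)
  qed
  with \<mu> \<mu>1 show ?thesis by (rule that)
qed

text \<open>
  For every \<open>j\<close> there is an annulus \<open>j < |h| \<le> n\<close> that contributes a fixed amount: the ball of
  radius \<open>n\<close> has at least \<open>c \<mu>\<^sup>n\<close> elements, each of weight at least \<open>\<mu>\<^bsup>-n\<^esup>\<close>, and the ball of
  radius \<open>j\<close> becomes negligible for large \<open>n\<close> if \<open>\<mu> > 1\<close>. If \<open>\<mu> = 1\<close>, every element contributes
  1.
\<close>

lemma poincare_diverges:
  assumes S: "S \<subseteq> carrier G" "infinite S" and \<mu>: "1 \<le> \<mu>" and c: "0 < c"
    and growth: "\<And>n. n\<^sub>0 \<le> n \<Longrightarrow> c * \<mu> ^ n \<le> real (growth_fun G A S n)"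
  shows "\<exists>T\<subseteq>S. finite T \<and> b < (\<Sum>h\<in>T. (1 / \<mu>) ^ wlen h)"
proof -
  define q where "q = 1 / \<mu>"
  have q: "0 < q" "q \<le> 1" using \<mu> by (auto simp: q_def)
  define \<epsilon> where "\<epsilon> = min (c / 2) 1"
  have \<epsilon>: "0 < \<epsilon>" using c by (simp add: \<epsilon>_def)
  define P where "P n = (\<Sum>h\<in>{h \<in> S. wlen h \<le> n}. q ^ wlen h)" for n
  have gain: "\<exists>n. P n \<ge> P j + \<epsilon>" for j
  proof -
    let ?f = "\<lambda>n. growth_fun G A S n"
    have annulus: "P n \<ge> P j + (real (?f n) - real (?f j)) * q ^ n" if n: "j \<le> n" for n
    proof -
      let ?B = "\<lambda>n. {h \<in> S. wlen h \<le> n}"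
      have fin: "finite (?B n)" for n by (rule finite_ball_in[OF S(1)])
      have sub: "?B j \<subseteq> ?B n" using n by auto
      have "real (card (?B n - ?B j)) * q ^ n = (\<Sum>h\<in>?B n - ?B j. q ^ n)" by simp
      also have "\<dots> \<le> (\<Sum>h\<in>?B n - ?B j. q ^ wlen h)"
        using q by (intro sum_mono power_decreasing) auto
      also have "\<dots> = P n - P j" using sum_diff[OF fin sub] by (simp add: P_def)
      finally show ?thesis
        using card_Diff_subset[OF fin sub] card_mono[OF fin sub]
        by (simp add: growth_fun_wlen[OF S(1)] of_nat_diff)
    qed
    show ?thesis
    proof (cases "\<mu> = 1")
      case True
      have "\<not> S \<subseteq> {x \<in> carrier G. wlen x \<le> j}" using S(2) finite_ball finite_subset by blast
      then obtain x where x: "x \<in> S" "j < wlen x" using S(1) by (auto simp: subset_iff not_le)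
      have "{h \<in> S. wlen h \<le> j} \<subseteq> {h \<in> S. wlen h \<le> wlen x}" "x \<in> {h \<in> S. wlen h \<le> wlen x}"
        "x \<notin> {h \<in> S. wlen h \<le> j}" using x by auto
      then have "{h \<in> S. wlen h \<le> j} \<subset> {h \<in> S. wlen h \<le> wlen x}" by blast
      then have "?f j < ?f (wlen x)"
        unfolding growth_fun_wlen[OF S(1)] by (intro psubset_card_mono finite_ball_in[OF S(1)])
      then have "1 \<le> (real (?f (wlen x)) - real (?f j)) * q ^ wlen x" using True by (simp add: q_def)
      then show ?thesis using annulus[of "wlen x"] x by (intro exI[of _ "wlen x"]) (auto simp: \<epsilon>_def)
    next
      case False
      then have "(\<lambda>n. real (?f j) * q ^ n) \<longlonglongrightarrow> real (?f j) * 0"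
        using \<mu> by (intro tendsto_mult tendsto_const LIMSEQ_power_zero) (auto simp: q_def)
      then have "eventually (\<lambda>n. real (?f j) * q ^ n < c / 2) sequentially"
        using c by (intro order_tendstoD(2)[of _ "real (?f j) * 0"]) auto
      then have "eventually (\<lambda>n. real (?f j) * q ^ n < c / 2 \<and> n\<^sub>0 \<le> n \<and> j \<le> n) sequentially"
        by (intro eventually_conj eventually_ge_at_top)
      then obtain n where n: "real (?f j) * q ^ n < c / 2" "n\<^sub>0 \<le> n" "j \<le> n"
        by (auto simp: eventually_sequentially)
      have "c = c * \<mu> ^ n * q ^ n" using \<mu> by (simp add: q_def power_divide)
      also have "\<dots> \<le> real (?f n) * q ^ n" using growth[OF n(2)] q by (intro mult_right_mono) auto
      finally have "c / 2 \<le> (real (?f n) - real (?f j)) * q ^ n" using n(1) by (simp add: left_diff_distrib)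
      then show ?thesis using annulus[OF n(3)] by (intro exI[of _ n]) (auto simp: \<epsilon>_def)
    qed
  qed
  have "\<exists>n. P n \<ge> real N * \<epsilon>" for N
  proof (induction N)
    case 0
    have "0 \<le> P 0" using q by (auto simp: P_def intro!: sum_nonneg)
    then show ?case by auto
  next
    case (Suc N)
    then obtain n where "P n \<ge> real N * \<epsilon>" by blast
    moreover obtain n' where "P n' \<ge> P n + \<epsilon>" using gain by blast
    ultimately have "P n' \<ge> real (Suc N) * \<epsilon>" by (simp add: algebra_simps)
    then show ?case by blast
  qed
  moreover obtain N :: nat where "b / \<epsilon> < real N" using reals_Archimedean2 by blast
  then have "b < real N * \<epsilon>" using \<epsilon> by (simp add: field_simps)
  ultimately obtain n where "b < P n" by (meson less_le_trans)
  then show ?thesis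
    using finite_ball_in[OF S(1)] by (intro exI[of _ "{h \<in> S. wlen h \<le> n}"]) (auto simp: P_def q_def)
qed

lemma sum_lists_length:
  fixes w :: "'a \<Rightarrow> real"
  assumes "finite T"
  shows "(\<Sum>hs\<in>{hs. set hs \<subseteq> T \<and> length hs = m}. \<Prod>h\<leftarrow>hs. w h) = (\<Sum>h\<in>T. w h) ^ m"
proof (induction m)
  case 0
  have "{hs. set hs \<subseteq> T \<and> length hs = 0} = {[]}" by auto
  then show ?case by simp
next
  case (Suc m)
  let ?L = "\<lambda>m. {hs. set hs \<subseteq> T \<and> length hs = m}"
  have "?L (Suc m) = (\<lambda>(h, hs). h # hs) ` (T \<times> ?L m)"
    by (auto simp: length_Suc_conv image_def)
  moreover have "inj_on (\<lambda>(h, hs). h # hs) (T \<times> ?L m)" by (auto intro: inj_onI)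
  ultimately have "(\<Sum>hs\<in>?L (Suc m). \<Prod>h\<leftarrow>hs. w h) = (\<Sum>(h, hs)\<in>T \<times> ?L m. w h * (\<Prod>h\<leftarrow>hs. w h))"
    by (simp add: sum.reindex case_prod_unfold)
  also have "\<dots> = (\<Sum>h\<in>T. w h) * (\<Sum>hs\<in>?L m. \<Prod>h\<leftarrow>hs. w h)"
    by (simp add: sum_product sum.cartesian_product)
  finally show ?case using Suc by simp
qed

text \<open>
  Let \<open>s > 1\<close> be the sum over \<open>T\<close> and \<open>W\<close> a bound for the weights. The words with \<open>m\<close> letters
  have total \<open>s\<^sup>m\<close>, spread over the weights \<open>n \<le> m W\<close>, so for one of these \<open>n\<close> the ball of
  radius \<open>n\<close> in \<open>G\<close> has at least \<open>q\<^bsup>-n\<^esup> s\<^sup>m / (m W + 1)\<close> elements. Half of the exponent of \<open>s\<close>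
  beats the denominator, and the other half is at least \<open>\<rho>\<^sup>n\<close> with \<open>\<rho>\<close> the \<open>2 W\<close>-th root of \<open>s\<close>.
\<close>

lemma growth_rate_gt_of_injective:
  assumes g: "g \<in> carrier G" and T: "finite T" "T \<subseteq> carrier G"
    and inj: "inj_on (alt_prod g) (lists T)"
    and q: "0 < q" and \<sigma>: "1 < (\<Sum>h\<in>T. q ^ (wlen h + wlen g))"
  shows "ereal (1 / q) < growth_rate G A (carrier G)"
proof -
  define s where "s = (\<Sum>h\<in>T. q ^ (wlen h + wlen g))"
  define wt where "wt hs = (\<Sum>h\<leftarrow>hs. wlen h + wlen g)" for hs
  define W where "W = Suc (Max ((\<lambda>h. wlen h + wlen g) ` T))"
  have W: "wlen h + wlen g \<le> W" if "h \<in> T" for h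
    using that T(1) by (auto simp: W_def intro: le_SucI)
  have wt_le: "wt hs \<le> length hs * W" if "set hs \<subseteq> T" for hs
    using that by (induction hs) (auto simp: wt_def dest!: W)
  have wlen_wt: "alt_prod g hs \<in> carrier G \<and> wlen (alt_prod g hs) \<le> wt hs" if "set hs \<subseteq> T" for hs
    using that
  proof (induction hs)
    case (Cons h hs)
    then have c: "h \<in> carrier G" "alt_prod g hs \<in> carrier G" using T by auto
    have "wlen (h \<otimes> g \<otimes> alt_prod g hs) \<le> wlen h + wlen g + wlen (alt_prod g hs)"
      using wlen_mult[of "h \<otimes> g" "alt_prod g hs"] wlen_mult[of h g] c g by simp
    then show ?case using Cons c g by (simp add: wt_def)
  qed (simp add: wt_def)
  let ?f = "growth_fun G A (carrier G)"
  let ?L = "\<lambda>m. {hs. set hs \<subseteq> T \<and> length hs = m}"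
  have finL: "finite (?L m)" for m using finite_lists_length_eq[OF T(1)] .
  have word_count: "card {hs \<in> ?L m. wt hs = n} \<le> ?f n" for m n
  proof -
    have "inj_on (alt_prod g) {hs \<in> ?L m. wt hs = n}" using inj by (rule inj_on_subset) auto
    moreover have "alt_prod g ` {hs \<in> ?L m. wt hs = n} \<subseteq> {x \<in> carrier G. wlen x \<le> n}"
      using wlen_wt by auto
    ultimately show ?thesis
      unfolding growth_fun_wlen[OF order.refl] using finite_ball by (rule card_inj_on_le)
  qed
  have many: "\<exists>n\<le>m * W. s ^ m \<le> real (m * W + 1) * (real (?f n) * q ^ n)" for m
  proof (rule ccontr)
    assume *: "\<not> ?thesis"
    have "s ^ m = (\<Sum>hs\<in>?L m. q ^ wt hs)"
    proof -
      have "(\<Prod>h\<leftarrow>hs. q ^ (wlen h + wlen g)) = q ^ wt hs" for hs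
        by (induction hs) (auto simp: wt_def power_add)
      then show ?thesis using sum_lists_length[OF T(1), of "\<lambda>h. q ^ (wlen h + wlen g)" m] by (simp add: s_def)
    qed
    also have "\<dots> = (\<Sum>n\<in>{..m * W}. \<Sum>hs\<in>{hs \<in> ?L m. wt hs = n}. q ^ wt hs)"
      using finL wt_le by (intro sum.group[symmetric]) auto
    also have "\<dots> = (\<Sum>n\<in>{..m * W}. real (card {hs \<in> ?L m. wt hs = n}) * q ^ n)"
      by (intro sum.cong) auto
    also have "\<dots> \<le> (\<Sum>n\<in>{..m * W}. real (?f n) * q ^ n)"
      using word_count q by (intro sum_mono mult_right_mono) auto
    also have "\<dots> < (\<Sum>n\<in>{..m * W}. s ^ m / real (m * W + 1))"
    proof (rule sum_strict_mono)
      fix n assume "n \<in> {..m * W}"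
      then have "real (m * W + 1) * (real (?f n) * q ^ n) < s ^ m" using * by force
      moreover have "0 < real (m * W + 1)" by (simp only: of_nat_0_less_iff)
      ultimately show "real (?f n) * q ^ n < s ^ m / real (m * W + 1)"
        by (simp only: pos_less_divide_eq mult.commute)
    qed auto
    also have "\<dots> = s ^ m" by (simp del: of_nat_add of_nat_mult)
    finally show False by simp
  qed
  define \<rho> where "\<rho> = root (2 * W) s"
  have W1: "1 \<le> W" by (simp add: W_def)
  have \<rho>1: "1 < \<rho>" using \<sigma> W1 by (simp add: \<rho>_def s_def)
  have \<rho>W: "s = \<rho> ^ W * \<rho> ^ W" using \<sigma> W1 by (simp add: \<rho>_def s_def flip: power_add mult_2)
  define x where "x = \<rho> ^ W"
  have x1: "1 < x" using \<rho>1 W1 by (simp add: x_def one_less_power)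
  have ev: "eventually (\<lambda>m. real (m * W + 1) \<le> x ^ m) sequentially"
  proof -
    have x0: "norm (1 / x) < 1" using x1 by simp
    have "(\<lambda>m. real W * (real m * (1 / x) ^ m) + (1 / x) ^ m) \<longlonglongrightarrow> real W * 0 + 0"
      by (intro tendsto_add tendsto_mult tendsto_const powser_times_n_limit_0[OF x0] LIMSEQ_power_zero[OF x0])
    then have "eventually (\<lambda>m. real W * (real m * (1 / x) ^ m) + (1 / x) ^ m < 1) sequentially"
      by (intro order_tendstoD(2)) auto
    then show ?thesis
      by eventually_elim (use x1 in \<open>auto simp: field_simps power_divide\<close>)
  qed
  then obtain m\<^sub>0 where m0: "\<And>m. m\<^sub>0 \<le> m \<Longrightarrow> real (m * W + 1) \<le> x ^ m"
    by (auto simp: eventually_sequentially)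
  have good: "\<exists>n. n \<le> m * W \<and> x ^ m \<le> real (?f n) * q ^ n" if m: "m\<^sub>0 \<le> m" for m
  proof -
    obtain n where n: "n \<le> m * W" "s ^ m \<le> real (m * W + 1) * (real (?f n) * q ^ n)" using many by blast
    have "x ^ m * x ^ m = s ^ m" by (simp add: \<rho>W x_def power_mult_distrib)
    also have "\<dots> \<le> x ^ m * (real (?f n) * q ^ n)"
      using n(2) m0[OF m] q by (meson mult_right_mono order_trans of_nat_0_le_iff mult_nonneg_nonneg zero_le_power less_imp_le)
    finally show ?thesis using n(1) x1 by auto
  qed
  have "ereal (\<rho> / q) \<le> growth_rate G A (carrier G)"
    unfolding growth_rate_def
  proof (rule le_limsup_infinitely_often)
    fix n\<^sub>1
    \<comment> \<open>The weights \<open>n\<close> are unbounded as \<open>m\<close> grows, since \<open>?f n * q ^ n\<close> stays below \<open>b\<close> for \<open>n \<le> n\<^sub>1\<close>.\<close>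
    define b where "b = (\<Sum>n\<le>n\<^sub>1. real (?f n) * q ^ n)"
    obtain m\<^sub>1 where m1: "b < x ^ m\<^sub>1" using real_arch_pow[OF x1] by blast
    define m where "m = max m\<^sub>0 m\<^sub>1"
    obtain n where n: "n \<le> m * W" "x ^ m \<le> real (?f n) * q ^ n" using good[of m] by (auto simp: m_def)
    have "n\<^sub>1 < n"
    proof (rule ccontr)
      assume "\<not> n\<^sub>1 < n"
      then have "real (?f n) * q ^ n \<le> b"
        unfolding b_def using q by (intro member_le_sum) auto
      moreover have "x ^ m\<^sub>1 \<le> x ^ m" using x1 by (intro power_increasing) (auto simp: m_def)
      ultimately show False using m1 n(2) by linarith
    qed
    have "\<rho> ^ n \<le> \<rho> ^ (m * W)" using n(1) \<rho>1 by (intro power_increasing) auto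
    also have "\<dots> = x ^ m" by (simp add: x_def mult.commute flip: power_mult)
    also have "\<dots> \<le> real (?f n) * q ^ n" by fact
    finally have "(\<rho> / q) ^ n \<le> real (?f n)" using q by (simp add: power_divide field_simps)
    then have "root n ((\<rho> / q) ^ n) \<le> root n (real (?f n))" using \<open>n\<^sub>1 < n\<close> by (intro real_root_le_mono) auto
    then have "\<rho> / q \<le> root n (real (?f n))" using \<open>n\<^sub>1 < n\<close> \<rho>1 q by (simp add: real_root_power_cancel)
    then show "\<exists>m\<ge>n\<^sub>1. ereal (\<rho> / q) \<le> ereal (root m (real (?f m)))"
      using \<open>n\<^sub>1 < n\<close> by (intro exI[of _ n]) auto
  qed
  moreover have "1 / q < \<rho> / q" using \<rho>1 q by (simp add: divide_strict_right_mono)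
  ultimately show ?thesis by (metis ereal_less_eq(3) less_le_trans less_ereal.simps(1))
qed

end

section \<open>Residually finite subgroups\<close>

text \<open>
  \<open>K\<close> is the intersection of subgroups of finite index that avoid one nontrivial element of
  \<open>S \<inter> H\<close> each. Finite index is expressed by a finite set \<open>R\<close> of coset representatives; it
  contains one element for every tuple of cosets that occurs.
\<close>

lemma (in group) residually_finite_avoid:
  assumes H: "subgroup H G" and rf: "residually_finite (G\<lparr>carrier := H\<rparr>)" and S: "finite S"
  shows "\<exists>K R. subgroup K G \<and> K \<subseteq> H \<and> K \<inter> S \<subseteq> {\<one>} \<and> finite R \<and> R \<subseteq> H \<and> (\<forall>h\<in>H. \<exists>r\<in>R. h \<otimes> inv r \<in> K)"
proof -
  let ?H = "G\<lparr>carrier := H\<rparr>"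
  note HG = subgroup.subset[OF H]
  define S' where "S' = S \<inter> H - {\<one>}"
  have finS': "finite S'" using S by (simp add: S'_def)
  have "\<exists>N. N \<lhd> ?H \<and> finite (rcosets\<^bsub>?H\<^esub> N) \<and> x \<notin> N" if "x \<in> S'" for x
    using rf that by (auto simp: residually_finite_def S'_def)
  then obtain N where N: "\<And>x. x \<in> S' \<Longrightarrow> N x \<lhd> ?H" "\<And>x. x \<in> S' \<Longrightarrow> finite (rcosets\<^bsub>?H\<^esub> (N x))"
    "\<And>x. x \<in> S' \<Longrightarrow> x \<notin> N x" by metis
  have NG: "subgroup (N x) G" if "x \<in> S'" for x
    using incl_subgroup[OF H] N(1)[OF that] by (simp add: normal_def)
  have NH: "N x \<subseteq> H" if "x \<in> S'" for x
    using N(1)[OF that] subgroup.subset[of "N x" ?H] by (simp add: normal_def)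
  define K where "K = \<Inter> (insert H (N ` S'))"
  have K: "subgroup K G" unfolding K_def using H NG by (intro subgroups_Inter) auto
  have "K \<inter> S \<subseteq> {\<one>}" using N(3) by (auto simp: K_def S'_def)
  define \<phi> where "\<phi> h = restrict (\<lambda>x. N x #> h) S'" for h
  have "N x #> h \<in> rcosets\<^bsub>?H\<^esub> (N x)" if "h \<in> H" for x h
    unfolding RCOSETS_def r_coset_def using that by simp blast
  then have "\<phi> ` H \<subseteq> PiE S' (\<lambda>x. rcosets\<^bsub>?H\<^esub> (N x))" by (auto simp: \<phi>_def)
  moreover have "finite (PiE S' (\<lambda>x. rcosets\<^bsub>?H\<^esub> (N x)))" using finS' N(2) by (intro finite_PiE) auto
  ultimately have fin: "finite (\<phi> ` H)" by (rule finite_subset)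
  define R where "R = inv_into H \<phi> ` (\<phi> ` H)"
  have "R \<subseteq> H" by (auto simp: R_def intro: inv_into_into)
  moreover have "\<exists>r\<in>R. h \<otimes> inv r \<in> K" if h: "h \<in> H" for h
  proof -
    define r where "r = inv_into H \<phi> (\<phi> h)"
    have r: "r \<in> R" "r \<in> H" "\<phi> r = \<phi> h" using h by (auto simp: R_def r_def inv_into_into f_inv_into_f)
    have c: "h \<in> carrier G" "r \<in> carrier G" using h r HG by auto
    have "h \<otimes> inv r \<in> N x" if x: "x \<in> S'" for x
    proof -
      have "N x #> r = N x #> h" using fun_cong[OF r(3), of x] x by (simp add: \<phi>_def)
      moreover have "h \<in> N x #> h" using subgroup.one_closed[OF NG[OF x]] c by (auto simp: r_coset_def intro!: bexI[of _ \<one>])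
      ultimately obtain n where n: "n \<in> N x" "h = n \<otimes> r" by (auto simp: r_coset_def)
      then have "n \<in> carrier G" using NG[OF x] subgroup.subset by blast
      then show ?thesis using n c by (simp add: m_assoc)
    qed
    then have "h \<otimes> inv r \<in> K"
      using h r subgroup.m_closed[OF H] subgroup.m_inv_closed[OF H] by (auto simp: K_def)
    with r show ?thesis by blast
  qed
  moreover have "finite R" using fin by (simp add: R_def)
  moreover have "K \<subseteq> H" by (auto simp: K_def)
  ultimately show ?thesis using K \<open>K \<inter> S \<subseteq> {\<one>}\<close> by blast
qed

section \<open>Comparison of the growth rates\<close>

context word_metric begin

lemma growth_rate_finite_le:
  assumes "finite S" "S \<subseteq> carrier G"
  shows "growth_rate G A S \<le> 1"
proof -
  define C where "C = Suc (card S)"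
  have "growth_fun G A S n \<le> C" for n
    using card_mono[OF assms(1), of "{x \<in> S. wlen x \<le> n}"] by (simp add: growth_fun_wlen assms C_def)
  then have "root n (real (growth_fun G A S n)) \<le> root n (real C)" if "1 \<le> n" for n
    using that by (simp add: real_root_le_iff)
  then have "growth_rate G A S \<le> limsup (\<lambda>n. ereal (root n (real C)))"
    unfolding growth_rate_def by (intro Limsup_mono) (auto simp: eventually_sequentially intro!: exI[of _ 1])
  also have "\<dots> = ereal 1"
    by (intro lim_imp_Limsup) (auto simp: C_def intro!: LIMSEQ_root_const)
  finally show ?thesis by (simp add: one_ereal_def)
qed

lemma growth_fun_finite_index:
  assumes H: "H \<subseteq> carrier G" and K: "K \<subseteq> carrier G" and R: "finite R" "R \<subseteq> carrier G"
    and cover: "\<And>h. h \<in> H \<Longrightarrow> \<exists>r\<in>R. h \<otimes> inv r \<in> K"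
  obtains r :: nat where "\<And>n. growth_fun G A H n \<le> growth_fun G A K (n + r) * card R"
proof -
  define r where "r = Max (insert 0 (wlen ` R))"
  have r: "wlen x \<le> r" if "x \<in> R" for x using that R(1) by (auto simp: r_def)
  have "growth_fun G A H n \<le> growth_fun G A K (n + r) * card R" for n
  proof -
    let ?K = "{x \<in> K. wlen x \<le> n + r}"
    have "{x \<in> H. wlen x \<le> n} \<subseteq> (\<lambda>(k, x). k \<otimes> x) ` (?K \<times> R)"
    proof
      fix h assume h: "h \<in> {x \<in> H. wlen x \<le> n}"
      then obtain x where x: "x \<in> R" "h \<otimes> inv x \<in> K" using cover by blast
      have c: "h \<in> carrier G" "x \<in> carrier G" using h x H R by auto
      have "wlen (h \<otimes> inv x) \<le> n + r"
        using wlen_mult[of h "inv x"] r[OF x(1)] h c wlen_inv[OF c(2)] by simp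
      then show "h \<in> (\<lambda>(k, x). k \<otimes> x) ` (?K \<times> R)"
        using x c by (intro image_eqI[of _ _ "(h \<otimes> inv x, x)"]) (auto simp: m_assoc)
    qed
    then have "card {x \<in> H. wlen x \<le> n} \<le> card (?K \<times> R)"
      using finite_ball_in[OF K] R by (intro surj_card_le) auto
    then show ?thesis by (simp add: growth_fun_wlen H K card_cartesian_product)
  qed
  then show ?thesis by (rule that)
qed

text \<open>
  The growth function of \<open>K\<close> is that of \<open>H\<close> up to a factor and a shift, so the sum over \<open>K\<close>
  diverges at the growth rate of \<open>H\<close>.
\<close>

lemma growth_rate_less:
  assumes H: "subgroup H G" "infinite H" and stable: "stable_in_cayley G A H M k" "0 \<le> k"
    and K: "subgroup K G" "K \<subseteq> H" and R: "finite R" "R \<subseteq> H" "\<And>h. h \<in> H \<Longrightarrow> \<exists>r\<in>R. h \<otimes> inv r \<in> K"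
    and g: "g \<in> carrier G" and inj: "inj_on (alt_prod g) (lists (K - {\<one>}))"
  shows "growth_rate G A H < growth_rate G A (carrier G)"
proof -
  note HG = subgroup.subset[OF H(1)]
  have KG: "K \<subseteq> carrier G" "R \<subseteq> carrier G" using K R HG by auto
  obtain \<mu> :: real and m :: nat where \<mu>: "growth_rate G A H = ereal \<mu>" "1 \<le> \<mu>"
    "\<And>n. \<mu> ^ n \<le> real (growth_fun G A H (n + m))"
    using growth_rate_le_submult[OF H(1) stable] by blast
  obtain r :: nat where r: "\<And>n. growth_fun G A H n \<le> growth_fun G A K (n + r) * card R"
    using growth_fun_finite_index[OF HG KG(1) R(1) KG(2) R(3)] by blast
  have "infinite K"
  proof
    assume "finite K"
    moreover have "H \<subseteq> (\<lambda>(k, x). k \<otimes> x) ` (K \<times> R)"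
    proof
      fix h assume h: "h \<in> H"
      then obtain x where x: "x \<in> R" "h \<otimes> inv x \<in> K" using R(3) by blast
      then show "h \<in> (\<lambda>(k, x). k \<otimes> x) ` (K \<times> R)"
        using h HG KG by (intro image_eqI[of _ _ "(h \<otimes> inv x, x)"]) (auto simp: m_assoc subset_iff)
    qed
    ultimately show False using H(2) R(1) by (meson finite_SigmaI finite_imageI finite_subset)
  qed
  define c where "c = 1 / (real (Suc (card R)) * \<mu> ^ (m + r))"
  have c: "0 < c" using \<mu>(2) by (simp add: c_def)
  have growth: "c * \<mu> ^ n \<le> real (growth_fun G A K n)" if n: "m + r \<le> n" for n
  proof -
    have "\<mu> ^ (n - (m + r)) \<le> real (growth_fun G A H (n - r))"
      using \<mu>(3)[of "n - (m + r)"] n by simp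
    also have "\<dots> \<le> real (growth_fun G A K n * card R)" using r[of "n - r"] n by (simp del: of_nat_mult)
    also have "\<dots> \<le> real (growth_fun G A K n) * real (Suc (card R))" by (simp add: mult_left_mono)
    finally have "\<mu> ^ (n - (m + r)) \<le> real (growth_fun G A K n) * real (Suc (card R))" .
    moreover have "\<mu> ^ n = \<mu> ^ (n - (m + r)) * \<mu> ^ (m + r)" using n by (simp flip: power_add)
    ultimately show ?thesis
      using \<mu>(2) by (simp add: c_def divide_le_eq mult.commute mult.left_commute)
  qed
  define q where "q = 1 / \<mu>"
  have q: "0 < q" "q \<le> 1" using \<mu>(2) by (auto simp: q_def)
  obtain T where T: "T \<subseteq> K" "finite T" "1 / q ^ wlen g + 1 < (\<Sum>h\<in>T. q ^ wlen h)"
    using poincare_diverges[OF KG(1) \<open>infinite K\<close> \<mu>(2) c growth, where b = "1 / q ^ wlen g + 1"] by (auto simp: q_def)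
  \<comment> \<open>The summand 1 in the choice of \<open>T\<close> pays for removing \<open>\<one>\<close>.\<close>
  have "(\<Sum>h\<in>T. q ^ wlen h) \<le> (\<Sum>h\<in>insert \<one> (T - {\<one>}). q ^ wlen h)"
    using T(2) q by (intro sum_mono2) auto
  also have "\<dots> = 1 + (\<Sum>h\<in>T - {\<one>}. q ^ wlen h)" using T(2) by (subst sum.insert) auto
  finally have "1 / q ^ wlen g < (\<Sum>h\<in>T - {\<one>}. q ^ wlen h)" using T(3) by linarith
  then have "1 < (\<Sum>h\<in>T - {\<one>}. q ^ wlen h) * q ^ wlen g" using q by (simp add: pos_divide_less_eq)
  then have "1 < (\<Sum>h\<in>T - {\<one>}. q ^ (wlen h + wlen g))" by (simp add: power_add sum_distrib_right)
  moreover have "inj_on (alt_prod g) (lists (T - {\<one>}))"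
    using inj lists_mono[of "T - {\<one>}" "K - {\<one>}"] T(1) by (meson Diff_mono inj_on_subset order.refl)
  ultimately have "ereal (1 / q) < growth_rate G A (carrier G)"
    using T KG g q by (intro growth_rate_gt_of_injective) auto
  then show ?thesis by (simp add: \<mu>(1) q_def)
qed

end

theorem theorem2:
  fixes G :: "('a, 'b) monoid_scheme" and H A :: "'a set"
  assumes "morse_local_to_global_group G"
    and "stable_subgroup G H"
    and "infinite (rcosets\<^bsub>G\<^esub> H)"
    and "residually_finite (G\<lparr>carrier := H\<rparr>)"
    and "finite_sym_generating_set G A"
    and nondegenerate: "finite H \<longrightarrow> 1 < growth_rate G A (carrier G)"
  shows "growth_rate G A H < growth_rate G A (carrier G)"
proof -
  interpret group G using assms(1) by (simp add: morse_local_to_global_group_def)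
  interpret A: word_metric G A using assms(5) by unfold_locales
  have H: "subgroup H G" using assms(2) by (simp add: stable_subgroup_def)
  note HG = subgroup.subset[OF H]
  show ?thesis
  proof (cases "finite H")
    case True
    then show ?thesis using A.growth_rate_finite_le[OF True HG] nondegenerate by (auto intro: le_less_trans)
  next
    case False
    obtain B where B: "finite_sym_generating_set G B"
      and ltg: "morse_local_to_global_space (cayley_points G B) (cayley_dist G B)"
      using assms(1) by (auto simp: morse_local_to_global_group_def)
    interpret B: word_metric G B using B by unfold_locales
    obtain M k where M: "morse_gauge M" "0 \<le> k" "stable_in_cayley G B H M k"
      using assms(2) B by (auto simp: stable_subgroup_def)
    interpret B: stable_in_word_metric G B H "\<lambda>k c. M k c + 1" k
      using M H B.stable_geo[OF M(3) HG]
      by (intro stable_in_word_metric.intro stable_in_word_metric_axioms.intro B.word_metric_axioms)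
         (auto simp: morse_gauge_def intro: add_nonneg_nonneg)
    obtain g S where g: "g \<in> carrier G" "finite S"
      "\<And>K. subgroup K G \<Longrightarrow> K \<subseteq> H \<Longrightarrow> K \<inter> S \<subseteq> {\<one>\<^bsub>G\<^esub>} \<Longrightarrow> inj_on (alt_prod g) (lists (K - {\<one>\<^bsub>G\<^esub>}))"
      using B.alt_prod_injective[OF B.local_to_global_word_metric[OF ltg] assms(3)] by blast
    obtain K R where K: "subgroup K G" "K \<subseteq> H" "K \<inter> S \<subseteq> {\<one>\<^bsub>G\<^esub>}" "finite R" "R \<subseteq> H"
      "\<And>h. h \<in> H \<Longrightarrow> \<exists>r\<in>R. h \<otimes>\<^bsub>G\<^esub> inv\<^bsub>G\<^esub> r \<in> K"
      using residually_finite_avoid[OF H assms(4) g(2)] by blast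
    obtain M' k' where "stable_in_cayley G A H M' k'" "0 \<le> k'"
      using assms(2,5) by (auto simp: stable_subgroup_def)
    then show ?thesis
      using A.growth_rate_less[OF H False _ _ K(1,2,4,5,6) g(1) g(3)[OF K(1-3)]] by blast
  qed
qed

end
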